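(* Consider triples of $3$-dimensional lattice polytopes $P_1,P_2,P_3 \subset \mathbb{R}^3$ for which there exist lattice projections $\varphi_1,\varphi_2,\varphi_3 \colon \mathbb{R}^3 \to \mathbb{R}^2$ such that (1) for all $i,j,k\in\{1,2,3\}$, the images $\varphi_k(P_i)$ and $\varphi_k(P_j)$ are both translates of $\Delta_2$ if and only if $i \neq k$ and $j\neq k$; and (2) the projection directions $v_1,v_2,v_3\in\mathbb{Z}^3$ of $\varphi_1,\varphi_2,\varphi_3$ linearly span $\mathbb{R}^2\times\{0\}$. Up to equivalence there are infinitely many such triples. All of them are, up to equivalence, contained in one of the triples $Q_k,R_k,\square_3$, $k\in\mathbb{Z}_{\geq 0}$, each of which has mixed degree two, where \begin{align*} Q_k &= \mathrm{conv}(\mathbf{0},\mathbf{e}_1-\mathbf{e}_2) + \mathrm{conv}(\mathbf{0},\mathbf{e}_2) + \mathrm{conv}(\mathbf{0},k \mathbf{e}_2 + \mathbf{e}_3),\\ R_k &= \mathrm{conv}(\mathbf{0},\mathbf{e}_2-\mathbf{e}_1) + \mathrm{conv}(\mathbf{0},\mathbf{e}_1) + \mathrm{conv}(\mathbf{0},k \mathbf{e}_1 + \mathbf{e}_3),\\ \square_3 &= \mathrm{conv}(\mathbf{0},\mathbf{e}_1) + \mathrm{conv}(\mathbf{0},\mathbf{e}_2) + \mathrm{conv}(\mathbf{0}, \mathbf{e}_3). \end{align*} Moreover, these triples can be covered, up to equivalence, by a finite number of $1$-parameter families. In particular, denoting by $\psi_1^k$ the shearing $(x,y,z) \mapsto (x,y+kz,z)$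 and by $\psi_2^k$ the shearing $(x,y,z) \mapsto (x+kz,y,z)$, one may choose as covering families the families $\{(\psi_1^k(P^0_1),\psi_2^k(P^0_2),P_3)\}_{k \in \mathbb{Z}_{\geq 0}}$ for all ($3$-dimensional lattice) subpolytopes $P_1^0 \subset Q_0$, $P_2^0 \subset R_0$ and $P_3 \subset \square_3$ satisfying $\mathrm{md}(P_1^0,P_2^0,P_3) = 1$.
   Context: A lattice polytope in $\mathbb{R}^3$ is a polytope with all vertices in $\mathbb{Z}^3$. Sums of polytopes are Minkowski sums. $\Delta_2 = \mathrm{conv}(\mathbf{0},\mathbf{e}_1,\mathbf{e}_2) \subset \mathbb{R}^2$; translates are by vectors of $\mathbb{Z}^2$. A lattice projection is a surjective affine-linear map $\varphi\colon \mathbb{R}^3 \to \mathbb{R}^2$ with $\varphi(\mathbb{Z}^3)=\mathbb{Z}^2$; its projection direction is the primitive vector $v\in\mathbb{Z}^3$ (unique up to sign) spanning the kernel of its linear part. Two triples $P_1,P_2,P_3$ and $Q_1,Q_2,Q_3$ of lattice polytopes in $\mathbb{R}^3$ are equivalent if there are a permutation $\sigma$ of $\{1,2,3\}$, an affine bijection $U\colon\mathbb{R}^3\to\mathbb{R}^3$ with $U(\mathbb{Z}^3)=\mathbb{Z}^3$, and $t_1,t_2,t_3 \in \mathbb{Z}^3$ with $P_i = U(Q_{\sigma(i)})+t_i$ for all $i$. A triple $P_1,P_2,P_3$ is, up to equivalence, contained in a triple $A_1,A_2,A_3$ if it is equivalent to a triple $P_1',P_2',P_3'$ with $P_i'\subseteq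 A_i$ for all $i$. A set of triples is covered, up to equivalence, by a collection of families if every triple in the set is equivalent to a member of one of the families. A lattice polytope in $\mathbb{R}^3$ is hollow if its interior contains no point of $\mathbb{Z}^3$. The mixed degree $\mathrm{md}(P_1,P_2,P_3)$ is $3$ if some $P_i$ has an interior lattice point; otherwise it is the smallest integer $0 \leq d \leq 2$ such that the Minkowski sum of any choice of $3-d$ polytopes of the triple (over distinct indices) is hollow. *)

theory Defs
  imports "HOL-Analysis.Analysis"
begin

definition int_lattice :: "(real^'n) set" where
  "int_lattice = {x. \<forall>i. x $ i \<in> \<int>}"

definition lattice_polytope :: "(real^'n) set \<Rightarrow> bool" where
  "lattice_polytope P \<longleftrightarrow> polytope P \<and> {v. v extreme_point_of P} \<subseteq> int_lattice"

definition hollow :: "(real^'n) set \<Rightarrow> bool" where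
  "hollow P \<longleftrightarrow> interior P \<inter> int_lattice = {}"

definition affine_linear :: "(real^'m \<Rightarrow> real^'n) \<Rightarrow> bool" where
  "affine_linear f \<longleftrightarrow> linear (\<lambda>x. f x - f 0)"

definition lattice_projection :: "(real^3 \<Rightarrow> real^2) \<Rightarrow> bool" where
  "lattice_projection \<phi> \<longleftrightarrow> affine_linear \<phi> \<and> surj \<phi> \<and> \<phi> ` int_lattice = int_lattice"

definition primitive :: "real^'n \<Rightarrow> bool" where
  "primitive v \<longleftrightarrow> v \<in> int_lattice \<and> Gcd (range (\<lambda>i. \<lfloor>v $ i\<rfloor>)) = 1"

definition projection_direction :: "(real^3 \<Rightarrow> real^2) \<Rightarrow> real^3 \<Rightarrow> bool" where
  "projection_direction \<phi> v \<longleftrightarrow> primitive v \<and> span {v} = {x. \<phi> x - \<phi> 0 = 0}"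

definition unimodular_triangle :: "(real^2) set" where
  "unimodular_triangle = convex hull {0, axis 1 1, axis 2 1}"

definition triangle_translate :: "(real^2) set \<Rightarrow> bool" where
  "triangle_translate T \<longleftrightarrow> (\<exists>t\<in>int_lattice. T = (+) t ` unimodular_triangle)"

text \<open>
  Triples of polytopes are functions on the three-element type \<^typ>\<open>3\<close>, whose elements
  are 1, 2 and 3 (the numeral 3 equals 0 in this type). Addition and sums of sets are the
  Minkowski operations of \<^theory>\<open>HOL-Library.Set_Algebras\<close>.
\<close>

type_synonym triple = "3 \<Rightarrow> (real^3) set"

definition triple :: "(real^3) set \<Rightarrow> (real^3) set \<Rightarrow> (real^3) set \<Rightarrow> triple" where
  "triple A B C = (\<lambda>i. if i = 1 then A else if i = 2 then B else C)"

definition lattice_automorphism :: "(real^3 \<Rightarrow> real^3) \<Rightarrow> bool" where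
  "lattice_automorphism U \<longleftrightarrow> affine_linear U \<and> bij U \<and> U ` int_lattice = int_lattice"

definition triple_equiv :: "triple \<Rightarrow> triple \<Rightarrow> bool" where
  "triple_equiv P Q \<longleftrightarrow>
     (\<exists>\<sigma> U t. bij \<sigma> \<and> lattice_automorphism U \<and>
        (\<forall>i. t i \<in> int_lattice \<and> P i = (+) (t i) ` U ` Q (\<sigma> i)))"

definition contained_up_to_equiv :: "triple \<Rightarrow> triple \<Rightarrow> bool" where
  "contained_up_to_equiv P A \<longleftrightarrow> (\<exists>P'. triple_equiv P P' \<and> (\<forall>i. P' i \<subseteq> A i))"

text \<open>A one-parameter family is a sequence of triples indexed by the nonnegative integers.\<close>

definition covered_up_to_equiv :: "triple set \<Rightarrow> (nat \<Rightarrow> triple) set \<Rightarrow> bool" where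
  "covered_up_to_equiv T \<F> \<longleftrightarrow> (\<forall>P\<in>T. \<exists>F\<in>\<F>. \<exists>k. triple_equiv P (F k))"

definition mixed_degree :: "triple \<Rightarrow> nat" where
  "mixed_degree P =
     (if \<exists>i. \<not> hollow (P i) then 3
      else LEAST d. d \<le> 2 \<and> (\<forall>I. card I = 3 - d \<longrightarrow> hollow (\<Sum>i\<in>I. P i)))"

definition lattice_polytope_3d :: "(real^3) set \<Rightarrow> bool" where
  "lattice_polytope_3d P \<longleftrightarrow> lattice_polytope P \<and> aff_dim P = 3"

definition projecting_triples :: "triple set" where
  "projecting_triples =
     {P. (\<forall>i. lattice_polytope_3d (P i)) \<and>
         (\<exists>\<phi> v. (\<forall>k. lattice_projection (\<phi> k) \<and> projection_direction (\<phi> k) (v k)) \<and>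
            (\<forall>i j k. triangle_translate (\<phi> k ` P i) \<and> triangle_translate (\<phi> k ` P j)
                 \<longleftrightarrow> i \<noteq> k \<and> j \<noteq> k) \<and>
            span (range (v :: 3 \<Rightarrow> real^3)) = {x. x $ 3 = 0})}"

definition Q_box :: "nat \<Rightarrow> (real^3) set" where
  "Q_box k = convex hull {0, axis 1 1 - axis 2 1} + convex hull {0, axis 2 1}
             + convex hull {0, of_nat k *\<^sub>R axis 2 1 + axis 3 1}"

definition R_box :: "nat \<Rightarrow> (real^3) set" where
  "R_box k = convex hull {0, axis 2 1 - axis 1 1} + convex hull {0, axis 1 1}
             + convex hull {0, of_nat k *\<^sub>R axis 1 1 + axis 3 1}"

definition unit_cube :: "(real^3) set" where
  "unit_cube = convex hull {0, axis 1 1} + convex hull {0, axis 2 1} + convex hull {0, axis 3 1}"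

definition shear1 :: "nat \<Rightarrow> real^3 \<Rightarrow> real^3" where
  "shear1 k p = vector [p $ 1, p $ 2 + of_nat k * p $ 3, p $ 3]"

definition shear2 :: "nat \<Rightarrow> real^3 \<Rightarrow> real^3" where
  "shear2 k p = vector [p $ 1 + of_nat k * p $ 3, p $ 2, p $ 3]"

definition covering_families :: "(nat \<Rightarrow> triple) set" where
  "covering_families =
     {\<lambda>k. triple (shear1 k ` P1) (shear2 k ` P2) P3 | P1 P2 P3.
        lattice_polytope_3d P1 \<and> P1 \<subseteq> Q_box 0 \<and>
        lattice_polytope_3d P2 \<and> P2 \<subseteq> R_box 0 \<and>
        lattice_polytope_3d P3 \<and> P3 \<subseteq> unit_cube \<and>
        mixed_degree (triple P1 P2 P3) = 1}"

end

theory Submission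
  imports Defs
begin

text \<open>
  Record a lattice polytope \<open>P\<close> by the set \<open>V\<close> of its lattice points. In coordinates, \<open>\<phi> k\<close> maps
  \<open>P i\<close> onto a translate of the unimodular triangle iff two integer functionals map \<open>V\<close> onto
  \<open>{(m, n), (m + 1, n), (m, n + 1)}\<close>. As the three projection directions are horizontal, the height
  factors through each projection. Were the three vertices of the triangle on different heights, each
  level of \<open>V\<close> would be a single point and \<open>P i\<close> a triangle; so the triangle has a horizontal edge
  and height one, and \<open>\<phi> k\<close> becomes \<open>x \<mapsto> (a k \<bullet> x, \<plusminus> height)\<close>. At least four points
  in \<open>V\<close> force the horizontal parts of \<open>a 1, a 2, a 3\<close> to be pairwise unimodular, and after changes of
  sign \<open>a 3 = a 1 + a 2 - k h\<close> with \<open>k \<ge> 0\<close>, where \<open>h\<close> is the height up to sign. In the coordinates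
  \<open>(a 2, a 1, h)\<close> the triple is a sheared triple of subpolytopes of \<open>Q_box 0\<close>, \<open>R_box 0\<close> and \<open>unit_cube\<close>.

  The pairwise sums are hollow since they project to triangles of size two. The total sum is not
  hollow by explicit interior lattice points, except when the three unsheared polytopes are the same
  unimodular simplex; then a reflection of the height axis gives a representation with parameter
  \<open>k + 1\<close> whose unsheared triple has mixed degree one.

  Infinitely many classes are told apart by the number of lattice points of the total Minkowski sum.
\<close>

section \<open>Lattice polytopes and lattice automorphisms\<close>

text \<open>Each polytope is seen by only two of the three functionals, and this is where the two
  shears come from. In the coordinates x, y, z of the overview the third functional is x + y - k z.
  The first polytope is seen by x and x + y - k z, so replacing y by y - k z keeps x and turns the
  other functional into x + y. The second is treated in the same way with x and y exchanged, and the
  third, seen by x and y, stays as it is. The sign of the height separates two types. Two of the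
  three signs always agree. If the third agrees as well, the unsheared polytopes are pyramids over a
  parallelogram with at most one corner missing; otherwise the first two are tetrahedra spanned by
  horizontal edges on opposite levels. The condition k \<ge> 0 can be reached because a and - a - h
  see the same triangle, and making this exchange in all three functionals turns k into - 1 - k. The
  exceptional case is unavoidable: three copies of a unimodular simplex add up to its threefold
  dilate, which is hollow.\<close>

lemma int_lattice_add: "x \<in> int_lattice \<Longrightarrow> y \<in> int_lattice \<Longrightarrow> x + y \<in> int_lattice"
  and int_lattice_diff: "x \<in> int_lattice \<Longrightarrow> y \<in> int_lattice \<Longrightarrow> x - y \<in> int_lattice"
  and int_lattice_uminus: "x \<in> int_lattice \<Longrightarrow> - x \<in> int_lattice"
  and int_lattice_scaleR: "c \<in> \<int> \<Longrightarrow> x \<in> int_lattice \<Longrightarrow> c *\<^sub>R x \<in> int_lattice"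
  and int_lattice_0: "0 \<in> int_lattice"
  and int_lattice_axis: "axis i 1 \<in> int_lattice"
  by (auto simp: int_lattice_def axis_def)

lemma int_lattice_sum: "(\<And>i. i \<in> I \<Longrightarrow> f i \<in> int_lattice) \<Longrightarrow> (\<Sum>i\<in>I. f i) \<in> int_lattice"
  by (induction I rule: infinite_finite_induct) (auto simp: int_lattice_0 int_lattice_add)

lemma int_lattice_inner: "x \<in> int_lattice \<Longrightarrow> y \<in> int_lattice \<Longrightarrow> x \<bullet> y \<in> \<int>"
  by (auto simp: int_lattice_def inner_vec_def intro!: Ints_sum)

lemma int_lattice_vector_iff: "vector [x, y, z] \<in> (int_lattice :: (real^3) set) \<longleftrightarrow> x \<in> \<int> \<and> y \<in> \<int> \<and> z \<in> \<int>"
  by (auto simp: int_lattice_def forall_3)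

lemma int_lattice_vector2_iff: "vector [x, y] \<in> (int_lattice :: (real^2) set) \<longleftrightarrow> x \<in> \<int> \<and> y \<in> \<int>"
  by (auto simp: int_lattice_def forall_2)

lemmas int_lattice_intros = int_lattice_add int_lattice_diff int_lattice_uminus int_lattice_scaleR
  int_lattice_0 int_lattice_axis

lemma inner_real3: "x \<bullet> y = x$1 * y$1 + x$2 * y$2 + x$3 * y$3" for x y :: "real^3"
  by (simp add: inner_vec_def sum_3)

lemma vec3_eq_iff: "x = y \<longleftrightarrow> x$1 = y$1 \<and> x$2 = y$2 \<and> x$3 = y$3" for x y :: "real^3"
  by (simp add: vec_eq_iff forall_3)

lemma vec2_eq_iff: "x = y \<longleftrightarrow> x$1 = y$1 \<and> x$2 = y$2" for x y :: "real^2"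
  by (simp add: vec_eq_iff forall_2)

lemma finite_bounded_int_lattice:
  fixes S :: "(real^'n) set"
  assumes "bounded S"
  shows "finite (S \<inter> int_lattice)"
proof -
  obtain B where B: "\<And>x. x \<in> S \<Longrightarrow> norm x \<le> B"
    using assms by (auto simp: bounded_iff)
  let ?F = "{r \<in> \<int>. \<bar>r\<bar> \<le> B}"
  have "S \<inter> int_lattice \<subseteq> vec_lambda ` (PiE UNIV (\<lambda>_. ?F))"
  proof
    fix x assume x: "x \<in> S \<inter> int_lattice"
    have "\<bar>x $ i\<bar> \<le> B" for i
      using x B[of x] component_le_norm_cart[of x i] by simp
    then have "vec_nth x \<in> PiE UNIV (\<lambda>_. ?F)"
      using x by (simp add: int_lattice_def PiE_def extensional_def Pi_def)
    then show "x \<in> vec_lambda ` (PiE UNIV (\<lambda>_. ?F))"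
      by (intro image_eqI[of _ _ "vec_nth x"]) simp_all
  qed
  moreover have "finite ?F"
    by (rule finite_abs_int_segment)
  ultimately show ?thesis
    by (elim finite_subset) (intro finite_imageI finite_PiE finite)
qed

section \<open>Lattice polytopes as hulls of their lattice points\<close>

lemma lattice_polytope_iff:
  "lattice_polytope P \<longleftrightarrow> (\<exists>S. finite S \<and> S \<subseteq> int_lattice \<and> P = convex hull S)"
proof
  assume P: "lattice_polytope P"
  then have "P = convex hull {v. v extreme_point_of P}" "finite {v. v extreme_point_of P}"
    by (auto simp: lattice_polytope_def polytope_imp_compact polytope_imp_convex
        Krein_Milman_Minkowski polytope_imp_polyhedron finite_polyhedron_extreme_points)
  then show "\<exists>S. finite S \<and> S \<subseteq> int_lattice \<and> P = convex hull S"
    using P unfolding lattice_polytope_def by metis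
next
  assume "\<exists>S. finite S \<and> S \<subseteq> int_lattice \<and> P = convex hull S"
  then show "lattice_polytope P"
    by (auto simp: lattice_polytope_def polytope_def dest!: extreme_point_of_convex_hull)
qed

lemma lattice_polytope_hull:
  assumes "lattice_polytope P"
  shows "P = convex hull (P \<inter> int_lattice)"
proof -
  obtain S where S: "S \<subseteq> int_lattice" "P = convex hull S"
    using assms lattice_polytope_iff by blast
  then have "convex hull S \<subseteq> convex hull (P \<inter> int_lattice)"
    by (intro hull_mono) (auto simp: hull_inc)
  moreover have "convex hull (P \<inter> int_lattice) \<subseteq> P"
    using S by (intro hull_minimal) auto
  ultimately show ?thesis using S(2) by blast
qed

lemma lattice_polytope_finite:
  assumes "lattice_polytope P"
  shows "finite (P \<inter> int_lattice)"
  using assms by (simp add: finite_bounded_int_lattice lattice_polytope_def polytope_imp_bounded)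

lemma lattice_polytope_convex: "lattice_polytope P \<Longrightarrow> convex P"
  by (simp add: lattice_polytope_def polytope_imp_convex)

text \<open>Affine dimension three needs four affinely independent points. Full dimension enters the
  combinatorial arguments in the form of this count.\<close>

lemma lattice_polytope_3d_card:
  assumes "lattice_polytope_3d P"
  shows "4 \<le> card (P \<inter> int_lattice)"
proof -
  have "P = convex hull (P \<inter> int_lattice)"
    using assms by (intro lattice_polytope_hull) (simp add: lattice_polytope_3d_def)
  then have "aff_dim P = aff_dim (P \<inter> int_lattice)"
    by (rule subst[where P = "\<lambda>Q. aff_dim Q = _", OF sym]) (rule aff_dim_convex_hull)
  also have "\<dots> \<le> int (card (P \<inter> int_lattice)) - 1"
    using assms by (intro aff_dim_le_card lattice_polytope_finite) (simp add: lattice_polytope_3d_def)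
  finally show ?thesis using assms by (simp add: lattice_polytope_3d_def)
qed

lemma lattice_polytope_3d_hull:
  fixes S :: "(real^3) set"
  assumes "finite S" "S \<subseteq> int_lattice" "interior (convex hull S) \<noteq> {}"
  shows "lattice_polytope_3d (convex hull S)"
proof -
  have "aff_dim (convex hull S) = 3"
    using assms(3) aff_dim_nonempty_interior[of "convex hull S"] by simp
  then show ?thesis
    using assms by (auto simp: lattice_polytope_3d_def lattice_polytope_iff)
qed

section \<open>The group of lattice automorphisms\<close>

lemma lattice_automorphism_linear:
  fixes G :: "real^3 \<Rightarrow> real^3"
  assumes "linear G" "bij G" "G ` int_lattice = int_lattice" "c \<in> int_lattice"
  shows "lattice_automorphism (\<lambda>x. c + G x)"
proof -
  have "bij ((+) c \<circ> G)"
    by (intro bij_comp assms) (auto intro!: bij_betw_byWitness[of _ "\<lambda>x. x - c"])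
  moreover have "(+) c ` G ` int_lattice = int_lattice"
  proof -
    have "(+) c ` int_lattice = (int_lattice :: (real^3) set)"
    proof
      show "(int_lattice :: (real^3) set) \<subseteq> (+) c ` int_lattice"
      proof
        fix x :: "real^3" assume "x \<in> int_lattice"
        then have "x - c \<in> int_lattice" using assms(4) by (rule int_lattice_diff)
        then show "x \<in> (+) c ` int_lattice" by (intro image_eqI[of _ _ "x - c"]) auto
      qed
    qed (use assms(4) int_lattice_add in auto)
    then show ?thesis using assms(3) by simp
  qed
  ultimately show ?thesis
    using assms(1) by (auto simp: lattice_automorphism_def affine_linear_def o_def image_image linear_0)
qed

lemma lattice_automorphismE:
  assumes "lattice_automorphism U"
  obtains L c where "U = (\<lambda>x. c + L x)" "linear L" "bij L" "L ` int_lattice = int_lattice" "c \<in> int_lattice"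
proof -
  define c where "c = U 0"
  define L where "L = (\<lambda>x. U x - c)"
  have c: "c \<in> int_lattice"
    using assms int_lattice_0 by (force simp: lattice_automorphism_def c_def)
  have U: "U = (\<lambda>x. c + L x)" by (simp add: L_def)
  have "bij L"
  proof -
    have "L = (\<lambda>x. x - c) \<circ> U" by (auto simp: L_def)
    moreover have "bij (\<lambda>x. x - c)" by (rule bij_diff_right)
    ultimately show ?thesis using assms by (simp add: lattice_automorphism_def bij_comp)
  qed
  moreover have "L ` int_lattice = int_lattice"
  proof -
    have "L ` int_lattice = (\<lambda>x. x - c) ` int_lattice"
      using assms by (metis (no_types, lifting) L_def image_cong image_image lattice_automorphism_def)
    also have "\<dots> = int_lattice"
    proof
      show "int_lattice \<subseteq> (\<lambda>x. x - c) ` int_lattice"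
        using c int_lattice_add by (force intro: image_eqI[of _ _ "_ + c"])
    qed (use c int_lattice_diff in auto)
    finally show ?thesis .
  qed
  moreover have "linear L"
    using assms by (simp add: L_def c_def lattice_automorphism_def affine_linear_def)
  ultimately show ?thesis using that U c by blast
qed

lemma lattice_automorphism_id: "lattice_automorphism (\<lambda>x. x)"
  by (auto simp: lattice_automorphism_def affine_linear_def linear_id[unfolded id_def] bij_id[unfolded id_def])

lemma lattice_automorphism_comp:
  assumes "lattice_automorphism U" "lattice_automorphism U'"
  shows "lattice_automorphism (\<lambda>x. U (U' x))"
proof -
  obtain L c where U: "U = (\<lambda>x. c + L x)" "linear L" using assms(1) by (rule lattice_automorphismE)
  obtain L' c' where U': "U' = (\<lambda>x. c' + L' x)" "linear L'" using assms(2) by (rule lattice_automorphismE)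
  have "(\<lambda>x. U (U' x) - U (U' 0)) = L \<circ> L'"
    using U U' by (auto simp: linear_add linear_0)
  then have "affine_linear (\<lambda>x. U (U' x))"
    using linear_compose[OF U'(2) U(2)] by (simp add: affine_linear_def)
  moreover have "bij (\<lambda>x. U (U' x))"
    using assms bij_comp[of U' U] by (simp add: lattice_automorphism_def o_def)
  moreover have "(\<lambda>x. U (U' x)) ` int_lattice = int_lattice"
    using assms by (metis image_image lattice_automorphism_def)
  ultimately show ?thesis by (simp add: lattice_automorphism_def)
qed

lemma lattice_automorphism_inv:
  assumes "lattice_automorphism U"
  shows "lattice_automorphism (inv U)"
proof -
  obtain L c where U: "U = (\<lambda>x. c + L x)" "linear L" "bij L" "L ` int_lattice = int_lattice" "c \<in> int_lattice"
    using assms by (rule lattice_automorphismE)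
  have L': "linear (inv L)"
    using U by (simp add: bij_is_inj bij_is_surj linear_inj_imp_surj inj_linear_imp_inv_linear)
  have "inv U = (\<lambda>x. - (inv L c) + inv L x)"
  proof (rule inv_equality)
    show "- inv L c + inv L (U x) = x" for x
      using U L' by (simp add: linear_add bij_is_inj)
    show "U (- inv L c + inv L x) = x" for x
      using U L' by (simp add: linear_add linear_diff bij_is_surj surj_f_inv_f)
  qed
  moreover have "inv L ` int_lattice = int_lattice"
    using U by (metis bij_is_inj image_inv_f_f)
  moreover have "bij (inv L)" using U by (simp add: bij_imp_bij_inv)
  ultimately show ?thesis
    using lattice_automorphism_linear[OF L', of "- inv L c"] U(5) int_lattice_uminus by auto
qed

lemma lattice_polytope_image:
  assumes "lattice_automorphism U" "lattice_polytope P"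
  shows "lattice_polytope (U ` P)"
proof -
  obtain L c where U: "U = (\<lambda>x. c + L x)" "linear L" "c \<in> int_lattice" "L ` int_lattice = int_lattice"
    using assms(1) by (rule lattice_automorphismE)
  obtain S where S: "finite S" "S \<subseteq> int_lattice" "P = convex hull S"
    using assms(2) lattice_polytope_iff by blast
  have "U ` P = (+) c ` L ` P" by (simp add: U image_image)
  also have "\<dots> = convex hull ((+) c ` L ` S)"
    by (simp add: S convex_hull_linear_image[OF U(2)] convex_hull_translation)
  finally have "U ` P = convex hull ((+) c ` L ` S)" .
  moreover have "L ` S \<subseteq> int_lattice"
    using image_mono[OF S(2), of L] U(4) by simp
  then have "(+) c ` L ` S \<subseteq> int_lattice"
    using U(3) int_lattice_add by fast
  moreover have "finite ((+) c ` L ` S)" using S(1) by simp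
  ultimately show ?thesis unfolding lattice_polytope_iff by blast
qed

lemma lattice_polytope_3d_image:
  assumes "lattice_automorphism U" "lattice_polytope_3d P"
  shows "lattice_polytope_3d (U ` P)"
proof -
  obtain L c where U: "U = (\<lambda>x. c + L x)" "linear L" "bij L"
    using assms(1) by (rule lattice_automorphismE)
  have "U ` P = (+) c ` L ` P" by (simp add: U image_image)
  then have "aff_dim (U ` P) = aff_dim P"
    using U by (simp add: aff_dim_translation_eq aff_dim_injective_linear_image bij_is_inj)
  then show ?thesis using assms lattice_polytope_image by (auto simp: lattice_polytope_3d_def)
qed

lemma lattice_automorphism_image_Int:
  assumes "lattice_automorphism U"
  shows "U ` P \<inter> int_lattice = U ` (P \<inter> int_lattice)"
  using assms by (metis bij_is_inj image_Int lattice_automorphism_def)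

section \<open>Unimodular coordinates that contain the height\<close>

definition minor12 :: "real^3 \<Rightarrow> real^3 \<Rightarrow> real" where
  "minor12 a b = a$1 * b$2 - a$2 * b$1"

definition coord_map :: "real^3 \<Rightarrow> real^3 \<Rightarrow> real^3 \<Rightarrow> real^3 \<Rightarrow> real^3" where
  "coord_map a b h x = vector [a \<bullet> x, b \<bullet> x, h \<bullet> x]"

lemma coord_map_nth [simp]:
  "coord_map a b h x $ 1 = a \<bullet> x" "coord_map a b h x $ 2 = b \<bullet> x" "coord_map a b h x $ 3 = h \<bullet> x"
  by (simp_all add: coord_map_def)

lemma linear_coord_map: "linear (coord_map a b h)"
  by (rule linearI) (simp_all add: vec3_eq_iff inner_add_right)

text \<open>The matrix with rows \<open>a\<close>, \<open>b\<close>, \<open>h\<close> has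
  determinant \<open>s * minor12 a b\<close>, a unit, so its inverse is integral.\<close>

lemma coord_map_automorphism:
  assumes "a \<in> int_lattice" "b \<in> int_lattice" "s = 1 \<or> s = -1" "h = s *\<^sub>R axis 3 1"
    and "c \<in> int_lattice" and D: "minor12 a b = 1 \<or> minor12 a b = -1"
  shows "lattice_automorphism (\<lambda>x. c + coord_map a b h x)"
proof (rule lattice_automorphism_linear)
  let ?D = "minor12 a b"
  \<comment> \<open>Cramer's rule: the third entry gives the height, its contribution is removed
    from the first two entries, and division by \<open>?D\<close> is multiplication by
    \<open>?D\<close>.\<close>
  define I where "I y = (vector [?D * (b$2 * (y$1 - a$3 * s * y$3) - a$2 * (y$2 - b$3 * s * y$3)),
     ?D * (- b$1 * (y$1 - a$3 * s * y$3) + a$1 * (y$2 - b$3 * s * y$3)), s * y$3] :: real^3)" for y :: "real^3"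
  have ss: "s * s = 1" "s * (s * x) = x" for x using assms(3) by auto
  have DD: "?D * ?D = 1" using D by auto
  have h: "h \<bullet> x = s * x$3" for x by (simp add: assms(4) inner_real3 axis_def)
  have IG: "I (coord_map a b h x) = x" for x
  proof -
    have 1: "a \<bullet> x - a$3 * s * (s * x$3) = a$1 * x$1 + a$2 * x$2" 
      "b \<bullet> x - b$3 * s * (s * x$3) = b$1 * x$1 + b$2 * x$2"
      by (simp_all add: inner_real3 ss mult.assoc)
    have "b$2 * (a$1 * x$1 + a$2 * x$2) - a$2 * (b$1 * x$1 + b$2 * x$2) = ?D * x$1"
      "- b$1 * (a$1 * x$1 + a$2 * x$2) + a$1 * (b$1 * x$1 + b$2 * x$2) = ?D * x$2"
      by (simp_all add: minor12_def algebra_simps)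
    then have "I (coord_map a b h x) = vector [?D * (?D * x$1), ?D * (?D * x$2), s * (s * x$3)]"
      unfolding I_def coord_map_nth h 1 by simp
    then show ?thesis
      by (simp add: vec3_eq_iff ss DD mult.assoc[symmetric])
  qed
  have GI: "coord_map a b h (I y) = y" for y
  proof -
    have "a \<bullet> I y = ?D * ?D * (y$1 - a$3 * s * y$3) + a$3 * s * y$3"
      unfolding inner_real3 I_def vector_3 by (simp add: minor12_def algebra_simps)
    moreover have "b \<bullet> I y = ?D * ?D * (y$2 - b$3 * s * y$3) + b$3 * s * y$3"
      unfolding inner_real3 I_def vector_3 by (simp add: minor12_def algebra_simps)
    moreover have "h \<bullet> I y = y$3" by (simp add: h I_def ss)
    ultimately show ?thesis by (simp add: vec3_eq_iff DD)
  qed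
  show "bij (coord_map a b h)"
    using IG GI by (intro bij_betw_byWitness[of _ I]) auto
  have hh: "h \<in> int_lattice" using assms(3,4) by (auto intro: int_lattice_intros)
  have "I y \<in> int_lattice" if "y \<in> int_lattice" for y
    using that assms(1,2,3) D unfolding I_def int_lattice_vector_iff
    by (auto simp: int_lattice_def)
  moreover have "coord_map a b h x \<in> int_lattice" if "x \<in> int_lattice" for x
    using that assms(1,2) hh by (auto simp: coord_map_def int_lattice_vector_iff int_lattice_inner)
  ultimately show "coord_map a b h ` int_lattice = int_lattice"
    using GI by (auto intro!: image_eqI[of _ _ "I _"])
qed (use assms linear_coord_map in auto)

section \<open>Equivalence, mixed degree and the boxes\<close>

lemma triple_nth [simp]: "triple A B C 1 = A" "triple A B C 2 = B" "triple A B C 3 = C"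
  by (simp_all add: triple_def)

lemma triple_equivI:
  assumes "bij \<sigma>" "lattice_automorphism U" "\<And>i. t i \<in> int_lattice" "\<And>i. P i = (+) (t i) ` U ` Q (\<sigma> i)"
  shows "triple_equiv P Q"
  using assms unfolding triple_equiv_def by (intro exI conjI allI)

lemma triple_equivE:
  assumes "triple_equiv P Q"
  obtains \<sigma> U t where "bij \<sigma>" "lattice_automorphism U" "\<forall>i. t i \<in> int_lattice"
    "\<forall>i. P i = (+) (t i) ` U ` Q (\<sigma> i)"
proof -
  from assms obtain \<sigma> U t where *: "bij \<sigma> \<and> lattice_automorphism U \<and>
      (\<forall>i. t i \<in> int_lattice \<and> P i = (+) (t i) ` U ` Q (\<sigma> i))"
    unfolding triple_equiv_def by (elim exE) (rule that)
  show thesis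
    by (rule that[of \<sigma> U t]) (use * in simp_all)
qed

lemma triple_equiv_refl: "triple_equiv P P"
  by (rule triple_equivI[of id "\<lambda>x. x" "\<lambda>_. 0"]) (auto simp: lattice_automorphism_id int_lattice_0)

lemma triple_equiv_permute: "bij \<sigma> \<Longrightarrow> triple_equiv (\<lambda>i. P (\<sigma> i)) P"
  by (rule triple_equivI[of \<sigma> "\<lambda>x. x" "\<lambda>_. 0"]) (auto simp: lattice_automorphism_id int_lattice_0)

lemma triple_equiv_trans:
  assumes "triple_equiv P Q" "triple_equiv Q R"
  shows "triple_equiv P R"
proof -
  obtain \<sigma> U t where h1: "bij \<sigma>" "lattice_automorphism U" "\<forall>i. t i \<in> int_lattice" "\<forall>i. P i = (+) (t i) ` U ` Q (\<sigma> i)"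
    using assms(1) by (rule triple_equivE)
  note 1 = h1[rule_format]
  obtain \<sigma>' U' t' where h2: "bij \<sigma>'" "lattice_automorphism U'" "\<forall>i. t' i \<in> int_lattice" "\<forall>i. Q i = (+) (t' i) ` U' ` R (\<sigma>' i)"
    using assms(2) by (rule triple_equivE)
  note 2 = h2[rule_format]
  obtain L c where L: "U = (\<lambda>x. c + L x)" "linear L" "L ` int_lattice = int_lattice" "c \<in> int_lattice"
    using 1(2) by (rule lattice_automorphismE)
  show ?thesis
  proof (rule triple_equivI[of "\<sigma>' \<circ> \<sigma>" "\<lambda>x. U (U' x)" "\<lambda>i. t i + L (t' (\<sigma> i))"])
    show "bij (\<sigma>' \<circ> \<sigma>)" by (rule bij_comp[OF 1(1) 2(1)])
    show "lattice_automorphism (\<lambda>x. U (U' x))" by (rule lattice_automorphism_comp[OF 1(2) 2(2)])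
    show "t i + L (t' (\<sigma> i)) \<in> int_lattice" for i
      using L(3) by (intro int_lattice_add 1(3)) (use 2(3) in blast)
    show "P i = (+) (t i + L (t' (\<sigma> i))) ` (\<lambda>x. U (U' x)) ` R ((\<sigma>' \<circ> \<sigma>) i)" for i
      by (simp add: 1(4) 2(4) image_image L linear_add[OF L(2)] add_ac)
  qed
qed

lemma sum_permute_bij: "bij (\<sigma> :: 'a::finite \<Rightarrow> 'a) \<Longrightarrow> (\<Sum>i\<in>UNIV. f (\<sigma> i)) = (\<Sum>i\<in>UNIV. f i)"
  using sum.reindex_bij_betw[of \<sigma> UNIV UNIV f] by simp

section \<open>Mixed degree and criteria for hollowness\<close>

lemma card_3_cases:
  fixes I :: "3 set"
  shows "card I = 1 \<longleftrightarrow> I = {1} \<or> I = {2} \<or> I = {3}"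
    and "card I = 2 \<longleftrightarrow> I = {1,2} \<or> I = {1,3} \<or> I = {2,3}"
    and "card I = 3 \<longleftrightarrow> I = UNIV"
proof -
  show "card I = 1 \<longleftrightarrow> I = {1} \<or> I = {2} \<or> I = {3}"
    unfolding card_1_singleton_iff One_nat_def using exhaust_3 by auto
  show "card I = 2 \<longleftrightarrow> I = {1,2} \<or> I = {1,3} \<or> I = {2,3}"
  proof
    assume "card I = 2"
    then obtain x y where xy: "I = {x, y}" "x \<noteq> y" by (auto simp: card_2_iff)
    show "I = {1,2} \<or> I = {1,3} \<or> I = {2,3}"
      using exhaust_3[of x] exhaust_3[of y] xy by (elim disjE) (simp_all add: insert_commute)
  qed auto
  have "card (UNIV :: 3 set) = 3" by simp
  then show "card I = 3 \<longleftrightarrow> I = UNIV"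
    using card_subset_eq[of "UNIV :: 3 set" I] by auto
qed

lemma mixed_degree_eq_1:
  assumes "hollow A" "hollow B" "hollow C" "hollow (A + B)" "hollow (A + C)" "hollow (B + C)"
    and "\<not> hollow (A + B + C)"
  shows "mixed_degree (triple A B C) = 1"
proof -
  let ?H = "\<lambda>d. d \<le> 2 \<and> (\<forall>I. card I = 3 - d \<longrightarrow> hollow (\<Sum>i\<in>I. triple A B C i))"
  have "\<not> (\<exists>i. \<not> hollow (triple A B C i))"
    using assms by (simp add: triple_def)
  moreover have "?H 1"
    using assms card_3_cases(2) by auto
  moreover have "\<not> ?H 0"
    using assms by (auto simp: card_3_cases(3) sum_3)
  then have "1 \<le> d" if "?H d" for d
    using that by (cases d) auto
  ultimately show ?thesis
    unfolding mixed_degree_def by (simp only: if_False) (rule Least_equality, blast+)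
qed

lemma mixed_degree_eq_2:
  assumes "hollow A" "hollow B" "hollow C" "\<not> hollow (A + B)" "\<not> hollow (A + B + C)"
  shows "mixed_degree (triple A B C) = 2"
proof -
  let ?H = "\<lambda>d. d \<le> 2 \<and> (\<forall>I. card I = 3 - d \<longrightarrow> hollow (\<Sum>i\<in>I. triple A B C i))"
  have "\<not> (\<exists>i. \<not> hollow (triple A B C i))"
    using assms by (simp add: triple_def)
  moreover have "?H 2"
    using assms card_3_cases(1) by auto
  moreover have "\<not> ?H 0"
    using assms by (auto simp: card_3_cases(3) sum_3)
  moreover have "\<not> ?H 1"
    using assms card_3_cases(2) by (auto intro!: exI[of _ "{1,2}"])
  then have "2 \<le> d" if "?H d" for d
    using that calculation by (cases "d = 0"; cases "d = 1") auto
  ultimately show ?thesis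
    unfolding mixed_degree_def by (simp only: if_False) (rule Least_equality, blast+)
qed

text \<open>A translate of the open set \<open>interior A\<close> by a point of \<open>B\<close>
  stays inside the sum, so it is enough that one summand is an interior point.\<close>

lemma not_hollow_sum:
  assumes "a \<in> interior A" "b \<in> B" "a + b \<in> int_lattice"
  shows "\<not> hollow (A + B)"
proof -
  have "(+) b ` interior A \<subseteq> interior (A + B)"
  proof (rule interior_maximal)
    show "(+) b ` interior A \<subseteq> A + B"
      using assms(2) interior_subset[of A] by (auto simp: set_plus_def add.commute)
  qed (simp add: open_translation)
  then have "a + b \<in> interior (A + B)" using assms(1) by (auto simp: add.commute)
  then show ?thesis using assms(3) by (auto simp: hollow_def)
qed

lemma not_hollow_sum3:
  assumes "a \<in> interior A" "b \<in> B" "c \<in> C" "a + b + c \<in> int_lattice"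
  shows "\<not> hollow (A + B + C)"
  using not_hollow_sum[of a A "b + c" "B + C"] assms by (auto simp: add.assoc set_plus_intro)

text \<open>Hollowness is inherited from the unimodular image in the plane with coordinates
  \<open>a \<bullet> x\<close> and \<open>b \<bullet> x\<close>: a triangle of size two has no interior lattice point.\<close>

lemma hollow_triangle:
  assumes "\<And>x. x \<in> S \<Longrightarrow> m \<le> a \<bullet> x" "\<And>x. x \<in> S \<Longrightarrow> n \<le> b \<bullet> x"
    and "\<And>x. x \<in> S \<Longrightarrow> a \<bullet> x + b \<bullet> x \<le> m + n + 2"
    and "m \<in> \<int>" "n \<in> \<int>" "a \<in> int_lattice" "b \<in> int_lattice" "a \<noteq> 0" "b \<noteq> 0" "a + b \<noteq> 0"
  shows "hollow S"
proof -
  have False if x: "x \<in> interior S" "x \<in> int_lattice" for x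
  proof -
    have "interior S \<subseteq> interior {x. m \<le> a \<bullet> x}" "interior S \<subseteq> interior {x. n \<le> b \<bullet> x}"
      "interior S \<subseteq> interior {x. (a + b) \<bullet> x \<le> m + n + 2}"
      using assms(1-3) by (intro interior_mono; auto simp: inner_add_left)+
    then have *: "m < a \<bullet> x" "n < b \<bullet> x" "(a + b) \<bullet> x < m + n + 2"
      using x(1) assms(8-10) interior_halfspace_ge[of a m] interior_halfspace_ge[of b n]
        interior_halfspace_le[of "a + b" "m + n + 2"] by auto
    obtain m' n' p q where "m = of_int m'" "n = of_int n'" "a \<bullet> x = of_int p" "b \<bullet> x = of_int q"
      using assms(4-7) x(2) int_lattice_inner by (metis Ints_cases)
    with * show False by (simp add: inner_add_left)
  qed
  then show ?thesis by (auto simp: hollow_def)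
qed

lemma convex_comb4:
  assumes "convex S" "w0 \<in> S" "w1 \<in> S" "w2 \<in> S" "w3 \<in> S"
    and "0 \<le> u0" "0 \<le> u1" "0 \<le> u2" "0 \<le> u3" "u0 + u1 + u2 + u3 = 1"
  shows "u0 *\<^sub>R w0 + u1 *\<^sub>R w1 + u2 *\<^sub>R w2 + u3 *\<^sub>R w3 \<in> S"
proof -
  have I: "{..<4::nat} = {0, 1, 2, 3}" by auto
  have "(\<Sum>i\<in>{..<4::nat}. ([u0, u1, u2, u3] ! i) *\<^sub>R ([w0, w1, w2, w3] ! i)) \<in> S"
    using assms by (intro convex_sum) (auto simp: I add_ac)
  then show ?thesis by (simp add: I add_ac)
qed

text \<open>The barycentric coordinates are supplied as explicit continuous functions. They are all
  positive on an open set, whose points are convex combinations of the four given points of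
  \<open>S\<close>. Interior membership thus becomes a check of rational identities.\<close>

lemma interior_by_barycentric:
  fixes S :: "(real^3) set"
  assumes "convex S" "w0 \<in> S" "w1 \<in> S" "w2 \<in> S" "w3 \<in> S"
    and "continuous_on UNIV u0" "continuous_on UNIV u1" "continuous_on UNIV u2" "continuous_on UNIV u3"
    and "\<And>x. u0 x + u1 x + u2 x + u3 x = 1"
    and "\<And>x. x = u0 x *\<^sub>R w0 + u1 x *\<^sub>R w1 + u2 x *\<^sub>R w2 + u3 x *\<^sub>R w3"
    and "0 < u0 a" "0 < u1 a" "0 < u2 a" "0 < u3 a"
  shows "a \<in> interior S"
proof -
  let ?O = "{x. 0 < u0 x} \<inter> {x. 0 < u1 x} \<inter> {x. 0 < u2 x} \<inter> {x. 0 < u3 x}"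
  have "open ?O"
    using assms(6-9) by (intro open_Int open_Collect_less continuous_intros) auto
  moreover have "?O \<subseteq> S"
  proof
    fix x assume x: "x \<in> ?O"
    have "u0 x *\<^sub>R w0 + u1 x *\<^sub>R w1 + u2 x *\<^sub>R w2 + u3 x *\<^sub>R w3 \<in> S"
      using x assms(1-5,10) by (intro convex_comb4) auto
    then show "x \<in> S" by (rule ssubst[OF assms(11)[of x], where P = "\<lambda>y. y \<in> S"])
  qed
  ultimately show ?thesis
    using assms(12-15) interior_maximal[of ?O S] by blast
qed

section \<open>The boxes as intersections of slabs\<close>

lemma sum_convex_hull_pairs:
  fixes a b c :: "'a::real_vector"
  shows "convex hull {0, a} + convex hull {0, b} + convex hull {0, c} =
    {r *\<^sub>R a + s *\<^sub>R b + t *\<^sub>R c | r s t. 0 \<le> r \<and> r \<le> 1 \<and> 0 \<le> s \<and> s \<le> 1 \<and> 0 \<le> t \<and> t \<le> 1}"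
proof -
  have hull: "convex hull {0, v} = {r *\<^sub>R v | r. 0 \<le> r \<and> r \<le> 1}" for v :: 'a
    unfolding segment_convex_hull[symmetric] closed_segment_def by auto
  show ?thesis unfolding hull set_plus_def by blast
qed

text \<open>The three bounded quantities are the coefficients of the generating segments. The middle
  one, x + y - k z, is the third functional of the normal form.\<close>

lemma Q_box_eq: "Q_box k = {p. 0 \<le> p$1 \<and> p$1 \<le> 1 \<and> 0 \<le> p$1 + p$2 - k * p$3 \<and> p$1 + p$2 - k * p$3 \<le> 1 \<and> 0 \<le> p$3 \<and> p$3 \<le> 1}"
  (is "_ = ?B")
proof -
  have eq: "p = p$1 *\<^sub>R (axis 1 1 - axis 2 1) + (p$1 + p$2 - k * p$3) *\<^sub>R axis 2 1
      + p$3 *\<^sub>R (of_nat k *\<^sub>R axis 2 1 + axis 3 1)" for p :: "real^3"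
    by (simp add: vec3_eq_iff axis_def algebra_simps)
  have "p \<in> Q_box k" if "p \<in> ?B" for p
    using that eq[of p] unfolding Q_box_def sum_convex_hull_pairs by blast
  moreover have "p \<in> ?B" if p_in: "p \<in> Q_box k" for p
  proof -
    obtain r s t where p: "p = r *\<^sub>R (axis 1 1 - axis 2 1) + s *\<^sub>R axis 2 1 + t *\<^sub>R (of_nat k *\<^sub>R axis 2 1 + axis 3 1)"
      and rst: "0 \<le> r" "r \<le> 1" "0 \<le> s" "s \<le> 1" "0 \<le> t" "t \<le> 1"
      using p_in unfolding Q_box_def sum_convex_hull_pairs by blast
    have "p$1 = r" "p$2 = s - r + k * t" "p$3 = t" by (simp_all add: p axis_def)
    then show ?thesis using rst by simp
  qed
  ultimately show ?thesis by blast
qed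

lemma R_box_eq: "R_box k = {p. 0 \<le> p$2 \<and> p$2 \<le> 1 \<and> 0 \<le> p$1 + p$2 - k * p$3 \<and> p$1 + p$2 - k * p$3 \<le> 1 \<and> 0 \<le> p$3 \<and> p$3 \<le> 1}"
  (is "_ = ?B")
proof -
  have eq: "p = p$2 *\<^sub>R (axis 2 1 - axis 1 1) + (p$1 + p$2 - k * p$3) *\<^sub>R axis 1 1
      + p$3 *\<^sub>R (of_nat k *\<^sub>R axis 1 1 + axis 3 1)" for p :: "real^3"
    by (simp add: vec3_eq_iff axis_def algebra_simps)
  have "p \<in> R_box k" if "p \<in> ?B" for p
    using that eq[of p] unfolding R_box_def sum_convex_hull_pairs by blast
  moreover have "p \<in> ?B" if p_in: "p \<in> R_box k" for p
  proof -
    obtain r s t where p: "p = r *\<^sub>R (axis 2 1 - axis 1 1) + s *\<^sub>R axis 1 1 + t *\<^sub>R (of_nat k *\<^sub>R axis 1 1 + axis 3 1)"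
      and rst: "0 \<le> r" "r \<le> 1" "0 \<le> s" "s \<le> 1" "0 \<le> t" "t \<le> 1"
      using p_in unfolding R_box_def sum_convex_hull_pairs by blast
    have "p$1 = s - r + k * t" "p$2 = r" "p$3 = t" by (simp_all add: p axis_def)
    then show ?thesis using rst by simp
  qed
  ultimately show ?thesis by blast
qed

lemma unit_cube_eq: "unit_cube = {p. 0 \<le> p$1 \<and> p$1 \<le> 1 \<and> 0 \<le> p$2 \<and> p$2 \<le> 1 \<and> 0 \<le> p$3 \<and> p$3 \<le> 1}"
  (is "_ = ?B")
proof -
  have eq: "p = p$1 *\<^sub>R axis 1 1 + p$2 *\<^sub>R axis 2 1 + p$3 *\<^sub>R axis 3 1" for p :: "real^3"
    by (simp add: vec3_eq_iff axis_def)
  have "p \<in> unit_cube" if "p \<in> ?B" for p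
    using that eq[of p] unfolding unit_cube_def sum_convex_hull_pairs by blast
  moreover have "unit_cube \<subseteq> ?B"
    unfolding unit_cube_def sum_convex_hull_pairs by (auto simp: axis_def)
  ultimately show ?thesis by blast
qed

lemma hollow_slab:
  fixes S :: "(real^3) set"
  assumes "\<And>x. x \<in> S \<Longrightarrow> 0 \<le> x$3 \<and> x$3 \<le> 1"
  shows "hollow S"
proof -
  have "axis 3 1 \<noteq> (0 :: real^3)" "axis 3 1 + axis 3 1 \<noteq> (0 :: real^3)"
    by (simp_all add: vec3_eq_iff axis_def)
  \<comment> \<open>With both functionals equal to the height, the bound 2 z \<le> 2 on their sum is
    the upper side of the slab.\<close>
  then show ?thesis
    using assms by (intro hollow_triangle[of S 0 "axis 3 1" 0 "axis 3 1"])
      (force simp: inner_axis' int_lattice_axis)+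
qed

lemma mixed_degree_boxes: "mixed_degree (triple (Q_box k) (R_box k) unit_cube) = 2"
proof (rule mixed_degree_eq_2)
  show "hollow (Q_box k)" "hollow (R_box k)" "hollow unit_cube"
    by (rule hollow_slab; simp add: Q_box_eq R_box_eq unit_cube_eq)+
  have int: "(vector [x, y, z] :: real^3) \<in> interior (Q_box k)"
    if "0 < x" "x < 1" "0 < x + y - k * z" "x + y - k * z < 1" "0 < z" "z < 1" for x y z :: real
  proof -
    let ?O = "{p::real^3. 0 < p$1} \<inter> {p. p$1 < 1} \<inter> {p. 0 < p$1 + p$2 - k * p$3} \<inter> {p. p$1 + p$2 - k * p$3 < 1}
       \<inter> {p. 0 < p$3} \<inter> {p. p$3 < 1}"
    have "open ?O"
      by (intro open_Int open_Collect_less continuous_intros)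
    moreover have "?O \<subseteq> Q_box k" by (auto simp: Q_box_eq)
    ultimately have "?O \<subseteq> interior (Q_box k)" by (rule interior_maximal[rotated])
    moreover have "vector [x, y, z] \<in> ?O" using that by simp
    ultimately show ?thesis by (rule subsetD)
  qed
  have "\<exists>a\<in>interior (Q_box k). \<exists>b\<in>R_box k. a + b \<in> int_lattice"
  proof (intro bexI)
    \<comment> \<open>This is the centre of \<open>Q_box k\<close>. The centre of
      \<open>R_box k\<close> completes it to a lattice point at height one only for odd
      \<open>k\<close>; for even \<open>k\<close> the centre of the facet y = 0 takes its
      place.\<close>
    show "vector [1/2, k/2, 1/2] \<in> interior (Q_box k)" by (rule int) simp_all
    show "(if even k then vector [(k + 1)/2, 0, 1/2] else vector [k/2, 1/2, 1/2]) \<in> R_box k"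
      by (simp add: R_box_eq field_simps)
    obtain m where "k = 2 * m \<or> k = 2 * m + 1" by (meson oddE evenE)
    then have "vector [1/2, k/2, 1/2] + (if even k then vector [(k + 1)/2, 0, 1/2] else vector [k/2, 1/2, 1/2])
        = (if even k then vector [real m + 1, real m, 1] else vector [real m + 1, real m + 1, 1] :: real^3)"
      by (auto simp: vec3_eq_iff field_simps)
    then show "vector [1/2, k/2, 1/2] + (if even k then vector [(k + 1)/2, 0, 1/2] else vector [k/2, 1/2, 1/2])
        \<in> (int_lattice :: (real^3) set)"
      by (simp add: int_lattice_vector_iff)
  qed
  then obtain a b where ab: "a \<in> interior (Q_box k)" "b \<in> R_box k" "a + b \<in> int_lattice" by blast
  show "\<not> hollow (Q_box k + R_box k)" using not_hollow_sum ab by blast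
  have "0 \<in> unit_cube" by (simp add: unit_cube_eq)
  then show "\<not> hollow (Q_box k + R_box k + unit_cube)" by (rule not_hollow_sum3[OF ab(1,2)]) (simp add: ab(3))
qed

section \<open>Finiteness of the covering families\<close>

lemma finite_lattice_polytopes:
  fixes B :: "(real^3) set"
  assumes "bounded B"
  shows "finite {P. lattice_polytope_3d P \<and> P \<subseteq> B}"
proof (rule finite_subset)
  show "{P. lattice_polytope_3d P \<and> P \<subseteq> B} \<subseteq> (hull) convex ` Pow (B \<inter> int_lattice)"
  proof safe
    fix P assume P: "lattice_polytope_3d P" "P \<subseteq> B"
    then have "P = convex hull (P \<inter> int_lattice)"
      by (intro lattice_polytope_hull) (simp add: lattice_polytope_3d_def)
    then show "P \<in> (hull) convex ` Pow (B \<inter> int_lattice)"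
      by (rule image_eqI) (use P(2) in blast)
  qed
  show "finite ((hull) convex ` Pow (B \<inter> int_lattice))"
    using finite_bounded_int_lattice[OF assms] by (intro finite_imageI) (simp only: finite_Pow_iff)
qed

lemma bounded_set_plus:
  fixes A B :: "'a::real_normed_vector set"
  assumes "bounded A" "bounded B"
  shows "bounded (A + B)"
proof -
  obtain a b where "\<And>x. x \<in> A \<Longrightarrow> norm x \<le> a" "\<And>x. x \<in> B \<Longrightarrow> norm x \<le> b"
    using assms by (auto simp: bounded_iff)
  then have "\<And>x. x \<in> A + B \<Longrightarrow> norm x \<le> a + b"
    by (auto simp: set_plus_def intro: norm_triangle_mono)
  then show ?thesis by (auto simp: bounded_iff)
qed

lemma finite_covering_families: "finite covering_families"
proof -
  have "bounded (Q_box 0)" "bounded (R_box 0)" "bounded unit_cube"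
    unfolding Q_box_def R_box_def unit_cube_def
    by (intro bounded_set_plus bounded_convex_hull finite_imp_bounded finite.intros)+
  then have fin: "finite ({P. lattice_polytope_3d P \<and> P \<subseteq> Q_box 0} \<times> {P. lattice_polytope_3d P \<and> P \<subseteq> R_box 0}
      \<times> {P. lattice_polytope_3d P \<and> P \<subseteq> unit_cube})"
    by (intro finite_cartesian_product finite_lattice_polytopes)
  let ?h = "\<lambda>(P1, P2, P3) k. triple (shear1 k ` P1) (shear2 k ` P2) P3"
  have "F \<in> ?h ` ({P. lattice_polytope_3d P \<and> P \<subseteq> Q_box 0} \<times> {P. lattice_polytope_3d P \<and> P \<subseteq> R_box 0}
      \<times> {P. lattice_polytope_3d P \<and> P \<subseteq> unit_cube})" if F: "F \<in> covering_families" for F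
  proof -
    obtain P1 P2 P3 where "F = ?h (P1, P2, P3)" "lattice_polytope_3d P1" "P1 \<subseteq> Q_box 0"
      "lattice_polytope_3d P2" "P2 \<subseteq> R_box 0" "lattice_polytope_3d P3" "P3 \<subseteq> unit_cube"
      using F unfolding covering_families_def by auto
    then show ?thesis by (intro image_eqI[of _ _ "(P1, P2, P3)"]) simp_all
  qed
  then have "covering_families \<subseteq> ?h ` ({P. lattice_polytope_3d P \<and> P \<subseteq> Q_box 0} \<times> {P. lattice_polytope_3d P \<and> P \<subseteq> R_box 0}
      \<times> {P. lattice_polytope_3d P \<and> P \<subseteq> unit_cube})" by (rule subsetI)
  then show ?thesis
    by (rule finite_subset) (rule finite_imageI[OF fin])
qed

text \<open>The Minkowski sum is spelled out with choice functions, so that a permutation of the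
  triple becomes a reindexing of the sum.\<close>

definition lattice_points_of_sum :: "triple \<Rightarrow> (real^3) set" where
  "lattice_points_of_sum P = {\<Sum>i\<in>UNIV. p i | p. \<forall>i. p i \<in> P i} \<inter> int_lattice"

lemma card_lattice_points_of_sum_equiv:
  assumes "triple_equiv P Q"
  shows "card (lattice_points_of_sum P) = card (lattice_points_of_sum Q)"
proof -
  obtain \<sigma> U t where h1: "bij \<sigma>" "lattice_automorphism U" "\<forall>i. t i \<in> int_lattice" "\<forall>i. P i = (+) (t i) ` U ` Q (\<sigma> i)"
    using assms by (rule triple_equivE)
  note 1 = h1[rule_format]
  obtain L c where L: "U = (\<lambda>x. c + L x)" "linear L" "bij L" "L ` int_lattice = int_lattice" "c \<in> int_lattice"
    using 1(2) by (rule lattice_automorphismE)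
  \<comment> \<open>Every summand contributes its own translation and one copy of the translation
    part of \<open>U\<close>.\<close>
  define d where "d = (\<Sum>i\<in>UNIV. t i + c)"
  let ?M = "\<lambda>Q :: triple. {\<Sum>i\<in>UNIV. p i | p. \<forall>i. p i \<in> Q i}"
  have M: "(\<lambda>x. d + L x) ` ?M Q = ?M P"
  proof (intro subset_antisym subsetI)
    fix y assume "y \<in> (\<lambda>x. d + L x) ` ?M Q"
    then obtain p where p: "y = d + L (\<Sum>i\<in>UNIV. p i)" "\<And>i. p i \<in> Q i" by auto
    have "y = d + (\<Sum>i\<in>UNIV. L (p (\<sigma> i)))"
      using sum_permute_bij[OF 1(1), of "\<lambda>i. L (p i)"] by (simp add: p linear_sum[OF L(2)])
    also have "\<dots> = (\<Sum>i\<in>UNIV. t i + U (p (\<sigma> i)))"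
      by (simp add: d_def L sum.distrib add_ac)
    finally show "y \<in> ?M P" using p(2) by (auto simp: 1(4))
  next
    fix y assume "y \<in> ?M P"
    then obtain p where p: "y = (\<Sum>i\<in>UNIV. p i)" "\<And>i. p i \<in> (+) (t i) ` U ` Q (\<sigma> i)"
      by (auto simp: 1(4))
    then have "\<forall>i. \<exists>q. p i = t i + U q \<and> q \<in> Q (\<sigma> i)" by blast
    then obtain q where q: "\<And>i. p i = t i + U (q i)" "\<And>i. q i \<in> Q (\<sigma> i)" by metis
    have "y = d + L (\<Sum>i\<in>UNIV. q i)"
      by (simp add: p q d_def L linear_sum[OF L(2)] sum.distrib add_ac)
    also have "(\<Sum>i\<in>UNIV. q i) = (\<Sum>i\<in>UNIV. q (inv \<sigma> i))"
      using sum_permute_bij[OF bij_imp_bij_inv[OF 1(1)], of q] by simp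
    finally have "y = d + L (\<Sum>i\<in>UNIV. q (inv \<sigma> i))" .
    moreover have "q (inv \<sigma> i) \<in> Q i" for i
      using q(2)[of "inv \<sigma> i"] 1(1) by (simp add: bij_is_surj surj_f_inv_f)
    ultimately show "y \<in> (\<lambda>x. d + L x) ` ?M Q" by blast
  qed
  have "d \<in> int_lattice"
    unfolding d_def using 1(3) L(5) by (intro int_lattice_sum int_lattice_add)
  then have "lattice_automorphism (\<lambda>x. d + L x)"
    using L by (intro lattice_automorphism_linear)
  then have "bij (\<lambda>x. d + L x)" "lattice_points_of_sum P = (\<lambda>x. d + L x) ` lattice_points_of_sum Q"
    using lattice_automorphism_image_Int[of "\<lambda>x. d + L x" "?M Q"] M
    by (simp_all add: lattice_points_of_sum_def lattice_automorphism_def)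
  then show ?thesis by (metis bij_is_inj card_image inj_on_subset subset_UNIV)
qed

section \<open>Infinitely many classes\<close>

text \<open>Serves to refute the triangle condition for an image of width two or more.\<close>

lemma triangle_translate_width:
  assumes "triangle_translate T" "p \<in> T" "q \<in> T"
  shows "p$1 - q$1 \<le> 1"
proof -
  have "unimodular_triangle \<subseteq> cbox 0 1"
    unfolding unimodular_triangle_def
    by (rule hull_minimal) (auto simp: mem_box_cart axis_def convex_box)
  moreover obtain t where "T = (+) t ` unimodular_triangle"
    using assms(1) by (auto simp: triangle_translate_def)
  ultimately obtain p' q' where "p = t + p'" "q = t + q'" "p' \<in> cbox 0 1" "q' \<in> cbox 0 1"
    using assms(2,3) by blast
  then show ?thesis by (auto simp: mem_box_cart forall_2)
qed

lemma lattice_polytope_3d_bounded: "lattice_polytope_3d P \<Longrightarrow> bounded P"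
  by (simp add: lattice_polytope_3d_def lattice_polytope_def polytope_imp_bounded)

definition plane_projection :: "real^3 \<Rightarrow> real^3 \<Rightarrow> real^2" where
  "plane_projection a x = vector [a \<bullet> x, x$3]"

lemma plane_projection_nth [simp]: "plane_projection a x $ 1 = a \<bullet> x" "plane_projection a x $ 2 = x$3"
  by (simp_all add: plane_projection_def)

lemma linear_plane_projection: "linear (plane_projection a)"
  by (rule linearI) (simp_all add: vec2_eq_iff inner_add_right)

lemma lattice_projection_plane:
  assumes "a \<in> int_lattice" "w \<in> int_lattice" "a \<bullet> w = 1" "w$3 = 0"
  shows "lattice_projection (plane_projection a)"
proof -
  \<comment> \<open>A right inverse: \<open>w\<close> lifts the first coordinate, and the term with
    \<open>a$3\<close> cancels the value of \<open>a\<close> on the vertical vector.\<close>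
  define I where "I y = (y$1 - a$3 * y$2) *\<^sub>R w + y$2 *\<^sub>R axis 3 1" for y :: "real^2"
  have "a \<bullet> axis 3 1 = a$3" "(axis 3 1 :: real^3) $ 3 = 1"
    by (simp add: inner_axis, simp add: axis_def)
  then have I: "plane_projection a (I y) = y" for y
    using assms(3,4) by (simp add: vec2_eq_iff I_def inner_add_right)
  have "I y \<in> int_lattice" if "y \<in> int_lattice" for y
    using that assms(1,2) by (auto simp: I_def int_lattice_def axis_def)
  moreover have "plane_projection a x \<in> int_lattice" if "x \<in> int_lattice" for x
  proof -
    have "x$3 \<in> \<int>" using that by (simp add: int_lattice_def)
    then show ?thesis
      using int_lattice_inner[OF assms(1) that] by (simp add: plane_projection_def int_lattice_vector2_iff)
  qed
  ultimately have "plane_projection a ` int_lattice = int_lattice"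
    using I by (metis (no_types, opaque_lifting) image_eqI image_subsetI subset_antisym subsetI)
  moreover have "surj (plane_projection a)" using I by (metis surjI)
  moreover have "affine_linear (plane_projection a)"
    using linear_plane_projection by (simp add: affine_linear_def linear_0)
  ultimately show ?thesis by (simp add: lattice_projection_def)
qed

definition pointed_simplex :: "real \<Rightarrow> real \<Rightarrow> (real^3) set" where
  "pointed_simplex a b = convex hull {0, axis 1 1, axis 2 1, vector [a, b, 1]}"

lemma lattice_polytope_3d_pointed_simplex:
  assumes "a \<in> \<int>" "b \<in> \<int>"
  shows "lattice_polytope_3d (pointed_simplex a b)"
  unfolding pointed_simplex_def
proof (rule lattice_polytope_3d_hull)
  show "{0, axis 1 1, axis 2 1, vector [a, b, 1]} \<subseteq> (int_lattice :: (real^3) set)"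
    using assms by (simp add: int_lattice_intros int_lattice_vector_iff)
  let ?x = "vector [(1 + a) / 4, (1 + b) / 4, 1/4] :: real^3"
  have "?x \<in> interior (convex hull {0, axis 1 1, axis 2 1, vector [a, b, 1]})"
    by (rule interior_by_barycentric[of _ 0 "axis 1 1" "axis 2 1" "vector [a, b, 1]"
        "\<lambda>x. 1 - x$1 - x$2 + (a + b - 1) * x$3" "\<lambda>x. x$1 - a * x$3" "\<lambda>x. x$2 - b * x$3" "\<lambda>x. x$3"])
      (auto intro!: continuous_intros hull_inc simp: vec3_eq_iff axis_def field_simps)
  then show "interior (convex hull {0, axis 1 1, axis 2 1, vector [a, b, 1]} :: (real^3) set) \<noteq> {}" by blast
qed simp

lemma plane_projection_simplex:
  "plane_projection u ` pointed_simplex a b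
    = convex hull {0, vector [u$1, 0], vector [u$2, 0], vector [u \<bullet> vector [a, b, 1], 1]}"
proof -
  have "plane_projection u 0 = 0" "plane_projection u (axis 1 1) = vector [u$1, 0]"
    "plane_projection u (axis 2 1) = vector [u$2, 0]"
    "plane_projection u (vector [a, b, 1]) = vector [u \<bullet> vector [a, b, 1], 1]"
    by (simp_all add: vec2_eq_iff inner_real3 axis_def)
  then show ?thesis
    by (simp add: pointed_simplex_def convex_hull_linear_image[OF linear_plane_projection])
qed

lemma span_line_eq_kernel:
  assumes "u \<noteq> 0" "\<And>x. f x = 0 \<Longrightarrow> \<exists>c. x = c *\<^sub>R u" "linear f" "f u = 0"
  shows "span {u} = {x. f x - f 0 = 0}"
  using assms by (auto simp: span_singleton linear_0 linear_scale)

text \<open>Three sheared copies of one unimodular simplex. The same triples supply infinitely many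
  classes and form the exceptional case of the covering.\<close>

definition example_triple :: "nat \<Rightarrow> triple" where
  "example_triple k = triple (pointed_simplex 0 k) (pointed_simplex k 0) (pointed_simplex 0 0)"

lemma example_triple_projecting:
  assumes "2 \<le> k"
  shows "example_triple k \<in> projecting_triples"
proof -
  define u :: "3 \<Rightarrow> real^3" where "u i = (if i = 1 then vector [0, 1, 0] else if i = 2 then vector [1, 0, 0]
     else vector [1, 1, - real k])" for i
  define v :: "3 \<Rightarrow> real^3" where "v i = (if i = 1 then vector [1, 0, 0] else if i = 2 then vector [0, 1, 0]
     else vector [1, -1, 0])" for i
  have u: "u 1 = vector [0, 1, 0]" "u 2 = vector [1, 0, 0]" "u 3 = vector [1, 1, - real k]"
    and v: "v 1 = vector [1, 0, 0]" "v 2 = vector [0, 1, 0]" "v 3 = vector [1, -1, 0]"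
    by (simp_all add: u_def v_def)
  have "lattice_polytope_3d (example_triple k i)" for i
    using exhaust_3[of i] by (auto simp: example_triple_def lattice_polytope_3d_pointed_simplex)
  moreover have "lattice_projection (plane_projection (u i))" for i
    using exhaust_3[of i] lattice_projection_plane[of "u 1" "vector [0, 1, 0]"]
      lattice_projection_plane[of "u 2" "vector [1, 0, 0]"] lattice_projection_plane[of "u 3" "vector [1, 0, 0]"]
    by (auto simp: u int_lattice_vector_iff inner_real3)
  moreover have "projection_direction (plane_projection (u i)) (v i)" for i
  proof -
    have "1 = \<lfloor>v i $ 1\<rfloor> \<or> 1 = \<lfloor>v i $ 2\<rfloor>" "v i \<in> int_lattice" "v i \<noteq> 0" "u i \<bullet> v i = 0" "v i $ 3 = 0"
      using exhaust_3[of i] by (auto simp: u v int_lattice_vector_iff vec3_eq_iff inner_real3)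
    moreover have "\<exists>c. x = c *\<^sub>R v i" if "u i \<bullet> x = 0" "x$3 = 0" for x
      using exhaust_3[of i] that
      by (auto simp: u v vec3_eq_iff inner_real3 intro: exI[of _ "x$1"] exI[of _ "x$2"])
    ultimately show ?thesis
      unfolding projection_direction_def primitive_def
      by (intro conjI span_line_eq_kernel linear_plane_projection) (auto simp: vec2_eq_iff intro!: Gcd_eq_1_I[of 1])
  qed
  moreover have "triangle_translate (plane_projection (u j) ` example_triple k i) \<longleftrightarrow> i \<noteq> j" for i j
  proof
    assume "i \<noteq> j"
    moreover have e: "axis 1 1 = (vector [1, 0] :: real^2)" "axis 2 1 = (vector [0, 1] :: real^2)"
      "vector [0, 0] = (0 :: real^2)"
      by (simp_all add: vec2_eq_iff axis_def)
    \<comment> \<open>Off the diagonal the functional \<open>u j\<close> vanishes at the apex, which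
      therefore projects to (0, 1), while the base projects onto the edge from (0, 0) to (1,
      0).\<close>
    ultimately have "plane_projection (u j) ` example_triple k i = unimodular_triangle"
      using exhaust_3[of i] exhaust_3[of j] unfolding unimodular_triangle_def
      by (elim disjE)
        (simp_all add: u example_triple_def plane_projection_simplex inner_real3 insert_commute[of _ 0] insert_commute[of "vector [0, 1]"])
    then show "triangle_translate (plane_projection (u j) ` example_triple k i)"
      unfolding triangle_translate_def by (intro bexI[of _ 0]) (auto simp: int_lattice_0)
  next
    assume T: "triangle_translate (plane_projection (u j) ` example_triple k i)"
    show "i \<noteq> j"
    proof
      assume "i = j"
      \<comment> \<open>On the diagonal the apex and the origin differ by \<open>k\<close> in the
        first coordinate of the image, too much once \<open>k\<close> is at least two.\<close>
      have "\<exists>a b. example_triple k j = pointed_simplex a b \<and> \<bar>u j \<bullet> vector [a, b, 1]\<bar> = real k"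
      proof -
        consider "j = 1" | "j = 2" | "j = 3" using exhaust_3[of j] by blast
        then show ?thesis
        proof cases
          case 1
          then show ?thesis
            by (intro exI[of _ 0] exI[of _ "real k"]) (simp add: u example_triple_def inner_real3)
        next
          case 2
          then show ?thesis
            by (intro exI[of _ "real k"] exI[of _ 0]) (simp add: u example_triple_def inner_real3)
        next
          case 3
          then show ?thesis
            by (intro exI[of _ 0]) (simp add: u example_triple_def inner_real3)
        qed
      qed
      then obtain a b where ab: "example_triple k j = pointed_simplex a b" "\<bar>u j \<bullet> vector [a, b, 1]\<bar> = real k"
        by blast
      define y :: "real^3" where "y = vector [a, b, 1]"
      have y: "y \<in> example_triple k j" "\<bar>u j \<bullet> y\<bar> = k" "0 \<in> example_triple k j"
        unfolding y_def using ab by (simp_all add: pointed_simplex_def hull_inc)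
      have "plane_projection (u j) y $ 1 - plane_projection (u j) 0 $ 1 \<le> 1"
        "plane_projection (u j) 0 $ 1 - plane_projection (u j) y $ 1 \<le> 1"
        using T y \<open>i = j\<close> by (intro triangle_translate_width[OF T] imageI; simp)+
      then show False using y assms by simp
    qed
  qed
  moreover have "span (range v) = {x. x$3 = 0}"
  proof
    have "x \<in> span (range v)" if "x$3 = 0" for x
    proof -
      have "x = x$1 *\<^sub>R v 1 + x$2 *\<^sub>R v 2" using that by (simp add: v vec3_eq_iff)
      then show ?thesis by (metis rangeI span_add span_base span_scale)
    qed
    then show "{x. x$3 = 0} \<subseteq> span (range v)" by blast
    have "subspace {x :: real^3. x$3 = 0}" by (simp add: subspace_def)
    moreover have "v i $ 3 = 0" for i using exhaust_3[of i] by (auto simp: v)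
    ultimately show "span (range v) \<subseteq> {x. x$3 = 0}" by (intro span_minimal) auto
  qed
  ultimately show ?thesis
    unfolding projecting_triples_def mem_Collect_eq
    by (intro conjI allI exI[of _ "\<lambda>i. plane_projection (u i)"] exI[of _ v]) simp_all
qed

lemma finite_lattice_points_of_sum:
  assumes "\<And>i. bounded (P i)"
  shows "finite (lattice_points_of_sum P)"
  unfolding lattice_points_of_sum_def
proof (rule finite_bounded_int_lattice)
  have "\<forall>i. \<exists>B. \<forall>x\<in>P i. norm x \<le> B" using assms by (simp add: bounded_iff)
  then obtain B where B: "\<And>i x. x \<in> P i \<Longrightarrow> norm x \<le> B i" by metis
  have "norm (\<Sum>i\<in>UNIV. p i) \<le> (\<Sum>i\<in>UNIV. B i)" if "\<forall>i. p i \<in> P i" for p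
    using that B by (intro order_trans[OF norm_sum] sum_mono) auto
  then show "bounded {\<Sum>i\<in>UNIV. p i | p. \<forall>i. p i \<in> P i}"
    by (auto simp: bounded_iff)
qed

text \<open>The segment joining the apexes (0, k, 1) and (k, 0, 1) carries k + 1 lattice points. It
  lies in the total sum because all three polytopes contain the origin.\<close>

lemma card_lattice_points_example:
  assumes "2 \<le> k"
  shows "k < card (lattice_points_of_sum (example_triple k))"
proof -
  let ?f = "\<lambda>j. vector [real k - real j, real j, 1] :: real^3"
  have "?f j \<in> lattice_points_of_sum (example_triple k)" if "j \<le> k" for j
  proof -
    define p where "p = (\<lambda>i::3. if i = 1 then (j / k) *\<^sub>R vector [0, real k, 1]
        else if i = 2 then (1 - j / k) *\<^sub>R vector [real k, 0, 1] else (0 :: real^3))"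
    have seg: "r *\<^sub>R vector [a, b, 1] \<in> pointed_simplex a b" if "0 \<le> r" "r \<le> 1" for r a b :: real
    proof -
      have "r *\<^sub>R vector [a, b, 1] + (1 - r) *\<^sub>R 0 \<in> pointed_simplex a b"
        unfolding pointed_simplex_def using that by (intro convexD convex_convex_hull hull_inc) auto
      then show ?thesis by simp
    qed
    have "p i \<in> example_triple k i" for i
      using exhaust_3[of i] seg[of 0 0 0] \<open>j \<le> k\<close> assms
      by (auto simp: p_def example_triple_def intro!: seg)
    moreover have "(\<Sum>i\<in>UNIV. p i) = ?f j"
      using assms by (simp add: sum_3 p_def vec3_eq_iff field_simps)
    ultimately show ?thesis
      unfolding lattice_points_of_sum_def using int_lattice_vector_iff[of "real k - real j" "real j" 1] 
      by (auto intro!: exI[of _ p])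
  qed
  then have "?f ` {..k} \<subseteq> lattice_points_of_sum (example_triple k)" by auto
  moreover have "bounded (example_triple k i)" for i
    using exhaust_3[of i] 
    by (auto simp: example_triple_def lattice_polytope_3d_pointed_simplex lattice_polytope_3d_bounded)
  ultimately have "card (?f ` {..k}) \<le> card (lattice_points_of_sum (example_triple k))"
    by (intro card_mono finite_lattice_points_of_sum)
  moreover have "inj_on ?f {..k}" by (auto simp: inj_on_def vec3_eq_iff)
  ultimately show ?thesis by (simp add: card_image)
qed

lemma infinite_classes: "infinite (projecting_triples // {(P, Q). triple_equiv P Q})"
proof
  let ?c = "\<lambda>P. card (lattice_points_of_sum P)"
  assume "finite (projecting_triples // {(P, Q). triple_equiv P Q})"
  then have fin: "finite ((\<lambda>C. ?c ` C) ` (projecting_triples // {(P, Q). triple_equiv P Q}))" by simp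
  \<comment> \<open>The count is constant on a class, so its image of a class is a singleton, and
    finitely many classes would bound the counts.\<close>
  have "{?c (example_triple k)} \<in> (\<lambda>C. ?c ` C) ` (projecting_triples // {(P, Q). triple_equiv P Q})"
    if "2 \<le> k" for k
  proof (rule image_eqI)
    show "{(P, Q). triple_equiv P Q} `` {example_triple k} \<in> projecting_triples // {(P, Q). triple_equiv P Q}"
      using example_triple_projecting[OF that] by (rule quotientI)
    show "{?c (example_triple k)} = ?c ` ({(P, Q). triple_equiv P Q} `` {example_triple k})"
      using triple_equiv_refl card_lattice_points_of_sum_equiv by force
  qed
  then have "(\<lambda>k. {?c (example_triple k)}) ` {2..} \<subseteq> (\<lambda>C. ?c ` C) ` (projecting_triples // {(P, Q). triple_equiv P Q})"
    by auto
  with fin have "finite ((\<lambda>k. {?c (example_triple k)}) ` {2..})" by (rule rev_finite_subset)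
  then have "finite (the_elem ` (\<lambda>k. {?c (example_triple k)}) ` {2..})" by (rule finite_imageI)
  then have "finite (?c ` example_triple ` {2..})" by (simp add: image_image)
  then obtain N where N: "\<And>k. 2 \<le> k \<Longrightarrow> ?c (example_triple k) \<le> N"
    by (auto simp: finite_nat_set_iff_bounded_le)
  have "N + 2 < ?c (example_triple (N + 2))" by (rule card_lattice_points_example) simp
  with N[of "N + 2"] show False by simp
qed

section \<open>Projections onto the unimodular triangle\<close>

definition standard_image :: "real^3 \<Rightarrow> real^3 \<Rightarrow> (real^3) set \<Rightarrow> bool" where
  "standard_image a b V \<longleftrightarrow>
    (\<exists>m\<in>\<int>. \<exists>n\<in>\<int>. (\<lambda>x. (a \<bullet> x, b \<bullet> x)) ` V = {(m, n), (m + 1, n), (m, n + 1)})"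

lemma standard_image_swap: "standard_image a b V \<longleftrightarrow> standard_image b a V"
proof -
  have "standard_image b a V" if ab: "standard_image a b V" for a b
  proof -
    obtain m n where mn: "m \<in> \<int>" "n \<in> \<int>" "(\<lambda>x. (a \<bullet> x, b \<bullet> x)) ` V = {(m, n), (m + 1, n), (m, n + 1)}"
      using ab by (auto simp: standard_image_def)
    have "(\<lambda>x. (b \<bullet> x, a \<bullet> x)) ` V = prod.swap ` (\<lambda>x. (a \<bullet> x, b \<bullet> x)) ` V"
      by (simp add: image_image)
    also have "\<dots> = {(n, m), (n + 1, m), (n, m + 1)}" unfolding mn by auto
    finally show ?thesis using mn unfolding standard_image_def by blast
  qed
  then show ?thesis by blast
qed

text \<open>An affine symmetry of the triangle, which fixes the vertex (m + 1, n) and exchanges the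
  other two. Together with the swap it generates all six symmetries.\<close>

lemma standard_image_rotate: "standard_image a (- a - b) V \<longleftrightarrow> standard_image a b V"
proof -
  have *: "standard_image a (- a - b) V" if ab: "standard_image a b V" for b
  proof -
    obtain m n where mn: "m \<in> \<int>" "n \<in> \<int>" "(\<lambda>x. (a \<bullet> x, b \<bullet> x)) ` V = {(m, n), (m + 1, n), (m, n + 1)}"
      using ab by (auto simp: standard_image_def)
    have "(\<lambda>x. (a \<bullet> x, (- a - b) \<bullet> x)) ` V = (\<lambda>(p, q). (p, - p - q)) ` (\<lambda>x. (a \<bullet> x, b \<bullet> x)) ` V"
      by (simp add: image_image inner_diff_left)
    also have "\<dots> = {(m, - m - n - 1), (m + 1, - m - n - 1), (m, (- m - n - 1) + 1)}"
      unfolding mn by auto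
    finally show ?thesis using mn unfolding standard_image_def by (meson Ints_1 Ints_diff Ints_minus)
  qed
  from *[of b] *[of "- a - b"] show ?thesis by auto
qed

text \<open>The symmetry that exchanges the two ends of the edge on which \<open>h\<close> is
  constant. It leaves \<open>h\<close> alone and is the source of the later changes of sign.\<close>

lemma standard_image_flip: "standard_image (- a - h) h V \<longleftrightarrow> standard_image a h V"
  by (metis standard_image_rotate standard_image_swap diff_minus_eq_add add.commute uminus_add_conv_diff)

section \<open>Integral triangles and the functionals of a lattice projection\<close>

lemma lattice_points_unimodular_triangle:
  "unimodular_triangle = {x. 0 \<le> x$1 \<and> 0 \<le> x$2 \<and> x$1 + x$2 \<le> 1}"
  "unimodular_triangle \<inter> int_lattice = {0, axis 1 1, axis 2 1}"
proof -
  have nth: "(axis 1 1 :: real^2) $ 1 = 1" "(axis 1 1 :: real^2) $ 2 = 0" 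
    "(axis 2 1 :: real^2) $ 1 = 0" "(axis 2 1 :: real^2) $ 2 = 1" by (simp_all add: axis_def)
  have "x \<in> unimodular_triangle \<longleftrightarrow> 0 \<le> x$1 \<and> 0 \<le> x$2 \<and> x$1 + x$2 \<le> 1" for x
  proof -
    have "x \<in> unimodular_triangle \<longleftrightarrow> (\<exists>u v w. 0 \<le> u \<and> 0 \<le> v \<and> 0 \<le> w \<and> u + v + w = 1 \<and> x$1 = v \<and> x$2 = w)"
      unfolding unimodular_triangle_def convex_hull_3 by (simp add: vec2_eq_iff nth)
    also have "\<dots> \<longleftrightarrow> 0 \<le> x$1 \<and> 0 \<le> x$2 \<and> x$1 + x$2 \<le> 1"
      by (auto intro!: exI[of _ "1 - x$1 - x$2"])
    finally show ?thesis .
  qed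
  then show 1: "unimodular_triangle = {x. 0 \<le> x$1 \<and> 0 \<le> x$2 \<and> x$1 + x$2 \<le> 1}" by blast
  have "x \<in> {0, axis 1 1, axis 2 1}" if x: "0 \<le> x$1" "0 \<le> x$2" "x$1 + x$2 \<le> 1" "x \<in> int_lattice" for x :: "real^2"
  proof -
    obtain p q where pq: "x$1 = of_int p" "x$2 = of_int q"
      using x(4) unfolding int_lattice_def by (metis Ints_cases mem_Collect_eq)
    have "0 \<le> p" "0 \<le> q" "p + q \<le> 1"
      using x(1-3) unfolding pq by linarith+
    then have "p = 0 \<and> q = 0 \<or> p = 1 \<and> q = 0 \<or> p = 0 \<and> q = 1" by linarith
    then show ?thesis using pq by (auto simp: vec2_eq_iff nth)
  qed
  then show "unimodular_triangle \<inter> int_lattice = {0, axis 1 1, axis 2 1}"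
    unfolding 1 using nth by (auto simp: int_lattice_0 int_lattice_axis)
qed

lemma triangle_translate_hull_iff:
  assumes "V \<subseteq> int_lattice"
  shows "triangle_translate (convex hull V) \<longleftrightarrow> (\<exists>t\<in>int_lattice. V = {t, t + axis 1 1, t + axis 2 1})"
proof
  assume "\<exists>t\<in>int_lattice. V = {t, t + axis 1 1, t + axis 2 1}"
  then obtain t where t: "t \<in> int_lattice" "V = (+) t ` {0, axis 1 1, axis 2 1}" by auto
  show "triangle_translate (convex hull V)"
    using t(1) unfolding t(2) triangle_translate_def unimodular_triangle_def convex_hull_translation by blast
next
  assume "triangle_translate (convex hull V)"
  then obtain t where t: "t \<in> int_lattice" "convex hull V = (+) t ` unimodular_triangle"
    by (auto simp: triangle_translate_def)
  have nth: "(axis 1 1 :: real^2) $ 1 = 1" "(axis 1 1 :: real^2) $ 2 = 0" 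
    "(axis 2 1 :: real^2) $ 1 = 0" "(axis 2 1 :: real^2) $ 2 = 1" by (simp_all add: axis_def)
  have sub: "V \<subseteq> {t, t + axis 1 1, t + axis 2 1}"
  proof
    fix x assume x: "x \<in> V"
    then have "x - t \<in> unimodular_triangle"
      using hull_inc[of x V convex] t(2) by auto
    then have "x - t \<in> {0, axis 1 1, axis 2 1}"
      using lattice_points_unimodular_triangle(2) x assms t(1) int_lattice_diff by blast
    then show "x \<in> {t, t + axis 1 1, t + axis 2 1}" by (auto simp: algebra_simps)
  qed
  have mem: "t + y \<in> convex hull V" if "y \<in> {0, axis 1 1, axis 2 1}" for y
    using that lattice_points_unimodular_triangle(2) t(2) by blast
  \<comment> \<open>An open halfspace that meets the hull meets \<open>V\<close>. Each of the three
    functionals used below cuts a single vertex off the triangle, so that vertex belongs to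
    \<open>V\<close>.\<close>
  have half: "\<exists>x\<in>V. c < a \<bullet> x" if "y \<in> convex hull V" "c < a \<bullet> y" for a y :: "real^2" and c
  proof (rule ccontr)
    assume "\<not> (\<exists>x\<in>V. c < a \<bullet> x)"
    then have "V \<subseteq> {x. a \<bullet> x \<le> c}" by auto
    then have "convex hull V \<subseteq> {x. a \<bullet> x \<le> c}" by (intro hull_minimal convex_halfspace_le)
    with that show False by auto
  qed
  have in2: "a \<bullet> x = a$1 * x$1 + a$2 * x$2" for a x :: "real^2" by (simp add: inner_vec_def sum_2)
  have "t \<in> V"
    using half[of t "- t$1 - t$2 - 1" "vector [-1, -1]"] mem[of 0] sub by (auto simp: in2 nth)
  moreover have "t + axis 1 1 \<in> V"
    using half[of "t + axis 1 1" "t$1" "vector [1, 0]"] mem[of "axis 1 1"] sub by (auto simp: in2 nth)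
  moreover have "t + axis 2 1 \<in> V"
    using half[of "t + axis 2 1" "t$2" "vector [0, 1]"] mem[of "axis 2 1"] sub by (auto simp: in2 nth)
  ultimately show "\<exists>t\<in>int_lattice. V = {t, t + axis 1 1, t + axis 2 1}"
    using sub t(1) by blast
qed

text \<open>\<open>A\<close> and \<open>B\<close> are the rows of the linear part. Lattice preimages
  \<open>w1\<close>, \<open>w2\<close> of the unit vectors exist because the projection is onto the
  integer plane; they form a dual system that later makes coefficients integral. The translation
  part is a lattice vector and does not affect the triangle condition.\<close>

lemma lattice_projectionE:
  assumes "lattice_projection \<phi>"
  obtains A B w1 w2 where "A \<in> int_lattice" "B \<in> int_lattice" "w1 \<in> int_lattice" "w2 \<in> int_lattice"
    "A \<bullet> w1 = 1" "B \<bullet> w1 = 0" "A \<bullet> w2 = 0" "B \<bullet> w2 = 1"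
    "\<And>x. \<phi> x = \<phi> 0 + vector [A \<bullet> x, B \<bullet> x]"
    "\<And>P. lattice_polytope P \<Longrightarrow> triangle_translate (\<phi> ` P) \<longleftrightarrow> standard_image A B (P \<inter> int_lattice)"
proof -
  define L where "L x = \<phi> x - \<phi> 0" for x
  have L: "linear L" "\<phi> ` int_lattice = int_lattice"
    using assms by (simp_all add: L_def[abs_def] lattice_projection_def affine_linear_def)
  have c: "\<phi> 0 \<in> int_lattice" using L(2) int_lattice_0 by blast
  define A where "A = matrix L $ 1"
  define B where "B = matrix L $ 2"
  have LAB: "L x = vector [A \<bullet> x, B \<bullet> x]" for x
    using matrix_works[OF L(1)[folded linear_matrix_vector_mul_eq], of x]
    by (simp add: vec2_eq_iff A_def B_def flip: matrix_vector_mul_component)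
  have Lint: "L x \<in> int_lattice" if "x \<in> int_lattice" for x
    using L(2) c that by (auto simp: L_def intro!: int_lattice_diff)
  have "matrix L $ i $ j \<in> \<int>" for i j
    using Lint[OF int_lattice_axis[of j]] by (simp add: matrix_def int_lattice_def)
  then have AB: "A \<in> int_lattice" "B \<in> int_lattice"
    by (simp_all add: A_def B_def int_lattice_def)
  have "\<exists>w\<in>int_lattice. L w = y" if "y \<in> int_lattice" for y
  proof -
    have "\<phi> 0 + y \<in> \<phi> ` int_lattice" using L(2) c that int_lattice_add by blast
    then obtain w where "w \<in> int_lattice" "\<phi> w = \<phi> 0 + y" by (metis imageE)
    then show ?thesis by (intro bexI[of _ w]) (simp_all add: L_def)
  qed
  then obtain w1 w2 where w: "w1 \<in> int_lattice" "w2 \<in> int_lattice" "L w1 = axis 1 1" "L w2 = axis 2 1"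
    using int_lattice_axis by blast
  have "triangle_translate (\<phi> ` P) \<longleftrightarrow> standard_image A B (P \<inter> int_lattice)" if P: "lattice_polytope P" for P
  proof -
    let ?V = "P \<inter> int_lattice"
    have \<phi>: "\<phi> = (\<lambda>x. \<phi> 0 + L x)" by (auto simp: L_def)
    have sub: "(+) (\<phi> 0) ` L ` ?V \<subseteq> int_lattice" using Lint c int_lattice_add by blast
    have "\<phi> ` P = (\<lambda>x. \<phi> 0 + L x) ` (convex hull ?V)"
      using lattice_polytope_hull[OF P] \<phi> by metis
    also have "\<dots> = (+) (\<phi> 0) ` L ` (convex hull ?V)"
      by (simp add: image_image)
    also have "\<dots> = convex hull ((+) (\<phi> 0) ` L ` ?V)"
      by (simp add: convex_hull_linear_image[OF L(1)] convex_hull_translation)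
    finally have "triangle_translate (\<phi> ` P) \<longleftrightarrow>
        (\<exists>t\<in>int_lattice. (+) (\<phi> 0) ` L ` ?V = {t, t + axis 1 1, t + axis 2 1})"
      using triangle_translate_hull_iff[OF sub] by simp
    also have "\<dots> \<longleftrightarrow> (\<exists>t\<in>int_lattice. L ` ?V = {t, t + axis 1 1, t + axis 2 1})"
    proof safe
      fix t assume t: "t \<in> int_lattice" "(+) (\<phi> 0) ` L ` ?V = {t, t + axis 1 1, t + axis 2 1}"
      have "L ` ?V = (+) (- \<phi> 0) ` (+) (\<phi> 0) ` L ` ?V" by (simp add: image_image)
      also have "\<dots> = {(t - \<phi> 0), (t - \<phi> 0) + axis 1 1, (t - \<phi> 0) + axis 2 1}"
        unfolding t by (auto simp: algebra_simps)
      finally show "\<exists>t\<in>int_lattice. L ` ?V = {t, t + axis 1 1, t + axis 2 1}"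
        using t(1) c int_lattice_diff by blast
    next
      fix t assume t: "t \<in> int_lattice" "L ` ?V = {t, t + axis 1 1, t + axis 2 1}"
      have "(+) (\<phi> 0) ` L ` ?V = {(\<phi> 0 + t), (\<phi> 0 + t) + axis 1 1, (\<phi> 0 + t) + axis 2 1}"
        unfolding t by (auto simp: algebra_simps)
      then show "\<exists>t\<in>int_lattice. (+) (\<phi> 0) ` L ` ?V = {t, t + axis 1 1, t + axis 2 1}"
        using t(1) c int_lattice_add by blast
    qed
    also have "\<dots> \<longleftrightarrow> standard_image A B ?V"
    proof -
      let ?g = "\<lambda>y :: real^2. (y$1, y$2)"
      have g: "inj ?g" by (auto simp: inj_on_def vec2_eq_iff)
      have *: "L ` ?V = {t, t + axis 1 1, t + axis 2 1} \<longleftrightarrow> (\<lambda>x. (A \<bullet> x, B \<bullet> x)) ` ?V = {(t$1, t$2), (t$1 + 1, t$2), (t$1, t$2 + 1)}" for t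
      proof -
        have "?g ` L ` ?V = (\<lambda>x. (A \<bullet> x, B \<bullet> x)) ` ?V" by (simp add: LAB image_image)
        moreover have "?g ` {t, t + axis 1 1, t + axis 2 1} = {(t$1, t$2), (t$1 + 1, t$2), (t$1, t$2 + 1)}"
          by (simp add: axis_def)
        ultimately show ?thesis by (subst inj_image_eq_iff[OF g, symmetric]) (simp only:)
      qed
      show ?thesis
      proof
        assume "\<exists>t\<in>int_lattice. L ` ?V = {t, t + axis 1 1, t + axis 2 1}"
        then show "standard_image A B ?V" unfolding * standard_image_def by (auto simp: int_lattice_def)
      next
        assume "standard_image A B ?V"
        then obtain m n where mn: "m \<in> \<int>" "n \<in> \<int>" "(\<lambda>x. (A \<bullet> x, B \<bullet> x)) ` ?V = {(m, n), (m + 1, n), (m, n + 1)}"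
          by (auto simp: standard_image_def)
        then show "\<exists>t\<in>int_lattice. L ` ?V = {t, t + axis 1 1, t + axis 2 1}"
          unfolding * by (intro bexI[of _ "vector [m, n]"]) (simp_all add: int_lattice_vector2_iff)
      qed
    qed
    finally show ?thesis .
  qed
  moreover have "\<phi> x = \<phi> 0 + vector [A \<bullet> x, B \<bullet> x]" for x
    using LAB[of x] by (simp add: L_def algebra_simps)
  moreover have "A \<bullet> w1 = 1" "B \<bullet> w1 = 0" "A \<bullet> w2 = 0" "B \<bullet> w2 = 1"
    using w(3,4) by (simp_all add: LAB vec2_eq_iff axis_def)
  ultimately show ?thesis using that AB w by blast
qed

lemma other_index: "\<exists>i::3. i \<noteq> j \<and> i \<noteq> k"
proof -
  have "card {j, k} < CARD(3)" using card_insert_le_m1[of 2 "{k}" j] by simp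
  then have "{j, k} \<noteq> UNIV" by (metis less_irrefl)
  then show ?thesis by auto
qed

text \<open>If the kernels of two of the projections agreed, then translates \<open>\<phi> k ` P j\<close> and
  \<open>\<phi> k ` P i\<close> would be carried to translates \<open>\<phi> j ` P j\<close> and \<open>\<phi> j ` P i\<close>, against
  the only-if part of the triangle condition.\<close>

lemma triangle_translate_transfer:
  assumes "lattice_projection \<phi>" "lattice_projection \<psi>"
    and ker: "\<And>x. \<phi> x = \<phi> 0 \<longleftrightarrow> \<psi> x = \<psi> 0"
    and P: "triangle_translate (\<phi> ` P)" "triangle_translate (\<phi> ` Q)" and Q: "triangle_translate (\<psi> ` Q)"
  shows "triangle_translate (\<psi> ` P)"
proof -
  obtain A B w1 w2 where \<phi>: "w1 \<in> int_lattice" "w2 \<in> int_lattice"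
    "A \<bullet> w1 = 1" "B \<bullet> w1 = 0" "A \<bullet> w2 = 0" "B \<bullet> w2 = 1" "\<And>x. \<phi> x = \<phi> 0 + vector [A \<bullet> x, B \<bullet> x]"
    using lattice_projectionE[OF assms(1)] by metis
  obtain A' B' where \<psi>: "A' \<in> int_lattice" "B' \<in> int_lattice" "\<And>x. \<psi> x = \<psi> 0 + vector [A' \<bullet> x, B' \<bullet> x]"
    using lattice_projectionE[OF assms(2)] by metis
  obtain s where s: "s \<in> int_lattice" "\<phi> ` P = (+) s ` unimodular_triangle"
    using P(1) unfolding triangle_translate_def by blast
  obtain t where t: "t \<in> int_lattice" "\<phi> ` Q = (+) t ` unimodular_triangle"
    using P(2) unfolding triangle_translate_def by blast
  note st = s(1) t(1) s(2) t(2)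
  \<comment> \<open>A lattice vector whose image under the linear part of \<open>\<phi>\<close> is
    \<open>s - t\<close>. Points of \<open>P\<close> then match points of \<open>Q\<close> shifted
    by \<open>u\<close>, up to the kernel, and the kernel is the same for
    \<open>\<psi>\<close>.\<close>
  define u where "u = (s - t)$1 *\<^sub>R w1 + (s - t)$2 *\<^sub>R w2"
  have u: "u \<in> int_lattice"
    using int_lattice_diff[OF st(1,2)] unfolding u_def
    by (intro int_lattice_add int_lattice_scaleR \<phi>(1,2)) (simp_all add: int_lattice_def)
  have ker': "A' \<bullet> x = 0 \<and> B' \<bullet> x = 0" if "A \<bullet> x = 0" "B \<bullet> x = 0" for x
  proof -
    have "vector [0, 0] = (0 :: real^2)" by (simp add: vec2_eq_iff)
    then have "\<psi> x = \<psi> 0" using ker[of x] \<phi>(7)[of x] that by simp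
    then show ?thesis using \<psi>(3)[of x] by (simp add: vec2_eq_iff)
  qed
  have shift: "\<psi> p = \<psi> q + vector [A' \<bullet> u, B' \<bullet> u]" if "\<phi> p = \<phi> q + (s - t)" for p q
  proof -
    have "A \<bullet> (p - q - u) = 0" "B \<bullet> (p - q - u) = 0"
      using that \<phi>(3-6) \<phi>(7)[of p] \<phi>(7)[of q]
      by (simp_all add: u_def vec2_eq_iff inner_diff_right inner_add_right)
    then have "A' \<bullet> (p - q - u) = 0" "B' \<bullet> (p - q - u) = 0" using ker' by blast+
    then show ?thesis
      using \<psi>(3)[of p] \<psi>(3)[of q] by (simp add: vec2_eq_iff inner_diff_right)
  qed
  have "\<psi> ` P = (+) (vector [A' \<bullet> u, B' \<bullet> u]) ` \<psi> ` Q"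
  proof (intro subset_antisym subsetI)
    fix y assume "y \<in> \<psi> ` P"
    then obtain p where p: "p \<in> P" "y = \<psi> p" by blast
    then obtain x where "x \<in> unimodular_triangle" "\<phi> p = s + x" using st(3) by blast
    then obtain q where "q \<in> Q" "\<phi> q = t + x" using st(4) by (metis imageE imageI)
    then show "y \<in> (+) (vector [A' \<bullet> u, B' \<bullet> u]) ` \<psi> ` Q"
      using shift[of p q] p \<open>\<phi> p = s + x\<close> by (auto simp: add.commute)
  next
    fix y assume "y \<in> (+) (vector [A' \<bullet> u, B' \<bullet> u]) ` \<psi> ` Q"
    then obtain q where q: "q \<in> Q" "y = vector [A' \<bullet> u, B' \<bullet> u] + \<psi> q" by blast
    then obtain x where "x \<in> unimodular_triangle" "\<phi> q = t + x" using st(4) by blast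
    then obtain p where "p \<in> P" "\<phi> p = s + x" using st(3) by (metis imageE imageI)
    then show "y \<in> \<psi> ` P"
      using shift[of p q] q \<open>\<phi> q = t + x\<close> by (intro image_eqI[of _ _ p]) (auto simp: add.commute)
  qed
  moreover have "vector [A' \<bullet> u, B' \<bullet> u] \<in> (int_lattice :: (real^2) set)"
    using \<psi> u by (simp add: int_lattice_vector2_iff int_lattice_inner)
  moreover obtain t' where "t' \<in> int_lattice" "\<psi> ` Q = (+) t' ` unimodular_triangle"
    using Q unfolding triangle_translate_def by blast
  ultimately have "\<psi> ` P = (+) (vector [A' \<bullet> u, B' \<bullet> u] + t') ` unimodular_triangle"
    by (simp add: image_image add.assoc)
  then show ?thesis
    using \<open>vector _ \<in> int_lattice\<close> \<open>t' \<in> int_lattice\<close> int_lattice_add unfolding triangle_translate_def by blast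
qed

lemma span_singleton_eq:
  fixes x v :: "'a::real_vector"
  assumes "x \<in> span {v}" "x \<noteq> 0"
  shows "span {x} = span {v}"
proof -
  obtain c where c: "x = c *\<^sub>R v" using assms(1) by (auto simp: span_singleton)
  then have "v = inverse c *\<^sub>R x" using assms(2) by simp
  then have "v \<in> span {x}" by (metis span_base span_scale singletonI)
  then show ?thesis using assms(1) by (simp add: span_eq)
qed

lemma Ints_mult_eq_1:
  fixes x y :: real
  assumes "x \<in> \<int>" "y \<in> \<int>" "x * y = 1 \<or> x * y = -1"
  shows "x = 1 \<or> x = -1"
proof -
  obtain p q where "x = of_int p" "y = of_int q" using assms(1,2) by (metis Ints_cases)
  then have "of_int (p * q) = (of_int 1 :: real) \<or> of_int (p * q) = (of_int (-1) :: real)"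
    using assms(3) by simp
  then have "p * q = 1 \<or> p * q = -1" by (simp only: of_int_eq_iff)
  then have "p dvd 1" by (metis dvd_triv_left dvd_minus_iff)
  then have "p = 1 \<or> p = -1" by (simp add: abs_eq_iff')
  then show ?thesis using \<open>x = of_int p\<close> by auto
qed

lemma card_le_3: "card S \<le> 3" if "S \<subseteq> {a, b, c}"
proof -
  have "card {a, b, c} \<le> 3" by (simp add: card_insert_if)
  then show ?thesis using card_mono[OF _ that] by simp
qed

text \<open>If the third coordinate took three distinct values on the vertices of the triangle, it would
  separate the lattice points of \<open>P\<close>: two of them on one level differ by an element of both kernels.\<close>

lemma triangle_coefficients:
  assumes "standard_image A B V" "standard_image A' B' V" "finite V" "4 \<le> card V"
    and z: "axis 3 1 = \<alpha> *\<^sub>R A + \<beta> *\<^sub>R B" and z': "axis 3 1 = \<alpha>' *\<^sub>R A' + \<beta>' *\<^sub>R B'"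
    and inj: "\<And>x. A \<bullet> x = 0 \<Longrightarrow> B \<bullet> x = 0 \<Longrightarrow> A' \<bullet> x = 0 \<Longrightarrow> B' \<bullet> x = 0 \<Longrightarrow> x = 0"
  shows "\<alpha> = 0 \<or> \<beta> = 0 \<or> \<alpha> = \<beta>"
proof (rule ccontr)
  assume ne: "\<not> (\<alpha> = 0 \<or> \<beta> = 0 \<or> \<alpha> = \<beta>)"
  have levels: "(\<lambda>x. x$3) ` V = (\<lambda>r. \<alpha> * m + \<beta> * n + r) ` {0, \<alpha>, \<beta>}"
    if "axis 3 1 = \<alpha> *\<^sub>R A + \<beta> *\<^sub>R B" "(\<lambda>x. (A \<bullet> x, B \<bullet> x)) ` V = {(m, n), (m + 1, n), (m, n + 1)}" for \<alpha> \<beta> A B m n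
  proof -
    have "x$3 = \<alpha> * (A \<bullet> x) + \<beta> * (B \<bullet> x)" for x
      using inner_axis'[of 3 "1::real" x] unfolding that(1) by (simp add: inner_add_left)
    then have "(\<lambda>x. x$3) ` V = (\<lambda>(p, q). \<alpha> * p + \<beta> * q) ` (\<lambda>x. (A \<bullet> x, B \<bullet> x)) ` V"
      by (simp add: image_image)
    also have "\<dots> = (\<lambda>r. \<alpha> * m + \<beta> * n + r) ` {0, \<alpha>, \<beta>}"
      unfolding that(2) by (simp add: algebra_simps)
    finally show ?thesis .
  qed
  have level_inj: "A \<bullet> x = A \<bullet> y \<and> B \<bullet> x = B \<bullet> y"
    if lv: "axis 3 1 = \<alpha> *\<^sub>R A + \<beta> *\<^sub>R B" "standard_image A B V" "\<alpha> \<noteq> 0" "\<beta> \<noteq> 0" "\<alpha> \<noteq> \<beta>" 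
      "x \<in> V" "y \<in> V" "x$3 = y$3" for \<alpha> \<beta> A B x y
  proof -
    obtain m n where mn: "(\<lambda>x. (A \<bullet> x, B \<bullet> x)) ` V = {(m, n), (m + 1, n), (m, n + 1)}"
      using lv(2) by (auto simp: standard_image_def)
    have "x$3 = \<alpha> * (A \<bullet> x) + \<beta> * (B \<bullet> x)" for x
      using inner_axis'[of 3 "1::real" x] unfolding lv(1) by (simp add: inner_add_left)
    then have "\<alpha> * (A \<bullet> x) + \<beta> * (B \<bullet> x) = \<alpha> * (A \<bullet> y) + \<beta> * (B \<bullet> y)" using lv(8) by simp
    moreover have "(A \<bullet> x, B \<bullet> x) \<in> {(m, n), (m + 1, n), (m, n + 1)}"
      "(A \<bullet> y, B \<bullet> y) \<in> {(m, n), (m + 1, n), (m, n + 1)}"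
      using lv(6,7) mn by blast+
    ultimately show ?thesis using lv(3-5) by (auto simp: algebra_simps)
  qed
  obtain m n m' n' where mn: "(\<lambda>x. (A \<bullet> x, B \<bullet> x)) ` V = {(m, n), (m + 1, n), (m, n + 1)}"
    "(\<lambda>x. (A' \<bullet> x, B' \<bullet> x)) ` V = {(m', n'), (m' + 1, n'), (m', n' + 1)}"
    using assms(1,2) unfolding standard_image_def by metis
  have card3: "card ((\<lambda>x. x$3) ` V) = card {0, \<alpha>, \<beta>}"
    unfolding levels[OF z mn(1)] by (rule card_image) (rule inj_on_add)
  have card3': "card ((\<lambda>x. x$3) ` V) = card {0, \<alpha>', \<beta>'}"
    unfolding levels[OF z' mn(2)] by (rule card_image) (rule inj_on_add)
  \<comment> \<open>The number of levels depends on \<open>V\<close> alone, so the second triangle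
    has three distinct levels as well.\<close>
  have ne': "\<not> (\<alpha>' = 0 \<or> \<beta>' = 0 \<or> \<alpha>' = \<beta>')"
    using card3 card3' ne by (auto simp: card_insert_if split: if_splits)
  have "inj_on (\<lambda>x. x$3) V"
  proof (rule inj_onI)
    fix x y assume xy: "x \<in> V" "y \<in> V" "x$3 = y$3"
    have "x - y = 0"
      using level_inj[OF z assms(1) _ _ _ xy] level_inj[OF z' assms(2) _ _ _ xy] ne ne'
      by (intro inj) (auto simp: inner_diff_right)
    then show "x = y" by simp
  qed
  then have "card V = card {0, \<alpha>, \<beta>}" using card3 by (simp add: card_image)
  then show False using assms(4) card_le_3[of "{0, \<alpha>, \<beta>}" 0 \<alpha> \<beta>] by simp
qed

text \<open>Relative to the corner of the triangle, the other two vertices have heights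
  \<open>\<alpha>\<close> and \<open>\<beta>\<close>, so the three alternatives say which edge is
  horizontal. A symmetry of the triangle moves that edge to the position where the second functional
  is constant.\<close>

lemma horizontal_edge:
  assumes "A \<in> int_lattice" "B \<in> int_lattice" "w1 \<in> int_lattice" "w2 \<in> int_lattice"
    "A \<bullet> w1 = 1" "B \<bullet> w1 = 0" "A \<bullet> w2 = 0" "B \<bullet> w2 = 1"
    and z: "axis 3 1 = \<alpha> *\<^sub>R A + \<beta> *\<^sub>R B" and \<alpha>\<beta>: "\<alpha> = 0 \<or> \<beta> = 0 \<or> \<alpha> = \<beta>"
  obtains f s w where "f \<in> int_lattice" "s = 1 \<or> s = -1" "w \<in> int_lattice" "f \<bullet> w = 1" "w$3 = 0"
    "\<And>V. standard_image f (s *\<^sub>R axis 3 1) V \<longleftrightarrow> standard_image A B V"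
    "\<And>x. f \<bullet> x = 0 \<Longrightarrow> x$3 = 0 \<Longrightarrow> A \<bullet> x = 0 \<and> B \<bullet> x = 0"
proof -
  have x3: "x$3 = \<alpha> * (A \<bullet> x) + \<beta> * (B \<bullet> x)" for x
    using inner_axis'[of 3 "1::real" x] unfolding z by (simp add: inner_add_left)
  have coef: "\<alpha> = w1$3" "\<beta> = w2$3" using assms(5-8) x3[of w1] x3[of w2] by simp_all
  then have Z: "\<alpha> \<in> \<int>" "\<beta> \<in> \<int>" using assms(3,4) by (simp_all add: int_lattice_def)
  have "(axis 3 1 :: real^3) $ 3 = 1" by (simp add: axis_def)
  \<comment> \<open>The third entry of \<open>z\<close> is an integer relation. In each of the three
    cases it exhibits the remaining coefficient as a divisor of 1, so the opposite vertex is exactly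
    one level away from the edge.\<close>
  then have one: "\<alpha> * A$3 + \<beta> * B$3 = 1" unfolding z by simp
  have A3: "A$3 \<in> \<int>" "B$3 \<in> \<int>" using assms(1,2) by (simp_all add: int_lattice_def)
  consider "\<alpha> = 0" | "\<beta> = 0" | "\<alpha> = \<beta>" using \<alpha>\<beta> by blast
  then show thesis
  proof cases
    case 1
    then have s: "\<beta> = 1 \<or> \<beta> = -1" using one Ints_mult_eq_1[of \<beta> "B$3"] Z A3 by simp
    then have "\<beta> *\<^sub>R axis 3 1 = B" using z 1 by auto
    then show thesis using 1 s assms x3 x3[of w1] by (intro that[of A \<beta> w1]) auto
  next
    case 2
    then have s: "\<alpha> = 1 \<or> \<alpha> = -1" using one Ints_mult_eq_1[of \<alpha> "A$3"] Z A3 by simp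
    then have "\<alpha> *\<^sub>R axis 3 1 = A" using z 2 by auto
    then show thesis using 2 s assms x3 x3[of w2] 
      by (intro that[of B \<alpha> w2]) (auto simp: standard_image_swap[of B A])
  next
    case 3
    then have "\<alpha> * (A$3 + B$3) = 1" using one by (simp add: algebra_simps)
    then have s: "\<alpha> = 1 \<or> \<alpha> = -1" using Ints_mult_eq_1[of \<alpha> "A$3 + B$3"] Z A3 by simp
    then have h: "(- \<alpha>) *\<^sub>R axis 3 1 = - A - B" using z 3 by auto
    show thesis
    proof (rule that[of A "- \<alpha>" "w1 - w2"])
      show "standard_image A (- \<alpha> *\<^sub>R axis 3 1) V \<longleftrightarrow> standard_image A B V" for V
        unfolding h by (rule standard_image_rotate)
      show "(w1 - w2) $ 3 = 0" using coef 3 by simp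
    qed (use 3 s assms x3 in \<open>auto simp: int_lattice_diff inner_diff_right\<close>)
  qed
qed

lemma projecting_triples_functionals:
  assumes "P \<in> projecting_triples"
  obtains f s w where "\<And>k. f k \<in> int_lattice" "\<And>k. s k = 1 \<or> s k = (-1 :: real)"
    "\<And>k. w k \<in> int_lattice" "\<And>k. f k \<bullet> w k = 1" "\<And>k. w k $ 3 = 0"
    "\<And>i k. i \<noteq> k \<Longrightarrow> standard_image (f k) (s k *\<^sub>R axis 3 1) (P i \<inter> int_lattice)"
    "\<And>j k x. j \<noteq> k \<Longrightarrow> f j \<bullet> x = 0 \<Longrightarrow> f k \<bullet> x = 0 \<Longrightarrow> x$3 = 0 \<Longrightarrow> x = 0"
proof -
  note def = assms[unfolded projecting_triples_def mem_Collect_eq]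
  have P: "lattice_polytope_3d (P i)" for i using def by simp
  obtain \<phi> v where \<phi>v: "(\<forall>k. lattice_projection (\<phi> k) \<and> projection_direction (\<phi> k) (v k)) \<and>
      (\<forall>i j k. triangle_translate (\<phi> k ` P i) \<and> triangle_translate (\<phi> k ` P j) \<longleftrightarrow> i \<noteq> k \<and> j \<noteq> k) \<and>
      span (range v) = {x. x$3 = 0}"
    using def[THEN conjunct2] by (elim exE)
  then have \<phi>: "lattice_projection (\<phi> k)" and v: "projection_direction (\<phi> k) (v k)"
    and sp: "span (range v) = {x. x$3 = 0}" for k by simp_all
  have tri: "triangle_translate (\<phi> k ` P i) \<and> triangle_translate (\<phi> k ` P j) \<longleftrightarrow> i \<noteq> k \<and> j \<noteq> k" for i j k
    using \<phi>v by blast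
  have tri: "triangle_translate (\<phi> k ` P i) \<longleftrightarrow> i \<noteq> k" for i k using tri[of k i i] by blast
  have "\<forall>k. \<exists>A B w1 w2. A \<in> int_lattice \<and> B \<in> int_lattice \<and> w1 \<in> int_lattice \<and> w2 \<in> int_lattice \<and>
    A \<bullet> w1 = 1 \<and> B \<bullet> w1 = 0 \<and> A \<bullet> w2 = 0 \<and> B \<bullet> w2 = 1 \<and>
    (\<forall>x. \<phi> k x = \<phi> k 0 + vector [A \<bullet> x, B \<bullet> x]) \<and>
    (\<forall>P. lattice_polytope P \<longrightarrow> triangle_translate (\<phi> k ` P) \<longleftrightarrow> standard_image A B (P \<inter> int_lattice))"
  proof
    fix k
    show "\<exists>A B w1 w2. A \<in> int_lattice \<and> B \<in> int_lattice \<and> w1 \<in> int_lattice \<and> w2 \<in> int_lattice \<and>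
      A \<bullet> w1 = 1 \<and> B \<bullet> w1 = 0 \<and> A \<bullet> w2 = 0 \<and> B \<bullet> w2 = 1 \<and>
      (\<forall>x. \<phi> k x = \<phi> k 0 + vector [A \<bullet> x, B \<bullet> x]) \<and>
      (\<forall>P. lattice_polytope P \<longrightarrow> triangle_translate (\<phi> k ` P) \<longleftrightarrow> standard_image A B (P \<inter> int_lattice))"
      by (rule lattice_projectionE[OF \<phi>[of k]]) blast
  qed
  then obtain A B w1 w2 where AB: "\<And>k. A k \<in> int_lattice" "\<And>k. B k \<in> int_lattice"
    "\<And>k. w1 k \<in> int_lattice" "\<And>k. w2 k \<in> int_lattice"
    "\<And>k. A k \<bullet> w1 k = 1" "\<And>k. B k \<bullet> w1 k = 0" "\<And>k. A k \<bullet> w2 k = 0" "\<And>k. B k \<bullet> w2 k = 1"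
    and lin: "\<And>k x. \<phi> k x = \<phi> k 0 + vector [A k \<bullet> x, B k \<bullet> x]"
    and std: "\<And>k P. lattice_polytope P \<Longrightarrow> triangle_translate (\<phi> k ` P) \<longleftrightarrow> standard_image (A k) (B k) (P \<inter> int_lattice)"
    by metis
  have ker: "x \<in> span {v k} \<longleftrightarrow> A k \<bullet> x = 0 \<and> B k \<bullet> x = 0" for k x
    using v[of k] lin[of k x] by (simp add: projection_direction_def vec2_eq_iff)
  have ker0: "\<phi> k x = \<phi> k 0 \<longleftrightarrow> x \<in> span {v k}" for k x
    using v[of k] by (simp add: projection_direction_def)
  have indep: "x = 0" if "j \<noteq> k" "A j \<bullet> x = 0" "B j \<bullet> x = 0" "A k \<bullet> x = 0" "B k \<bullet> x = 0" for j k x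
  proof (rule ccontr)
    assume "x \<noteq> 0"
    then have "span {v j} = span {v k}"
      using that ker span_singleton_eq by metis
    obtain i where "i \<noteq> j" "i \<noteq> k" using other_index by blast
    then have "triangle_translate (\<phi> j ` P j)"
      using triangle_translate_transfer[OF \<phi>[of k] \<phi>[of j], of "P j" "P i"] tri \<open>j \<noteq> k\<close> ker0 \<open>span {v j} = span {v k}\<close>
      by simp
    then show False using tri by simp
  qed
  \<comment> \<open>Subtracting from \<open>x\<close> its expansion in the dual vectors leaves a
    vector of the kernel, which is horizontal. Hence the height is a combination of
    \<open>A k\<close> and \<open>B k\<close>, with the heights of the dual vectors as
    coefficients.\<close>
  have z: "axis 3 1 = (w1 k)$3 *\<^sub>R A k + (w2 k)$3 *\<^sub>R B k" for k
  proof (rule vector_eq_rdot[THEN iffD1], rule allI)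
    fix x
    let ?x = "x - (A k \<bullet> x) *\<^sub>R w1 k - (B k \<bullet> x) *\<^sub>R w2 k"
    have "?x \<in> span {v k}" unfolding ker using AB(5-8) by (simp add: inner_diff_right)
    moreover have "span {v k} \<subseteq> span (range v)" by (intro span_mono) simp
    ultimately have "?x $ 3 = 0" using sp by blast
    then show "axis 3 1 \<bullet> x = ((w1 k)$3 *\<^sub>R A k + (w2 k)$3 *\<^sub>R B k) \<bullet> x"
      by (simp add: inner_axis' inner_add_left algebra_simps)
  qed
  have lp: "lattice_polytope (P i)" for i using P by (simp add: lattice_polytope_3d_def)
  have std': "standard_image (A k) (B k) (P i \<inter> int_lattice)" if "i \<noteq> k" for i k
    using tri std[OF lp] that by blast
  have coef: "(w1 k)$3 = 0 \<or> (w2 k)$3 = 0 \<or> (w1 k)$3 = (w2 k)$3" for k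
  proof -
    obtain j where j: "j \<noteq> k" using other_index by blast
    \<comment> \<open>The polytope with the remaining index is the one that both projections send to
      triangles.\<close>
    obtain i where i: "i \<noteq> j" "i \<noteq> k" using other_index by blast
    show ?thesis
      using i j indep by (intro triangle_coefficients[OF std'[of i k] std'[of i j] _ _ z[of k] z[of j]]
        lattice_polytope_finite[OF lp] lattice_polytope_3d_card[OF P]) auto
  qed
  have "\<forall>k. \<exists>f s w. f \<in> int_lattice \<and> (s = 1 \<or> s = -1) \<and> w \<in> int_lattice \<and> f \<bullet> w = 1 \<and> w$3 = 0 \<and>
    (\<forall>V. standard_image f (s *\<^sub>R axis 3 1) V \<longleftrightarrow> standard_image (A k) (B k) V) \<and>
    (\<forall>x. f \<bullet> x = 0 \<longrightarrow> x$3 = 0 \<longrightarrow> A k \<bullet> x = 0 \<and> B k \<bullet> x = 0)"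
  proof
    fix k
    show "\<exists>f s w. f \<in> int_lattice \<and> (s = 1 \<or> s = -1) \<and> w \<in> int_lattice \<and> f \<bullet> w = 1 \<and> w$3 = 0 \<and>
      (\<forall>V. standard_image f (s *\<^sub>R axis 3 1) V \<longleftrightarrow> standard_image (A k) (B k) V) \<and>
      (\<forall>x. f \<bullet> x = 0 \<longrightarrow> x$3 = 0 \<longrightarrow> A k \<bullet> x = 0 \<and> B k \<bullet> x = 0)"
      by (rule horizontal_edge[OF AB(1)[of k] AB(2)[of k] AB(3)[of k] AB(4)[of k] AB(5)[of k] AB(6)[of k]
        AB(7)[of k] AB(8)[of k] z[of k] coef[of k]]) blast
  qed
  then obtain f s w where fsw: "\<And>k. f k \<in> int_lattice" "\<And>k. s k = 1 \<or> s k = (-1::real)" "\<And>k. w k \<in> int_lattice"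
    "\<And>k. f k \<bullet> w k = 1" "\<And>k. w k $ 3 = 0"
    "\<And>k V. standard_image (f k) (s k *\<^sub>R axis 3 1) V \<longleftrightarrow> standard_image (A k) (B k) V"
    "\<And>k x. f k \<bullet> x = 0 \<Longrightarrow> x$3 = 0 \<Longrightarrow> A k \<bullet> x = 0 \<and> B k \<bullet> x = 0"
    by metis
  show thesis
  proof (rule that[of f s w])
    show "x = 0" if "j \<noteq> k" "f j \<bullet> x = 0" "f k \<bullet> x = 0" "x$3 = 0" for j k x
      using indep[OF that(1)] fsw(7) that by blast
    show "standard_image (f k) (s k *\<^sub>R axis 3 1) (P i \<inter> int_lattice)" if "i \<noteq> k" for i k
      using fsw(6) std'[OF that] by blast
  qed (use fsw in blast)+
qed

section \<open>Normal form of the projecting functionals\<close>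

lemma standard_image_scaled_axis:
  assumes "standard_image a (s *\<^sub>R axis 3 1) V"
  obtains m n where "(\<lambda>x. (a \<bullet> x, s * x$3)) ` V = {(m, n), (m + 1, n), (m, n + 1)}"
  using assms by (auto simp: standard_image_def inner_axis')

lemma standard_image_mem:
  assumes "(\<lambda>x. (f x, g x)) ` V = {(m, n), (m + 1, n), (m, n + 1)}" "x \<in> V"
  shows "f x = m \<and> g x = n \<or> f x = m + 1 \<and> g x = n \<or> f x = m \<and> g x = n + (1::real)"
proof -
  have "(f x, g x) \<in> {(m, n), (m + 1, n), (m, n + 1)}"
    using assms by blast
  then show ?thesis by simp
qed

lemma standard_image_levels:
  assumes "(\<lambda>x. (f x, g x)) ` V = {(m, n), (m + 1, n), (m, n + (1::real))}"
  shows "g ` V = {n, n + 1}"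
proof -
  have "g ` V = snd ` (\<lambda>x. (f x, g x)) ` V" by (simp add: image_image)
  then show ?thesis unfolding assms by simp
qed

text \<open>Otherwise the lattice points, whose images under \<open>(a, b, height)\<close> lie on two levels, would avoid
  every pair of horizontally adjacent positions; this leaves at most three positions.\<close>

lemma horizontal_dual_vector:
  assumes "finite V" "4 \<le> card V" "s = 1 \<or> s = -1" "s' = 1 \<or> s' = (-1 :: real)"
    and std: "standard_image a (s *\<^sub>R axis 3 1) V" "standard_image b (s' *\<^sub>R axis 3 1) V"
    and inj: "\<And>x. a \<bullet> x = 0 \<Longrightarrow> b \<bullet> x = 0 \<Longrightarrow> x$3 = 0 \<Longrightarrow> x = 0"
  shows "\<exists>x\<in>V. \<exists>y\<in>V. x$3 = y$3 \<and> (\<bar>a \<bullet> (x - y)\<bar> = 1 \<and> b \<bullet> (x - y) = 0 \<or> a \<bullet> (x - y) = 0 \<and> \<bar>b \<bullet> (x - y)\<bar> = 1)"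
    (is ?thesis)
proof (rule ccontr)
  assume contr: "\<not> ?thesis"
  define g where "g x = (a \<bullet> x, b \<bullet> x, s * x$3)" for x
  have "inj_on g V"
  proof (rule inj_onI)
    fix x y assume "g x = g y"
    then have "x - y = 0" using assms(3) by (intro inj) (auto simp: g_def inner_diff_right)
    then show "x = y" by simp
  qed
  moreover define I where "I = g ` V"
  ultimately have card: "4 \<le> card I" using assms(2) by (simp add: card_image)
  have small: False if "I \<subseteq> {p, q, r}" for p q r using card card_le_3[OF that] by simp
  have adj: False if pq: "(p, q, r) \<in> I" "(p', q', r) \<in> I" "\<bar>p - p'\<bar> = 1 \<and> q = q' \<or> p = p' \<and> \<bar>q - q'\<bar> = 1" for p q r p' q'
  proof -
    obtain x y where xy: "x \<in> V" "y \<in> V" "(p, q, r) = g x" "(p', q', r) = g y" using pq(1,2) unfolding I_def by blast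
    then have "x$3 = y$3" using assms(3) by (auto simp: g_def)
    with xy contr pq(3) show False by (auto simp: g_def inner_diff_right)
  qed
  obtain m n where mn: "(\<lambda>x. (a \<bullet> x, s * x$3)) ` V = {(m, n), (m + 1, n), (m, n + 1)}"
    using std(1) by (rule standard_image_scaled_axis)
  obtain m' n' where mn': "(\<lambda>x. (b \<bullet> x, s' * x$3)) ` V = {(m', n'), (m' + 1, n'), (m', n' + 1)}"
    using std(2) by (rule standard_image_scaled_axis)
  show False
  proof (cases "s' = s")
    case True
    have "{n, n + 1} = {n', n' + 1}"
      using standard_image_levels[OF mn] standard_image_levels[OF mn'] True by simp
    then have n: "n' = n" by (auto simp: doubleton_eq_iff)
    \<comment> \<open>With equal signs both triangles have their horizontal edge on level
      \<open>n\<close>: there is room for four corners of a square there and for one apex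
      above.\<close>
    have sub: "I \<subseteq> {(m, m', n), (m + 1, m', n), (m, m' + 1, n), (m + 1, m' + 1, n), (m, m', n + 1)}"
    proof
      fix p assume "p \<in> I"
      then obtain x where "x \<in> V" "p = g x" unfolding I_def by blast
      then show "p \<in> {(m, m', n), (m + 1, m', n), (m, m' + 1, n), (m + 1, m' + 1, n), (m, m', n + 1)}"
        using standard_image_mem[OF mn, of x] standard_image_mem[OF mn', of x] n True
        by (auto simp: g_def)
    qed
    \<comment> \<open>Each corner of one diagonal of the square is adjacent to both corners of the
      other, so only one diagonal can be occupied. With the apex this makes three positions.\<close>
    have adj_cases: "(p, q, n) \<in> I \<Longrightarrow> (p', q', n) \<in> I \<Longrightarrow> False"
      if "(p, q) = (m, m') \<or> (p, q) = (m + 1, m' + 1)" "(p', q') = (m + 1, m') \<or> (p', q') = (m, m' + 1)" for p q p' q'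
      by (rule adj, assumption, assumption) (use that in auto)
    show False
    proof (cases "(m, m', n) \<in> I \<or> (m + 1, m' + 1, n) \<in> I")
      case True
      then have "(m + 1, m', n) \<notin> I" "(m, m' + 1, n) \<notin> I"
        using adj_cases by blast+
      then show False using sub by (intro small[of "(m, m', n)" "(m + 1, m' + 1, n)" "(m, m', n + 1)"]) blast
    next
      case False
      then show False using sub by (intro small[of "(m + 1, m', n)" "(m, m' + 1, n)" "(m, m', n + 1)"]) blast
    qed
  next
    case False
    then have s': "s' = - s" using assms(3,4) by auto
    have "(\<lambda>x. s' * x$3) ` V = uminus ` (\<lambda>x. s * x$3) ` V" by (simp add: s' image_image)
    then have "{n', n' + 1} = {- n, - n - 1}"
      using standard_image_levels[OF mn] standard_image_levels[OF mn'] by simp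
    then have n: "n' = - n - 1" by (auto simp: doubleton_eq_iff)
    \<comment> \<open>With opposite signs the edge of one triangle lies on the apex level of the
      other. Each level keeps two adjacent positions.\<close>
    have sub: "I \<subseteq> {(m, m', n), (m + 1, m', n), (m, m', n + 1), (m, m' + 1, n + 1)}"
    proof
      fix p assume "p \<in> I"
      then obtain x where "x \<in> V" "p = g x" unfolding I_def by blast
      then show "p \<in> {(m, m', n), (m + 1, m', n), (m, m', n + 1), (m, m' + 1, n + 1)}"
        using standard_image_mem[OF mn, of x] standard_image_mem[OF mn', of x] n s'
        by (auto simp: g_def)
    qed
    show False
    proof (cases "(m, m', n) \<in> I \<and> (m + 1, m', n) \<in> I")
      case True
      then show False using adj[of m m' n "m + 1" m'] by simp
    next
      case False
      then consider "(m, m', n) \<notin> I" | "(m + 1, m', n) \<notin> I" by blast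
      then show False
      proof cases
        case 1
        then show False using sub by (intro small[of "(m + 1, m', n)" "(m, m', n + 1)" "(m, m' + 1, n + 1)"]) blast
      next
        case 2
        then show False using sub by (intro small[of "(m, m', n)" "(m, m', n + 1)" "(m, m' + 1, n + 1)"]) blast
      qed
    qed
  qed
qed

section \<open>Unimodularity of the horizontal parts\<close>

lemma minor12_mult:
  assumes "u$3 = 0" "w$3 = 0"
  shows "minor12 a b * minor12 u w = (a \<bullet> u) * (b \<bullet> w) - (a \<bullet> w) * (b \<bullet> u)"
  using assms by (simp add: minor12_def inner_real3 algebra_simps)

lemma minor12_Ints: "a \<in> int_lattice \<Longrightarrow> b \<in> int_lattice \<Longrightarrow> minor12 a b \<in> \<int>"
  by (simp add: minor12_def int_lattice_def)

text \<open>A horizontal difference \<open>u\<close> of lattice points pairs with (\<open>a\<close>,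
  \<open>b\<close>) to a signed unit vector. Joined with the dual vector of the functional that
  vanishes on \<open>u\<close>, it gives a triangular pairing matrix of determinant 1 or -1. By
  multiplicativity \<open>minor12 a b\<close> divides a unit.\<close>

lemma minor12_unit:
  assumes "finite V" "4 \<le> card V" "V \<subseteq> int_lattice" "s = 1 \<or> s = -1" "s' = 1 \<or> s' = (-1 :: real)"
    and std: "standard_image a (s *\<^sub>R axis 3 1) V" "standard_image b (s' *\<^sub>R axis 3 1) V"
    and inj: "\<And>x. a \<bullet> x = 0 \<Longrightarrow> b \<bullet> x = 0 \<Longrightarrow> x$3 = 0 \<Longrightarrow> x = 0"
    and ab: "a \<in> int_lattice" "b \<in> int_lattice"
    and w: "w \<in> int_lattice" "a \<bullet> w = 1" "w$3 = 0"
    and w': "w' \<in> int_lattice" "b \<bullet> w' = 1" "w'$3 = 0"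
  shows "minor12 a b = 1 \<or> minor12 a b = -1"
proof -
  obtain x y where xy: "x \<in> V" "y \<in> V" "x$3 = y$3"
    "\<bar>a \<bullet> (x - y)\<bar> = 1 \<and> b \<bullet> (x - y) = 0 \<or> a \<bullet> (x - y) = 0 \<and> \<bar>b \<bullet> (x - y)\<bar> = 1"
    using horizontal_dual_vector[OF assms(1,2,4,5) std inj] by blast
  define u where "u = x - y"
  have u: "u \<in> int_lattice" "u$3 = 0" using xy assms(3) by (auto simp: u_def intro: int_lattice_diff)
  from xy(4) have "\<exists>r\<in>\<int>. minor12 a b * r = 1 \<or> minor12 a b * r = -1"
    unfolding u_def[symmetric]
  proof (elim disjE conjE)
    assume "\<bar>a \<bullet> u\<bar> = 1" "b \<bullet> u = 0"
    then have "minor12 a b * minor12 u w' = 1 \<or> minor12 a b * minor12 u w' = -1"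
      unfolding minor12_mult[OF u(2) w'(3)] using w'(2) by auto
    then show ?thesis using minor12_Ints u(1) w'(1) by blast
  next
    assume "\<bar>b \<bullet> u\<bar> = 1" "a \<bullet> u = 0"
    then have "minor12 a b * minor12 u w = 1 \<or> minor12 a b * minor12 u w = -1"
      unfolding minor12_mult[OF u(2) w(3)] using w(2) by auto
    then show ?thesis using minor12_Ints u(1) w(1) by blast
  qed
  then show ?thesis using Ints_mult_eq_1 minor12_Ints[OF ab] by blast
qed

text \<open>One formula for the identity and the flip: the coefficient of \<open>h\<close> is 0 for
  \<open>\<alpha>\<close> = 1 and -1 for \<open>\<alpha>\<close> = -1.\<close>

lemma standard_image_signed:
  assumes "\<alpha> = 1 \<or> \<alpha> = -1"
  shows "standard_image (\<alpha> *\<^sub>R a + ((\<alpha> - 1) / 2) *\<^sub>R h) h V \<longleftrightarrow> standard_image a h V"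
  using assms standard_image_flip[of a h V] by auto

text \<open>The horizontal parts of \<open>a1\<close> and \<open>a2\<close> are a basis of the
  integer plane, and by Cramer's rule those of \<open>a3\<close> have coefficients 1 or -1. Flips
  absorb both signs. Each flip changes only the multiple of \<open>h\<close>, and \<open>k\<close>
  collects these changes.\<close>

lemma normal_form_int:
  assumes a: "a1 \<in> int_lattice" "a2 \<in> int_lattice" "a3 \<in> int_lattice"
    and s: "s = 1 \<or> s = -1" and h: "h = s *\<^sub>R axis 3 1" and \<eta>: "\<eta> = 1 \<or> \<eta> = -1"
    and D: "minor12 a1 a2 = 1 \<or> minor12 a1 a2 = -1" "minor12 a1 a3 = 1 \<or> minor12 a1 a3 = -1"
      "minor12 a3 a2 = 1 \<or> minor12 a3 a2 = -1"
  obtains b1 b2 k where "b1 \<in> int_lattice" "b2 \<in> int_lattice" "k \<in> \<int>"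
    "minor12 b1 b2 = 1 \<or> minor12 b1 b2 = -1"
    "\<And>V. standard_image b1 h V \<longleftrightarrow> standard_image a1 h V" "\<And>V. standard_image b2 h V \<longleftrightarrow> standard_image a2 h V"
    "\<And>V. standard_image (\<eta> *\<^sub>R (b1 + b2 - k *\<^sub>R h)) (\<eta> *\<^sub>R h) V \<longleftrightarrow> standard_image a3 (\<eta> *\<^sub>R h) V"
proof -
  define \<alpha> where "\<alpha> = minor12 a1 a2 * minor12 a3 a2"
  define \<beta> where "\<beta> = minor12 a1 a2 * minor12 a1 a3"
  define c where "c = s * (a3$3 - \<alpha> * a1$3 - \<beta> * a2$3)"
  have \<alpha>\<beta>: "\<alpha> = 1 \<or> \<alpha> = -1" "\<beta> = 1 \<or> \<beta> = -1" using D by (auto simp: \<alpha>_def \<beta>_def)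
  have DD: "minor12 a1 a2 * minor12 a1 a2 = 1" and ss: "s * s = 1" using D(1) s by auto
  \<comment> \<open>Cramer's rule, where multiplication by \<open>minor12 a1 a2\<close> replaces
    division by it.\<close>
  have "\<alpha> * a1$i + \<beta> * a2$i = (minor12 a1 a2 * minor12 a1 a2) * a3$i" if "i = 1 \<or> i = 2" for i
    using that by (auto simp: \<alpha>_def \<beta>_def minor12_def algebra_simps)
  then have comb: "\<alpha> * a1$1 + \<beta> * a2$1 = a3$1" "\<alpha> * a1$2 + \<beta> * a2$2 = a3$2" by (simp_all add: DD)
  have "s * c = a3$3 - \<alpha> * a1$3 - \<beta> * a2$3" by (simp add: c_def ss flip: mult.assoc)
  with comb have a3: "a3 = \<alpha> *\<^sub>R a1 + \<beta> *\<^sub>R a2 + c *\<^sub>R h"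
    by (simp add: vec3_eq_iff h axis_def mult.commute)
  define b1 where "b1 = \<alpha> *\<^sub>R a1 + ((\<alpha> - 1) / 2) *\<^sub>R h"
  define b2 where "b2 = \<beta> *\<^sub>R a2 + ((\<beta> - 1) / 2) *\<^sub>R h"
  \<comment> \<open>The last summand is 1 exactly for \<open>\<eta>\<close> = -1. Then
    \<open>b1 + b2 - k h\<close> is \<open>a3 - h\<close>, whose negative is the flip of
    \<open>a3\<close> with respect to \<open>- h\<close>.\<close>
  define k where "k = (\<alpha> - 1) / 2 + (\<beta> - 1) / 2 - c + (1 - \<eta>) / 2"
  have Z: "\<alpha> \<in> \<int>" "\<beta> \<in> \<int>" "(\<alpha> - 1) / 2 \<in> \<int>" "(\<beta> - 1) / 2 \<in> \<int>" "(1 - \<eta>) / 2 \<in> \<int>" "s \<in> \<int>"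
    using \<alpha>\<beta> \<eta> s by auto
  have hZ: "h \<in> int_lattice" using s by (auto simp: h intro: int_lattice_intros)
  have "b1 + b2 - k *\<^sub>R h = a3 - ((1 - \<eta>) / 2) *\<^sub>R h"
    by (simp add: a3 b1_def b2_def k_def algebra_simps)
  then have "standard_image (\<eta> *\<^sub>R (b1 + b2 - k *\<^sub>R h)) (\<eta> *\<^sub>R h) V \<longleftrightarrow> standard_image a3 (\<eta> *\<^sub>R h) V" for V
    using \<eta> standard_image_flip[of a3 "- h" V] by auto
  moreover have "minor12 b1 b2 = \<alpha> * \<beta> * minor12 a1 a2"
    by (simp add: minor12_def b1_def b2_def h axis_def algebra_simps)
  then have "minor12 b1 b2 = 1 \<or> minor12 b1 b2 = -1" using \<alpha>\<beta> D(1) by auto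
  moreover have "k \<in> \<int>" unfolding k_def c_def using Z a
    by (intro Ints_add Ints_diff Ints_mult) (auto simp: int_lattice_def)
  moreover have "b1 \<in> int_lattice" "b2 \<in> int_lattice" unfolding b1_def b2_def
    by (intro int_lattice_add int_lattice_scaleR Z a hZ)+
  ultimately show thesis
    using that[of b1 b2 k] standard_image_signed[OF \<alpha>\<beta>(1)] standard_image_signed[OF \<alpha>\<beta>(2)]
    unfolding b1_def b2_def by blast
qed

text \<open>Flipping both \<open>b1\<close> and \<open>b2\<close> makes the third functional the
  flip of the old one, with \<open>k\<close> replaced by - k - 1. One of these two integers is
  nonnegative.\<close>

lemma normal_form:
  assumes a: "a1 \<in> int_lattice" "a2 \<in> int_lattice" "a3 \<in> int_lattice"
    and s: "s = 1 \<or> s = -1" and h: "h = s *\<^sub>R axis 3 1" and \<eta>: "\<eta> = 1 \<or> \<eta> = -1"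
    and D: "minor12 a1 a2 = 1 \<or> minor12 a1 a2 = -1" "minor12 a1 a3 = 1 \<or> minor12 a1 a3 = -1"
      "minor12 a3 a2 = 1 \<or> minor12 a3 a2 = -1"
  obtains b1 b2 and k :: nat where "b1 \<in> int_lattice" "b2 \<in> int_lattice"
    "minor12 b1 b2 = 1 \<or> minor12 b1 b2 = -1"
    "\<And>V. standard_image b1 h V \<longleftrightarrow> standard_image a1 h V" "\<And>V. standard_image b2 h V \<longleftrightarrow> standard_image a2 h V"
    "\<And>V. standard_image (\<eta> *\<^sub>R (b1 + b2 - real k *\<^sub>R h)) (\<eta> *\<^sub>R h) V \<longleftrightarrow> standard_image a3 (\<eta> *\<^sub>R h) V"
proof -
  obtain b1 b2 k where b: "b1 \<in> int_lattice" "b2 \<in> int_lattice" "k \<in> \<int>"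
    "minor12 b1 b2 = 1 \<or> minor12 b1 b2 = -1"
    "\<And>V. standard_image b1 h V \<longleftrightarrow> standard_image a1 h V" "\<And>V. standard_image b2 h V \<longleftrightarrow> standard_image a2 h V"
    "\<And>V. standard_image (\<eta> *\<^sub>R (b1 + b2 - k *\<^sub>R h)) (\<eta> *\<^sub>R h) V \<longleftrightarrow> standard_image a3 (\<eta> *\<^sub>R h) V"
    using normal_form_int[OF assms] by blast
  obtain i where i: "k = of_int i" using b(3) by (elim Ints_cases)
  show thesis
  proof (cases "0 \<le> i")
    case True
    then show thesis using b i that[of b1 b2 "nat i"] by simp
  next
    case False
    then have k: "real (nat (- i - 1)) = - k - 1" by (simp add: i)
    have hZ: "h \<in> int_lattice" using s by (auto simp: h intro: int_lattice_intros)
    show thesis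
    proof (rule that[of "- b1 - h" "- b2 - h" "nat (- i - 1)"])
      have "minor12 (- b1 - h) (- b2 - h) = minor12 b1 b2"
        by (simp add: minor12_def h axis_def)
      then show "minor12 (- b1 - h) (- b2 - h) = 1 \<or> minor12 (- b1 - h) (- b2 - h) = - 1"
        using b(4) by simp
      have "\<eta> *\<^sub>R (- b1 - h + (- b2 - h) - real (nat (- i - 1)) *\<^sub>R h)
          = - (\<eta> *\<^sub>R (b1 + b2 - k *\<^sub>R h)) - \<eta> *\<^sub>R h"
        unfolding k by (simp add: algebra_simps)
      then show "standard_image (\<eta> *\<^sub>R (- b1 - h + (- b2 - h) - real (nat (- i - 1)) *\<^sub>R h)) (\<eta> *\<^sub>R h) V
          \<longleftrightarrow> standard_image a3 (\<eta> *\<^sub>R h) V" for V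
        using b(7)[of V] standard_image_flip by metis
    qed (use b hZ in \<open>auto simp: standard_image_flip intro: int_lattice_diff int_lattice_uminus\<close>)
  qed
qed

text \<open>Pigeonhole for two signs. The agreeing pair is moved to the indices 1 and 2, so that
  only the third functional may come with the opposite height.\<close>

lemma permutation_agreeing:
  fixes s :: "3 \<Rightarrow> real"
  assumes "\<And>k. s k = 1 \<or> s k = -1"
  obtains \<sigma> :: "3 \<Rightarrow> 3" where "bij \<sigma>" "s (\<sigma> 1) = s (\<sigma> 2)"
proof -
  have "s 1 = s 2 \<or> s 1 = s 3 \<or> s 3 = s 2" using assms[of 1] assms[of 2] assms[of 3] by auto
  then show thesis
  proof (elim disjE)
    assume "s 1 = s 2"
    then show thesis using that[of id] by simp
  next
    assume "s 1 = s 3"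
    then show thesis using that[of "Transposition.transpose 2 3"] by (simp add: transpose_def)
  next
    assume "s 3 = s 2"
    then show thesis using that[of "Transposition.transpose 1 3"] by (simp add: transpose_def)
  qed
qed

lemma projecting_triples_normal_form:
  assumes "P \<in> projecting_triples"
  obtains \<sigma> :: "3 \<Rightarrow> 3" and b1 b2 h s \<eta> and k :: nat where "bij \<sigma>" "b1 \<in> int_lattice" "b2 \<in> int_lattice"
    "minor12 b1 b2 = 1 \<or> minor12 b1 b2 = -1" "s = 1 \<or> s = -1" "h = s *\<^sub>R axis 3 1" "\<eta> = 1 \<or> \<eta> = -1"
    "standard_image b1 h (P (\<sigma> 2) \<inter> int_lattice)" "standard_image b1 h (P (\<sigma> 3) \<inter> int_lattice)"
    "standard_image b2 h (P (\<sigma> 1) \<inter> int_lattice)" "standard_image b2 h (P (\<sigma> 3) \<inter> int_lattice)"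
    "standard_image (\<eta> *\<^sub>R (b1 + b2 - real k *\<^sub>R h)) (\<eta> *\<^sub>R h) (P (\<sigma> 1) \<inter> int_lattice)"
    "standard_image (\<eta> *\<^sub>R (b1 + b2 - real k *\<^sub>R h)) (\<eta> *\<^sub>R h) (P (\<sigma> 2) \<inter> int_lattice)"
proof -
  obtain f s w where f: "\<And>k. f k \<in> int_lattice" and s: "\<And>k. s k = 1 \<or> s k = (-1 :: real)"
    and w: "\<And>k. w k \<in> int_lattice" "\<And>k. f k \<bullet> w k = 1" "\<And>k. w k $ 3 = 0"
    and std: "\<And>i k. i \<noteq> k \<Longrightarrow> standard_image (f k) (s k *\<^sub>R axis 3 1) (P i \<inter> int_lattice)"
    and inj: "\<And>j k x. j \<noteq> k \<Longrightarrow> f j \<bullet> x = 0 \<Longrightarrow> f k \<bullet> x = 0 \<Longrightarrow> x$3 = 0 \<Longrightarrow> x = 0"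
    using projecting_triples_functionals[OF assms] by blast
  have P: "lattice_polytope_3d (P i)" for i using assms by (simp add: projecting_triples_def)
  have D: "minor12 (f j) (f k) = 1 \<or> minor12 (f j) (f k) = -1" if "j \<noteq> k" for j k
  proof -
    obtain i where i: "i \<noteq> j" "i \<noteq> k" using other_index by blast
    show ?thesis
      using P[of i] lattice_polytope_3d_card[OF P[of i]] that
      by (intro minor12_unit[OF _ _ _ s[of j] s[of k] std[OF i(1)] std[OF i(2)] _ f f w w] inj[of j k])
        (auto simp: lattice_polytope_3d_def lattice_polytope_finite)
  qed
  obtain \<sigma> :: "3 \<Rightarrow> 3" where \<sigma>: "bij \<sigma>" "s (\<sigma> 1) = s (\<sigma> 2)" using permutation_agreeing[OF s] .
  have neq: "\<sigma> i = \<sigma> j \<longleftrightarrow> i = j" for i j using \<sigma>(1) by (auto simp: bij_def inj_eq)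
  have ne: "\<sigma> 1 \<noteq> \<sigma> 2" "\<sigma> 1 \<noteq> \<sigma> 3" "\<sigma> 3 \<noteq> \<sigma> 2" by (simp_all add: neq)
  define h where "h = s (\<sigma> 1) *\<^sub>R (axis 3 1 :: real^3)"
  define \<eta> where "\<eta> = s (\<sigma> 1) * s (\<sigma> 3)"
  have \<eta>: "\<eta> = 1 \<or> \<eta> = -1" using s[of "\<sigma> 1"] s[of "\<sigma> 3"] by (auto simp: \<eta>_def)
  have h3: "s (\<sigma> 3) *\<^sub>R axis 3 1 = \<eta> *\<^sub>R h" using s[of "\<sigma> 1"] by (auto simp: \<eta>_def h_def)
  obtain b1 b2 and k :: nat where b: "b1 \<in> int_lattice" "b2 \<in> int_lattice"
    "minor12 b1 b2 = 1 \<or> minor12 b1 b2 = -1"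
    "\<And>V. standard_image b1 h V \<longleftrightarrow> standard_image (f (\<sigma> 1)) h V"
    "\<And>V. standard_image b2 h V \<longleftrightarrow> standard_image (f (\<sigma> 2)) h V"
    "\<And>V. standard_image (\<eta> *\<^sub>R (b1 + b2 - real k *\<^sub>R h)) (\<eta> *\<^sub>R h) V \<longleftrightarrow> standard_image (f (\<sigma> 3)) (\<eta> *\<^sub>R h) V"
    using normal_form[OF f[of "\<sigma> 1"] f[of "\<sigma> 2"] f[of "\<sigma> 3"] s[of "\<sigma> 1"] h_def \<eta> D[OF ne(1)] D[OF ne(2)] D[OF ne(3)]]
    by blast
  show thesis
  proof (rule that[of \<sigma> b1 b2 "s (\<sigma> 1)" h \<eta> k])
    show "standard_image b1 h (P (\<sigma> 2) \<inter> int_lattice)" "standard_image b1 h (P (\<sigma> 3) \<inter> int_lattice)"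
      unfolding b(4) unfolding h_def by (rule std; simp add: neq)+
    show "standard_image b2 h (P (\<sigma> 1) \<inter> int_lattice)" "standard_image b2 h (P (\<sigma> 3) \<inter> int_lattice)"
      unfolding b(5) unfolding h_def \<sigma>(2) by (rule std; simp add: neq)+
    show "standard_image (\<eta> *\<^sub>R (b1 + b2 - real k *\<^sub>R h)) (\<eta> *\<^sub>R h) (P (\<sigma> 1) \<inter> int_lattice)"
      "standard_image (\<eta> *\<^sub>R (b1 + b2 - real k *\<^sub>R h)) (\<eta> *\<^sub>R h) (P (\<sigma> 2) \<inter> int_lattice)"
      unfolding b(6) unfolding h3[symmetric] by (rule std; simp add: neq)+
  qed (rule \<sigma>(1) b(1-3) s h_def \<eta>)+
qed

section \<open>Interior lattice points of sums of pyramids\<close>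

lemma triple_equiv_sym:
  assumes "triple_equiv P Q"
  shows "triple_equiv Q P"
proof -
  obtain \<sigma> U t where h1: "bij \<sigma>" "lattice_automorphism U" "\<forall>i. t i \<in> int_lattice" "\<forall>i. P i = (+) (t i) ` U ` Q (\<sigma> i)"
    using assms by (rule triple_equivE)
  note 1 = h1[rule_format]
  obtain L c where L: "U = (\<lambda>x. c + L x)" "linear L" "bij L" "L ` int_lattice = int_lattice" "c \<in> int_lattice"
    using 1(2) by (rule lattice_automorphismE)
  have "lattice_automorphism L"
    using lattice_automorphism_linear[OF L(2-4) int_lattice_0] by simp
  then have aut: "lattice_automorphism (inv L)" by (rule lattice_automorphism_inv)
  have lin: "linear (inv L)" using L(2,3) by (simp add: bij_is_inj bij_is_surj inj_linear_imp_inv_linear)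
  have inv: "inv L (L x) = x" for x using L(3) by (simp add: bij_is_inj)
  show ?thesis
  proof (rule triple_equivI[OF bij_imp_bij_inv[OF 1(1)] aut, of "\<lambda>j. - inv L (t (inv \<sigma> j) + c)"])
    show "- inv L (t (inv \<sigma> j) + c) \<in> int_lattice" for j
      using aut 1(3) L(5) int_lattice_add int_lattice_uminus unfolding lattice_automorphism_def by blast
    show "Q j = (+) (- inv L (t (inv \<sigma> j) + c)) ` inv L ` P (inv \<sigma> j)" for j
    proof -
      have "\<sigma> (inv \<sigma> j) = j" using 1(1) by (simp add: bij_is_surj surj_f_inv_f)
      then show ?thesis
        by (simp add: 1(4) L(1) image_image linear_add[OF lin] inv)
    qed
  qed
qed

text \<open>Both summands lie over the same unit triangle in the plane of (\<open>a\<close>,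
  \<open>b\<close>), so their sum lies over a triangle of size two.\<close>

lemma hollow_pair:
  assumes "\<And>p. p \<in> A \<Longrightarrow> m \<le> a \<bullet> p \<and> n \<le> b \<bullet> p \<and> a \<bullet> p + b \<bullet> p \<le> m + n + 1"
    and "\<And>p. p \<in> B \<Longrightarrow> m \<le> a \<bullet> p \<and> n \<le> b \<bullet> p \<and> a \<bullet> p + b \<bullet> p \<le> m + n + 1"
    and "m \<in> \<int>" "n \<in> \<int>" "a \<in> int_lattice" "b \<in> int_lattice" "a \<noteq> 0" "b \<noteq> 0" "a + b \<noteq> 0"
  shows "hollow (A + B)"
proof (rule hollow_triangle[of _ "m + m" a "n + n" b])
  fix x assume "x \<in> A + B"
  then obtain p q where "x = p + q" "p \<in> A" "q \<in> B" by (auto simp: set_plus_def)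
  with assms(1)[of p] assms(2)[of q] show "m + m \<le> a \<bullet> x" "n + n \<le> b \<bullet> x" "a \<bullet> x + b \<bullet> x \<le> m + m + (n + n) + 2"
    by (simp_all add: inner_add_right)
qed (use assms in auto)

lemma convex_segment_point:
  assumes "convex S" "p \<in> S" "q \<in> S" "0 \<le> r" "r \<le> 1" "x = r *\<^sub>R p + (1 - r) *\<^sub>R q"
  shows "x \<in> S"
  using assms convexD[of S p q r "1 - r"] by simp

lemma apex_segment_point:
  fixes S :: "(real^3) set"
  assumes "convex S" "vector [a, b, 0] \<in> S" "vector [0, 0, 1] \<in> S" "0 \<le> r" "r \<le> 1"
  shows "vector [r * a, r * b, 1 - r] \<in> S"
  by (rule convex_segment_point[OF assms]) (simp add: vec3_eq_iff)

lemma midpoint_mem: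
  fixes S :: "(real^3) set"
  assumes "convex S" "vector [a, b, 0] \<in> S" "vector [c, d, 0] \<in> S"
  shows "vector [(a + c) / 2, (b + d) / 2, 0] \<in> S"
  by (rule convex_segment_point[OF assms, of "1/2"]) (auto simp: vec3_eq_iff field_simps)

lemmas barycentric_simps = vec3_eq_iff field_simps

text \<open>(1, -1, 0) is the corner of the base outside the standard triangle. The two hypotheses
  exhaust the ways in which two further corners can be present. The points, at height 1/6, are tuned
  so that points on the axes of the other two pyramids complete them to a lattice point.\<close>

lemma interior_Q_point:
  fixes S :: "(real^3) set"
  assumes S: "convex S" "vector [1, -1, 0] \<in> S" "vector [0, 0, 1] \<in> S"
  shows "vector [0, 0, 0] \<in> S \<Longrightarrow> vector [1, 0, 0] \<in> S \<or> vector [0, 1, 0] \<in> S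
      \<Longrightarrow> vector [2/3, -7/12, 1/6] \<in> interior S"
    and "vector [1, 0, 0] \<in> S \<Longrightarrow> vector [0, 1, 0] \<in> S \<Longrightarrow> vector [3/4, -7/12, 1/6] \<in> interior S"
proof -
  show "vector [2/3, -7/12, 1/6] \<in> interior S" if "vector [0, 0, 0] \<in> S" "vector [1, 0, 0] \<in> S \<or> vector [0, 1, 0] \<in> S"
    using that(2)
  proof
    assume "vector [1, 0, 0] \<in> S"
    then show ?thesis
      by (intro interior_by_barycentric[OF S(1) that(1) _ S(2,3),
          where ?u0.0 = "\<lambda>x. 1 - x$1 - x$3" and ?u1.0 = "\<lambda>x. x$1 + x$2" and ?u2.0 = "\<lambda>x. - x$2" and ?u3.0 = "\<lambda>x. x$3"])
        (auto intro!: continuous_intros simp: barycentric_simps)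
  next
    assume "vector [0, 1, 0] \<in> S"
    then show ?thesis
      by (intro interior_by_barycentric[OF S(1) that(1) _ S(2,3),
          where ?u0.0 = "\<lambda>x. 1 - 2 * x$1 - x$2 - x$3" and ?u1.0 = "\<lambda>x. x$1 + x$2" and ?u2.0 = "\<lambda>x. x$1" and ?u3.0 = "\<lambda>x. x$3"])
        (auto intro!: continuous_intros simp: barycentric_simps)
  qed
  show "vector [3/4, -7/12, 1/6] \<in> interior S" if "vector [1, 0, 0] \<in> S" "vector [0, 1, 0] \<in> S"
    by (rule interior_by_barycentric[OF S(1) that S(2,3),
        where ?u0.0 = "\<lambda>x. 2 * x$1 + x$2 + x$3 - 1" and ?u1.0 = "\<lambda>x. 1 - x$1 - x$3" and ?u2.0 = "\<lambda>x. 1 - x$1 - x$2 - x$3" and ?u3.0 = "\<lambda>x. x$3"])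
      (auto intro!: continuous_intros simp: barycentric_simps)
qed

text \<open>The mirror image of \<open>interior_Q_point\<close> under the exchange of x and
  y.\<close>

lemma interior_R_point:
  fixes S :: "(real^3) set"
  assumes S: "convex S" "vector [-1, 1, 0] \<in> S" "vector [0, 0, 1] \<in> S"
  shows "vector [0, 0, 0] \<in> S \<Longrightarrow> vector [1, 0, 0] \<in> S \<or> vector [0, 1, 0] \<in> S
      \<Longrightarrow> vector [-7/12, 2/3, 1/6] \<in> interior S"
    and "vector [1, 0, 0] \<in> S \<Longrightarrow> vector [0, 1, 0] \<in> S \<Longrightarrow> vector [-7/12, 3/4, 1/6] \<in> interior S"
proof -
  show "vector [-7/12, 2/3, 1/6] \<in> interior S" if "vector [0, 0, 0] \<in> S" "vector [1, 0, 0] \<in> S \<or> vector [0, 1, 0] \<in> S"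
    using that(2)
  proof
    assume "vector [0, 1, 0] \<in> S"
    then show ?thesis
      by (intro interior_by_barycentric[OF S(1) that(1) _ S(2,3),
          where ?u0.0 = "\<lambda>x. 1 - x$2 - x$3" and ?u1.0 = "\<lambda>x. x$1 + x$2" and ?u2.0 = "\<lambda>x. - x$1" and ?u3.0 = "\<lambda>x. x$3"])
        (auto intro!: continuous_intros simp: barycentric_simps)
  next
    assume "vector [1, 0, 0] \<in> S"
    then show ?thesis
      by (intro interior_by_barycentric[OF S(1) that(1) _ S(2,3),
          where ?u0.0 = "\<lambda>x. 1 - 2 * x$2 - x$1 - x$3" and ?u1.0 = "\<lambda>x. x$1 + x$2" and ?u2.0 = "\<lambda>x. x$2" and ?u3.0 = "\<lambda>x. x$3"])
        (auto intro!: continuous_intros simp: barycentric_simps)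
  qed
  show "vector [-7/12, 3/4, 1/6] \<in> interior S" if "vector [1, 0, 0] \<in> S" "vector [0, 1, 0] \<in> S"
    by (rule interior_by_barycentric[OF S(1) that S(2,3),
        where ?u0.0 = "\<lambda>x. 1 - x$2 - x$3" and ?u1.0 = "\<lambda>x. 2 * x$2 + x$1 + x$3 - 1" and ?u2.0 = "\<lambda>x. 1 - x$1 - x$2 - x$3" and ?u3.0 = "\<lambda>x. x$3"])
      (auto intro!: continuous_intros simp: barycentric_simps)
qed

lemma interior_cube_point:
  fixes S :: "(real^3) set"
  assumes S: "convex S" "vector [1, 1, 0] \<in> S" "vector [0, 0, 1] \<in> S"
  shows "vector [1, 0, 0] \<in> S \<Longrightarrow> vector [0, 0, 0] \<in> S \<or> vector [0, 1, 0] \<in> S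
      \<Longrightarrow> vector [3/4, 2/3, 1/6] \<in> interior S"
    and "vector [0, 0, 0] \<in> S \<Longrightarrow> vector [0, 1, 0] \<in> S \<Longrightarrow> vector [2/3, 3/4, 1/6] \<in> interior S"
proof -
  show "vector [3/4, 2/3, 1/6] \<in> interior S" if "vector [1, 0, 0] \<in> S" "vector [0, 0, 0] \<in> S \<or> vector [0, 1, 0] \<in> S"
    using that(2)
  proof
    assume "vector [0, 0, 0] \<in> S"
    then show ?thesis
      by (intro interior_by_barycentric[OF S(1) that(1) _ S(2,3),
          where ?u0.0 = "\<lambda>x. x$1 - x$2" and ?u1.0 = "\<lambda>x. 1 - x$1 - x$3" and ?u2.0 = "\<lambda>x. x$2" and ?u3.0 = "\<lambda>x. x$3"])
        (auto intro!: continuous_intros simp: barycentric_simps)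
  next
    assume "vector [0, 1, 0] \<in> S"
    then show ?thesis
      by (intro interior_by_barycentric[OF S(1) that(1) _ S(2,3),
          where ?u0.0 = "\<lambda>x. 1 - x$2 - x$3" and ?u1.0 = "\<lambda>x. 1 - x$1 - x$3" and ?u2.0 = "\<lambda>x. x$1 + x$2 + x$3 - 1" and ?u3.0 = "\<lambda>x. x$3"])
        (auto intro!: continuous_intros simp: barycentric_simps)
  qed
  show "vector [2/3, 3/4, 1/6] \<in> interior S" if "vector [0, 0, 0] \<in> S" "vector [0, 1, 0] \<in> S"
    by (rule interior_by_barycentric[OF S(1) that S(2,3),
        where ?u0.0 = "\<lambda>x. 1 - x$2 - x$3" and ?u1.0 = "\<lambda>x. x$2 - x$1" and ?u2.0 = "\<lambda>x. x$1" and ?u3.0 = "\<lambda>x. x$3"])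
      (auto intro!: continuous_intros simp: barycentric_simps)
qed

text \<open>For a base of four points this says that at least three are present. The pairwise form
  avoids cardinalities and passes to images and larger sets.\<close>

definition misses_at_most_one :: "'a set \<Rightarrow> 'a set \<Rightarrow> bool" where
  "misses_at_most_one S B \<longleftrightarrow> (\<forall>p\<in>B. \<forall>q\<in>B. p \<noteq> q \<longrightarrow> p \<in> S \<or> q \<in> S)"

definition Q_base :: "(real^3) set" where
  "Q_base = {vector [0, 0, 0], vector [1, 0, 0], vector [0, 1, 0], vector [1, -1, 0]}"

definition R_base :: "(real^3) set" where
  "R_base = {vector [0, 0, 0], vector [1, 0, 0], vector [0, 1, 0], vector [-1, 1, 0]}"

definition cube_base :: "(real^3) set" where
  "cube_base = {vector [0, 0, 0], vector [1, 0, 0], vector [0, 1, 0], vector [1, 1, 0]}"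

lemma misses_at_most_oneD:
  assumes "misses_at_most_one S B" "p \<in> B" "q \<in> B" "p \<noteq> q"
  shows "p \<in> S \<or> q \<in> S"
  using assms by (simp add: misses_at_most_one_def)

lemma base_distinct:
  "(vector [0, 0, 0] :: real^3) \<noteq> vector [1, 0, 0]" "(vector [0, 0, 0] :: real^3) \<noteq> vector [0, 1, 0]"
  "(vector [1, 0, 0] :: real^3) \<noteq> vector [0, 1, 0]" "(vector [0, 0, 0] :: real^3) \<noteq> vector [1, -1, 0]"
  "(vector [1, 0, 0] :: real^3) \<noteq> vector [1, -1, 0]" "(vector [0, 1, 0] :: real^3) \<noteq> vector [1, -1, 0]"
  "(vector [0, 0, 0] :: real^3) \<noteq> vector [-1, 1, 0]"
  "(vector [1, 0, 0] :: real^3) \<noteq> vector [-1, 1, 0]" "(vector [0, 1, 0] :: real^3) \<noteq> vector [-1, 1, 0]"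
  "(vector [0, 0, 0] :: real^3) \<noteq> vector [1, 1, 0]"
  "(vector [1, 0, 0] :: real^3) \<noteq> vector [1, 1, 0]" "(vector [0, 1, 0] :: real^3) \<noteq> vector [1, 1, 0]"
  by (simp_all add: vec3_eq_iff)

text \<open>The first conclusion is applied with {p, q} and {r, t} the diagonals of a base, the
  second with \<open>t\<close> the corner that is already known to be present.\<close>

lemma misses_four:
  assumes "misses_at_most_one S {p, q, r, t}" "p \<noteq> q" "p \<noteq> r" "p \<noteq> t" "q \<noteq> r" "q \<noteq> t" "r \<noteq> t"
  shows "p \<in> S \<and> q \<in> S \<or> r \<in> S \<and> t \<in> S"
    and "p \<in> S \<and> (q \<in> S \<or> r \<in> S) \<or> q \<in> S \<and> r \<in> S"
proof -
  have *: "p \<in> S \<or> q \<in> S" "p \<in> S \<or> r \<in> S" "p \<in> S \<or> t \<in> S" "q \<in> S \<or> r \<in> S" "q \<in> S \<or> t \<in> S" "r \<in> S \<or> t \<in> S"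
    using misses_at_most_oneD[OF assms(1)] assms(2-) by simp_all
  then show "p \<in> S \<and> q \<in> S \<or> r \<in> S \<and> t \<in> S" by blast
  from * show "p \<in> S \<and> (q \<in> S \<or> r \<in> S) \<or> q \<in> S \<and> r \<in> S" by blast
qed

text \<open>The base is a parallelogram with at most one corner missing, so one diagonal survives,
  and its midpoint is the centre.\<close>

lemma base_centre:
  assumes "convex S"
  shows "misses_at_most_one S Q_base \<Longrightarrow> vector [1/2, 0, 0] \<in> S"
    and "misses_at_most_one S R_base \<Longrightarrow> vector [0, 1/2, 0] \<in> S"
    and "misses_at_most_one S cube_base \<Longrightarrow> vector [1/2, 1/2, 0] \<in> S"
proof -
  assume "misses_at_most_one S Q_base"
  from misses_four(1)[OF this[unfolded Q_base_def]] show "vector [1/2, 0, 0] \<in> S"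
    using midpoint_mem[OF assms, of 0 0 1 0] midpoint_mem[OF assms, of 0 1 1 "-1"] by (auto simp: base_distinct)
next
  assume "misses_at_most_one S R_base"
  \<comment> \<open>The corners are reordered so that the two diagonals become consecutive
    pairs.\<close>
  then have "misses_at_most_one S {vector [0, 0, 0], vector [0, 1, 0], vector [1, 0, 0], vector [-1, 1, 0]}"
    by (simp only: R_base_def insert_commute)
  from misses_four(1)[OF this] show "vector [0, 1/2, 0] \<in> S"
    using midpoint_mem[OF assms, of 0 0 0 1] midpoint_mem[OF assms, of 1 0 "-1" 1]
    by (auto simp: base_distinct base_distinct[symmetric])
next
  assume "misses_at_most_one S cube_base"
  then have "misses_at_most_one S {vector [0, 0, 0], vector [1, 1, 0], vector [1, 0, 0], vector [0, 1, 0]}"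
    by (simp only: cube_base_def insert_commute)
  from misses_four(1)[OF this] show "vector [1/2, 1/2, 0] \<in> S"
    using midpoint_mem[OF assms, of 0 0 1 1] midpoint_mem[OF assms, of 1 0 0 1] 
    by (auto simp: base_distinct base_distinct[symmetric])
qed

text \<open>Each certificate is a lattice point written as a sum of an interior point of one summand and
  points of the other two on the segments from the apex to the centre of the base, which lie in every
  admissible pyramid.\<close>

lemma not_hollow_pyramids:
  assumes conv: "convex S1" "convex S2" "convex S3"
    and apex: "vector [0, 0, 1] \<in> S1" "vector [0, 0, 1] \<in> S2" "vector [0, 0, 1] \<in> S3"
    and base: "misses_at_most_one S1 Q_base" "misses_at_most_one S2 R_base" "misses_at_most_one S3 cube_base"
    and extra: "vector [1, -1, 0] \<in> S1 \<or> vector [-1, 1, 0] \<in> S2 \<or> vector [1, 1, 0] \<in> S3"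
  shows "\<not> hollow (S1 + S2 + S3)"
proof -
  have c1: "vector [r / 2, 0, 1 - r] \<in> S1" if "0 \<le> r" "r \<le> 1" for r
    using apex_segment_point[OF conv(1) base_centre(1)[OF conv(1) base(1)] apex(1) that] by simp
  have c2: "vector [0, r / 2, 1 - r] \<in> S2" if "0 \<le> r" "r \<le> 1" for r
    using apex_segment_point[OF conv(2) base_centre(2)[OF conv(2) base(2)] apex(2) that] by simp
  have c3: "vector [r / 2, r / 2, 1 - r] \<in> S3" if "0 \<le> r" "r \<le> 1" for r
    using apex_segment_point[OF conv(3) base_centre(3)[OF conv(3) base(3)] apex(3) that] by simp
  from extra consider "vector [1, -1, 0] \<in> S1" | "vector [-1, 1, 0] \<in> S2" | "vector [1, 1, 0] \<in> S3" by blast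
  then show ?thesis
  proof cases
    case 1
    \<comment> \<open>All certificates of this case reach (1, 0, 1); in the next two cases they
      reach (0, 1, 1) and (1, 1, 1). The heights of the summands are always 1/6, 1/2 and 1/3 in some
      order.\<close>
    note I = interior_Q_point[OF conv(1) 1 apex(1)]
    have "vector [0, 0, 0] \<in> S1 \<and> (vector [1, 0, 0] \<in> S1 \<or> vector [0, 1, 0] \<in> S1) \<or> vector [1, 0, 0] \<in> S1 \<and> vector [0, 1, 0] \<in> S1"
      using misses_four(2)[OF base(1)[unfolded Q_base_def]] by (simp add: base_distinct)
    then show ?thesis
    proof (elim disjE conjE)
      assume "vector [1, 0, 0] \<in> S1" "vector [0, 1, 0] \<in> S1"
      from not_hollow_sum3[OF I(2)[OF this] c2[of "2/3"] c3[of "1/2"]] show ?thesis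
        by (simp add: int_lattice_def forall_3)
    next
      assume "vector [0, 0, 0] \<in> S1" "vector [1, 0, 0] \<in> S1"
      from not_hollow_sum3[OF I(1)[OF this(1) disjI1[OF this(2)]] c2[of "1/2"] c3[of "2/3"]] show ?thesis
        by (simp add: int_lattice_def forall_3)
    next
      assume "vector [0, 0, 0] \<in> S1" "vector [0, 1, 0] \<in> S1"
      from not_hollow_sum3[OF I(1)[OF this(1) disjI2[OF this(2)]] c2[of "1/2"] c3[of "2/3"]] show ?thesis
        by (simp add: int_lattice_def forall_3)
    qed
  next
    case 2
    note I = interior_R_point[OF conv(2) 2 apex(2)]
    have "vector [0, 0, 0] \<in> S2 \<and> (vector [1, 0, 0] \<in> S2 \<or> vector [0, 1, 0] \<in> S2) \<or> vector [1, 0, 0] \<in> S2 \<and> vector [0, 1, 0] \<in> S2"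
      using misses_four(2)[OF base(2)[unfolded R_base_def]] by (simp add: base_distinct)
    then have "\<not> hollow (S2 + S1 + S3)"
    proof (elim disjE conjE)
      assume "vector [1, 0, 0] \<in> S2" "vector [0, 1, 0] \<in> S2"
      from not_hollow_sum3[OF I(2)[OF this] c1[of "2/3"] c3[of "1/2"]] show ?thesis
        by (simp add: int_lattice_def forall_3)
    next
      assume "vector [0, 0, 0] \<in> S2" "vector [1, 0, 0] \<in> S2"
      from not_hollow_sum3[OF I(1)[OF this(1) disjI1[OF this(2)]] c1[of "1/2"] c3[of "2/3"]] show ?thesis
        by (simp add: int_lattice_def forall_3)
    next
      assume "vector [0, 0, 0] \<in> S2" "vector [0, 1, 0] \<in> S2"
      from not_hollow_sum3[OF I(1)[OF this(1) disjI2[OF this(2)]] c1[of "1/2"] c3[of "2/3"]] show ?thesis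
        by (simp add: int_lattice_def forall_3)
    qed
    then show ?thesis by (simp add: add.commute)
  next
    case 3
    note I = interior_cube_point[OF conv(3) 3 apex(3)]
    have "vector [1, 0, 0] \<in> S3 \<and> (vector [0, 0, 0] \<in> S3 \<or> vector [0, 1, 0] \<in> S3) \<or> vector [0, 0, 0] \<in> S3 \<and> vector [0, 1, 0] \<in> S3"
      using misses_four(2)[OF base(3)[unfolded cube_base_def]] by (simp add: base_distinct) blast
    then have "\<not> hollow (S3 + S1 + S2)"
    proof (elim disjE conjE)
      assume "vector [0, 0, 0] \<in> S3" "vector [0, 1, 0] \<in> S3"
      from not_hollow_sum3[OF I(2)[OF this] c1[of "2/3"] c2[of "1/2"]] show ?thesis
        by (simp add: int_lattice_def forall_3)
    next
      assume "vector [1, 0, 0] \<in> S3" "vector [0, 0, 0] \<in> S3"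
      from not_hollow_sum3[OF I(1)[OF this(1) disjI1[OF this(2)]] c1[of "1/2"] c2[of "2/3"]] show ?thesis
        by (simp add: int_lattice_def forall_3)
    next
      assume "vector [1, 0, 0] \<in> S3" "vector [0, 1, 0] \<in> S3"
      from not_hollow_sum3[OF I(1)[OF this(1) disjI2[OF this(2)]] c1[of "1/2"] c2[of "2/3"]] show ?thesis
        by (simp add: int_lattice_def forall_3)
    qed
    then show ?thesis by (simp add: add_ac)
  qed
qed

text \<open>Any two of the pyramids share a functional: x + y for the first two, x for the first and
  third, y for the last two. Together with the height it maps both into the same unit
  triangle.\<close>

lemma mixed_degree_pyramids:
  assumes I1: "\<And>p. p \<in> S1 \<Longrightarrow> 0 \<le> p$1 \<and> 0 \<le> p$1 + p$2 \<and> 0 \<le> p$3 \<and> p$1 + p$3 \<le> 1 \<and> p$1 + p$2 + p$3 \<le> 1"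
    and I2: "\<And>p. p \<in> S2 \<Longrightarrow> 0 \<le> p$2 \<and> 0 \<le> p$1 + p$2 \<and> 0 \<le> p$3 \<and> p$2 + p$3 \<le> 1 \<and> p$1 + p$2 + p$3 \<le> 1"
    and I3: "\<And>p. p \<in> S3 \<Longrightarrow> 0 \<le> p$1 \<and> 0 \<le> p$2 \<and> 0 \<le> p$3 \<and> p$1 + p$3 \<le> 1 \<and> p$2 + p$3 \<le> 1"
    and nh: "\<not> hollow (S1 + S2 + S3)"
  shows "mixed_degree (triple S1 S2 S3) = 1"
proof (rule mixed_degree_eq_1[OF _ _ _ _ _ _ nh])
  show "hollow S1" by (rule hollow_slab) (use I1 in fastforce)
  show "hollow S2" by (rule hollow_slab) (use I2 in fastforce)
  show "hollow S3" by (rule hollow_slab) (use I3 in fastforce)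
  note simps = inner_real3 int_lattice_vector_iff vec3_eq_iff
  show "hollow (S1 + S2)"
    by (rule hollow_pair[of S1 0 "vector [1, 1, 0]" 0 "vector [0, 0, 1]"]) (use I1 I2 in \<open>force simp: simps\<close>)+
  show "hollow (S1 + S3)"
    by (rule hollow_pair[of S1 0 "vector [1, 0, 0]" 0 "vector [0, 0, 1]"]) (use I1 I3 in \<open>force simp: simps\<close>)+
  show "hollow (S2 + S3)"
    by (rule hollow_pair[of S2 0 "vector [0, 1, 0]" 0 "vector [0, 0, 1]"]) (use I2 I3 in \<open>force simp: simps\<close>)+
qed

text \<open>The first two members are now tetrahedra, which share the triangle of - x - y and - z;
  the third is still a pyramid and shares x or y with the others, the height being taken
  upwards.\<close>

lemma mixed_degree_twisted:
  assumes conv: "convex S1" "convex S2" "convex S3"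
    and S1: "{vector [0, 1, 0], vector [1, 0, 0], vector [0, 0, 1], vector [0, 1, 1]} \<subseteq> S1"
    and S2: "{vector [1, 0, 0], vector [0, 1, 0], vector [0, 0, 1], vector [1, 0, 1]} \<subseteq> S2"
    and S3: "vector [0, 0, 1] \<in> S3" "misses_at_most_one S3 cube_base"
    and I1: "\<And>p. p \<in> S1 \<Longrightarrow> 0 \<le> p$1 \<and> 0 \<le> p$3 \<and> p$1 + p$3 \<le> 1 \<and> p$1 + p$2 \<le> 1 \<and> p$3 \<le> 1 \<and> 1 \<le> p$1 + p$2 + p$3"
    and I2: "\<And>p. p \<in> S2 \<Longrightarrow> 0 \<le> p$2 \<and> 0 \<le> p$3 \<and> p$2 + p$3 \<le> 1 \<and> p$1 + p$2 \<le> 1 \<and> p$3 \<le> 1 \<and> 1 \<le> p$1 + p$2 + p$3"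
    and I3: "\<And>p. p \<in> S3 \<Longrightarrow> 0 \<le> p$1 \<and> 0 \<le> p$2 \<and> 0 \<le> p$3 \<and> p$1 + p$3 \<le> 1 \<and> p$2 + p$3 \<le> 1"
  shows "mixed_degree (triple S1 S2 S3) = 1"
proof (rule mixed_degree_eq_1)
  show "hollow S1" by (rule hollow_slab) (use I1 in fastforce)
  show "hollow S2" by (rule hollow_slab) (use I2 in fastforce)
  show "hollow S3" by (rule hollow_slab) (use I3 in fastforce)
  note simps = inner_real3 int_lattice_vector_iff vec3_eq_iff
  show "hollow (S1 + S2)"
    by (rule hollow_pair[of S1 "-1" "vector [-1, -1, 0]" "-1" "vector [0, 0, -1]"]) (use I1 I2 in \<open>force simp: simps\<close>)+
  show "hollow (S1 + S3)"
    by (rule hollow_pair[of S1 0 "vector [1, 0, 0]" 0 "vector [0, 0, 1]"]) (use I1 I3 in \<open>force simp: simps\<close>)+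
  show "hollow (S2 + S3)"
    by (rule hollow_pair[of S2 0 "vector [0, 1, 0]" 0 "vector [0, 0, 1]"]) (use I2 I3 in \<open>force simp: simps\<close>)+
  \<comment> \<open>The certificate adds up to (1, 1, 2): this interior point, a point on an edge of
    the second tetrahedron, and a point between the apex and the base centre of the third
    polytope.\<close>
  have "vector [1/6, 1/2, 2/3] \<in> interior S1"
    by (rule interior_by_barycentric[OF conv(1), of "vector [0, 1, 0]" "vector [1, 0, 0]" "vector [0, 0, 1]" "vector [0, 1, 1]"
        "\<lambda>x. 1 - x$1 - x$3" "\<lambda>x. x$1" "\<lambda>x. 1 - x$1 - x$2" "\<lambda>x. x$1 + x$2 + x$3 - 1"])
      (use S1 in \<open>auto intro!: continuous_intros simp: barycentric_simps\<close>)
  moreover have "vector [2/3, 1/3, 2/3] \<in> S2"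
    by (rule convex_segment_point[OF conv(2), of "vector [1, 0, 1]" "vector [0, 1, 0]" "2/3"])
      (use S2 in \<open>auto simp: vec3_eq_iff\<close>)
  moreover have "vector [1/6, 1/6, 2/3] \<in> S3"
    using apex_segment_point[OF conv(3) base_centre(3)[OF conv(3) S3(2)] S3(1), of "1/3"] by simp
  ultimately show "\<not> hollow (S1 + S2 + S3)"
    by (rule not_hollow_sum3) (simp add: int_lattice_def forall_3)
qed

lemma minor12_inj:
  assumes "minor12 a b = 1 \<or> minor12 a b = -1" "s = 1 \<or> s = -1" "h = s *\<^sub>R axis 3 1"
    and "a \<bullet> x = 0" "b \<bullet> x = 0" "h \<bullet> x = 0"
  shows "x = 0"
proof -
  have x3: "x$3 = 0" using assms(2,3,6) by (auto simp: inner_axis')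
  then have "a$1 * x$1 + a$2 * x$2 = 0" "b$1 * x$1 + b$2 * x$2 = 0" using assms(4,5) by (simp_all add: inner_real3)
  moreover have "minor12 a b * x$1 = b$2 * (a$1 * x$1 + a$2 * x$2) - a$2 * (b$1 * x$1 + b$2 * x$2)"
    "minor12 a b * x$2 = a$1 * (b$1 * x$1 + b$2 * x$2) - b$1 * (a$1 * x$1 + a$2 * x$2)"
    by (simp_all add: minor12_def algebra_simps)
  ultimately have "minor12 a b * x$1 = 0" "minor12 a b * x$2 = 0" by simp_all
  then show ?thesis using assms(1) x3 by (auto simp: vec3_eq_iff)
qed

section \<open>From standard images to pyramids and tetrahedra\<close>

lemma lattice_polytope_halfspace:
  assumes "lattice_polytope P" "\<And>x. x \<in> P \<inter> int_lattice \<Longrightarrow> c \<le> u \<bullet> x" "x \<in> P"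
  shows "c \<le> u \<bullet> x"
proof -
  have "convex hull (P \<inter> int_lattice) \<subseteq> {x. c \<le> u \<bullet> x}"
    using assms(2) convex_halfspace_ge by (intro hull_minimal) auto
  then show ?thesis using lattice_polytope_hull[OF assms(1)] assms(3) by blast
qed

definition square_base :: "(real \<times> real \<times> real) set" where
  "square_base = {(0, 0, 0), (1, 0, 0), (0, 1, 0), (1, 1, 0)}"

lemma card_coordinates:
  assumes "lattice_polytope_3d P" "\<And>x. a \<bullet> x = 0 \<Longrightarrow> b \<bullet> x = 0 \<Longrightarrow> h \<bullet> x = 0 \<Longrightarrow> x = 0"
  shows "4 \<le> card ((\<lambda>x. (a \<bullet> x - m, b \<bullet> x - m', h \<bullet> x - n)) ` (P \<inter> int_lattice))"
proof -
  have "inj_on (\<lambda>x. (a \<bullet> x - m, b \<bullet> x - m', h \<bullet> x - n)) (P \<inter> int_lattice)"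
  proof (rule inj_onI)
    fix x y assume "(a \<bullet> x - m, b \<bullet> x - m', h \<bullet> x - n) = (a \<bullet> y - m, b \<bullet> y - m', h \<bullet> y - n)"
    then have "x - y = 0" by (intro assms(2)) (auto simp: inner_diff_right)
    then show "x = y" by simp
  qed
  then show ?thesis using lattice_polytope_3d_card[OF assms(1)] by (simp add: card_image)
qed

text \<open>Both triangles have the same base level and the same apex level. On the upper level both
  functionals are minimal, which leaves one position, the apex; on the lower level there are four.
  As at least four of the five positions are taken and the apex is, at most one corner is
  missing.\<close>

lemma standard_images_pyramid:
  assumes P: "lattice_polytope_3d P"
    and std: "standard_image a h (P \<inter> int_lattice)" "standard_image b h (P \<inter> int_lattice)"
    and inj: "\<And>x. a \<bullet> x = 0 \<Longrightarrow> b \<bullet> x = 0 \<Longrightarrow> h \<bullet> x = 0 \<Longrightarrow> x = 0"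
  obtains m m' n where "m \<in> \<int>" "m' \<in> \<int>" "n \<in> \<int>"
    "\<And>x. x \<in> P \<Longrightarrow> m \<le> a \<bullet> x \<and> m' \<le> b \<bullet> x \<and> n \<le> h \<bullet> x \<and> a \<bullet> x + h \<bullet> x \<le> m + n + 1 \<and> b \<bullet> x + h \<bullet> x \<le> m' + n + 1"
    "(\<lambda>x. (a \<bullet> x - m, b \<bullet> x - m', h \<bullet> x - n)) ` (P \<inter> int_lattice) \<subseteq> insert (0, 0, 1) square_base"
    "(0, 0, 1) \<in> (\<lambda>x. (a \<bullet> x - m, b \<bullet> x - m', h \<bullet> x - n)) ` (P \<inter> int_lattice)"
    "misses_at_most_one ((\<lambda>x. (a \<bullet> x - m, b \<bullet> x - m', h \<bullet> x - n)) ` (P \<inter> int_lattice)) square_base"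
proof -
  let ?V = "P \<inter> int_lattice"
  obtain m n where Z: "m \<in> \<int>" "n \<in> \<int>" and mn: "(\<lambda>x. (a \<bullet> x, h \<bullet> x)) ` ?V = {(m, n), (m + 1, n), (m, n + 1)}"
    using std(1) unfolding standard_image_def by blast
  obtain m' n' where Z': "m' \<in> \<int>" "n' \<in> \<int>" and mn': "(\<lambda>x. (b \<bullet> x, h \<bullet> x)) ` ?V = {(m', n'), (m' + 1, n'), (m', n' + 1)}"
    using std(2) unfolding standard_image_def by blast
  have "{n, n + 1} = {n', n' + 1}"
    using standard_image_levels[OF mn] standard_image_levels[OF mn'] by simp
  then have n: "n' = n" by (auto simp: doubleton_eq_iff)
  note mem = standard_image_mem[OF mn] standard_image_mem[OF mn'[unfolded n]]
  have lp: "lattice_polytope P" using P by (simp add: lattice_polytope_3d_def)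
  define C where "C = (\<lambda>x. (a \<bullet> x - m, b \<bullet> x - m', h \<bullet> x - n)) ` ?V"
  have card4: "4 \<le> card C" unfolding C_def by (rule card_coordinates[OF P]) (rule inj)
  have sub: "C \<subseteq> insert (0, 0, 1) square_base"
  proof
    fix p assume "p \<in> C"
    then obtain x where x: "x \<in> ?V" "p = (a \<bullet> x - m, b \<bullet> x - m', h \<bullet> x - n)" unfolding C_def by blast
    show "p \<in> insert (0, 0, 1) square_base"
      unfolding x(2) using mem(1)[OF x(1)] mem(2)[OF x(1)] by (auto simp: square_base_def)
  qed
  have apex: "(0, 0, 1) \<in> C"
  proof -
    have "(m, n + 1) \<in> (\<lambda>x. (a \<bullet> x, h \<bullet> x)) ` ?V" unfolding mn by simp
    then obtain x where x: "x \<in> ?V" "a \<bullet> x = m" "h \<bullet> x = n + 1" by force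
    then have "b \<bullet> x = m'" using mem(2)[OF x(1)] by auto
    then show ?thesis unfolding C_def using x by (intro image_eqI[of _ _ x]) simp_all
  qed
  have misses: "misses_at_most_one C square_base"
    unfolding misses_at_most_one_def
  proof (intro ballI impI, rule ccontr)
    fix p q assume pq: "p \<in> square_base" "q \<in> square_base" "p \<noteq> q" "\<not> (p \<in> C \<or> q \<in> C)"
    have "C \<subseteq> insert (0, 0, 1) square_base - {p, q}" using sub pq(4) by blast
    moreover have fin: "finite (insert (0, 0, 1) square_base)" by (simp add: square_base_def)
    ultimately have "card C \<le> card (insert (0, 0, 1) square_base - {p, q})"
      by (intro card_mono) auto
    also have "\<dots> = card (insert (0, 0, 1) square_base) - card {p, q}"
      using pq(1,2) by (intro card_Diff_subset) auto
    also have "\<dots> = 3" using pq(3) by (simp add: square_base_def)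
    finally show False using card4 by simp
  qed
  have ineq: "m \<le> a \<bullet> x \<and> m' \<le> b \<bullet> x \<and> n \<le> h \<bullet> x \<and> a \<bullet> x + h \<bullet> x \<le> m + n + 1 \<and> b \<bullet> x + h \<bullet> x \<le> m' + n + 1"
    if x: "x \<in> P" for x
  proof -
    have V: "m \<le> a \<bullet> y" "m' \<le> b \<bullet> y" "n \<le> h \<bullet> y" "- (m + n + 1) \<le> (- a - h) \<bullet> y" "- (m' + n + 1) \<le> (- b - h) \<bullet> y"
      if "y \<in> ?V" for y
      using mem(1)[OF that] mem(2)[OF that] by (auto simp: inner_diff_left)
    have "m \<le> a \<bullet> x" "m' \<le> b \<bullet> x" "n \<le> h \<bullet> x" "- (m + n + 1) \<le> (- a - h) \<bullet> x" "- (m' + n + 1) \<le> (- b - h) \<bullet> x"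
      by (rule lattice_polytope_halfspace[OF lp _ x], erule V)+
    then show ?thesis by (simp add: inner_diff_left)
  qed
  show thesis
    by (rule that[OF Z(1) Z'(1) Z(2) ineq]) (use sub apex misses in \<open>simp_all add: C_def\<close>)
qed

definition twisted_vertices :: "(real \<times> real \<times> real) set" where
  "twisted_vertices = {(0, 1, 0), (1, 1, 0), (0, 0, 1), (0, 1, 1)}"

text \<open>Here the base level of one triangle is the apex level of the other. Each level offers
  only two positions, so all four must be taken, and the polytope is the tetrahedron on two
  horizontal edges.\<close>

lemma standard_images_twisted:
  assumes P: "lattice_polytope_3d P"
    and std: "standard_image a h (P \<inter> int_lattice)" "standard_image (- b) (- h) (P \<inter> int_lattice)"
    and inj: "\<And>x. a \<bullet> x = 0 \<Longrightarrow> b \<bullet> x = 0 \<Longrightarrow> h \<bullet> x = 0 \<Longrightarrow> x = 0"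
  obtains m m' n where "m \<in> \<int>" "m' \<in> \<int>" "n \<in> \<int>"
    "\<And>x. x \<in> P \<Longrightarrow> m \<le> a \<bullet> x \<and> n \<le> h \<bullet> x \<and> a \<bullet> x + h \<bullet> x \<le> m + n + 1 \<and>
      b \<bullet> x \<le> m' + 1 \<and> h \<bullet> x \<le> n + 1 \<and> m' + n + 1 \<le> b \<bullet> x + h \<bullet> x"
    "(\<lambda>x. (a \<bullet> x - m, b \<bullet> x - m', h \<bullet> x - n)) ` (P \<inter> int_lattice) = twisted_vertices"
proof -
  let ?V = "P \<inter> int_lattice"
  obtain m n where Z: "m \<in> \<int>" "n \<in> \<int>" and mn: "(\<lambda>x. (a \<bullet> x, h \<bullet> x)) ` ?V = {(m, n), (m + 1, n), (m, n + 1)}"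
    using std(1) unfolding standard_image_def by blast
  obtain p q where Z': "p \<in> \<int>" "q \<in> \<int>" and mn': "(\<lambda>x. (- b \<bullet> x, - h \<bullet> x)) ` ?V = {(p, q), (p + 1, q), (p, q + 1)}"
    using std(2) unfolding standard_image_def by blast
  have "(\<lambda>x. - h \<bullet> x) ` ?V = uminus ` (\<lambda>x. h \<bullet> x) ` ?V" by (simp add: image_image)
  then have "{q, q + 1} = {- n, - n - 1}"
    using standard_image_levels[OF mn] standard_image_levels[OF mn'] by simp
  then have q: "q = - n - 1" by (auto simp: doubleton_eq_iff)
  \<comment> \<open>Shifted so that \<open>b\<close> takes the values \<open>m'\<close> and
    \<open>m' + 1\<close> on the lattice points, as \<open>a\<close> does with
    \<open>m\<close>.\<close>
  define m' where "m' = - p - 1"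
  have p: "p = - m' - 1" by (simp add: m'_def)
  have m': "m' \<in> \<int>" using Z' by (simp add: m'_def)
  note mem = standard_image_mem[OF mn] standard_image_mem[OF mn'[unfolded q p]]
  have lp: "lattice_polytope P" using P by (simp add: lattice_polytope_3d_def)
  define C where "C = (\<lambda>x. (a \<bullet> x - m, b \<bullet> x - m', h \<bullet> x - n)) ` ?V"
  have card4: "4 \<le> card C" unfolding C_def by (rule card_coordinates[OF P]) (rule inj)
  have "C \<subseteq> twisted_vertices"
  proof
    fix r assume "r \<in> C"
    then obtain x where x: "x \<in> ?V" "r = (a \<bullet> x - m, b \<bullet> x - m', h \<bullet> x - n)" unfolding C_def by blast
    show "r \<in> twisted_vertices"
      unfolding x(2) using mem(1)[OF x(1)] mem(2)[OF x(1)] by (auto simp: twisted_vertices_def)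
  qed
  moreover have "card twisted_vertices \<le> card C"
    using card4 by (simp add: twisted_vertices_def)
  ultimately have C: "C = twisted_vertices"
    by (intro card_seteq) (auto simp: twisted_vertices_def)
  have ineq: "m \<le> a \<bullet> x \<and> n \<le> h \<bullet> x \<and> a \<bullet> x + h \<bullet> x \<le> m + n + 1 \<and>
      b \<bullet> x \<le> m' + 1 \<and> h \<bullet> x \<le> n + 1 \<and> m' + n + 1 \<le> b \<bullet> x + h \<bullet> x"
    if x: "x \<in> P" for x
  proof -
    have V: "m \<le> a \<bullet> y" "n \<le> h \<bullet> y" "- (m + n + 1) \<le> (- a - h) \<bullet> y" "- (m' + 1) \<le> (- b) \<bullet> y"
      "- (n + 1) \<le> (- h) \<bullet> y" "m' + n + 1 \<le> (b + h) \<bullet> y" if "y \<in> ?V" for y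
      using mem(1)[OF that] mem(2)[OF that] by (auto simp: inner_diff_left inner_add_left)
    have "m \<le> a \<bullet> x" "n \<le> h \<bullet> x" "- (m + n + 1) \<le> (- a - h) \<bullet> x" "- (m' + 1) \<le> (- b) \<bullet> x"
      "- (n + 1) \<le> (- h) \<bullet> x" "m' + n + 1 \<le> (b + h) \<bullet> x"
      by (rule lattice_polytope_halfspace[OF lp _ x], erule V)+
    then show ?thesis by (simp add: inner_diff_left inner_add_left)
  qed
  show thesis
    by (rule that[OF Z(1) m' Z(2) ineq]) (use C in \<open>simp_all add: C_def\<close>)
qed

lemma misses_at_most_one_image:
  assumes "misses_at_most_one C B"
  shows "misses_at_most_one (f ` C) (f ` B)"
  unfolding misses_at_most_one_def
proof (intro ballI impI)
  fix p q assume "p \<in> f ` B" "q \<in> f ` B" "p \<noteq> q"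
  then obtain p' q' where pq: "p' \<in> B" "q' \<in> B" "p = f p'" "q = f q'" by (elim imageE)
  moreover have "p' \<noteq> q'" using pq \<open>p \<noteq> q\<close> by blast
  ultimately have "p' \<in> C \<or> q' \<in> C" using assms by (simp add: misses_at_most_one_def)
  then show "p \<in> f ` C \<or> q \<in> f ` C" unfolding pq(3,4) by (elim disjE) simp_all
qed

lemma misses_at_most_one_mono: "misses_at_most_one C B \<Longrightarrow> C \<subseteq> D \<Longrightarrow> misses_at_most_one D B"
  unfolding misses_at_most_one_def by blast

section \<open>Shears and membership in the covering families\<close>

lemma shear1_nth [simp]: "shear1 k p $ 1 = p$1" "shear1 k p $ 2 = p$2 + real k * p$3" "shear1 k p $ 3 = p$3"
  by (simp_all add: shear1_def)

lemma shear2_nth [simp]: "shear2 k p $ 1 = p$1 + real k * p$3" "shear2 k p $ 2 = p$2" "shear2 k p $ 3 = p$3"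
  by (simp_all add: shear2_def)

lemma linear_shear1: "linear (shear1 k)" and linear_shear2: "linear (shear2 k)"
  by (rule linearI; simp add: vec3_eq_iff algebra_simps)+

lemma shear1_Q_box: "S \<subseteq> Q_box 0 \<Longrightarrow> shear1 k ` S \<subseteq> Q_box k"
  by (auto simp: Q_box_eq)

lemma shear2_R_box: "S \<subseteq> R_box 0 \<Longrightarrow> shear2 k ` S \<subseteq> R_box k"
  by (auto simp: R_box_eq)

lemma shear_pointed_simplex:
  "shear1 k ` pointed_simplex 0 0 = pointed_simplex 0 k" "shear2 k ` pointed_simplex 0 0 = pointed_simplex k 0"
proof -
  have "shear1 k 0 = 0" "shear1 k (axis 1 1) = axis 1 1" "shear1 k (axis 2 1) = axis 2 1"
    "shear1 k (vector [0, 0, 1]) = vector [0, real k, 1]"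
    by (simp_all add: vec3_eq_iff axis_def)
  then show "shear1 k ` pointed_simplex 0 0 = pointed_simplex 0 k"
    unfolding pointed_simplex_def convex_hull_linear_image[OF linear_shear1] by simp
  have "shear2 k 0 = 0" "shear2 k (axis 1 1) = axis 1 1" "shear2 k (axis 2 1) = axis 2 1"
    "shear2 k (vector [0, 0, 1]) = vector [real k, 0, 1]"
    by (simp_all add: vec3_eq_iff axis_def)
  then show "shear2 k ` pointed_simplex 0 0 = pointed_simplex k 0"
    unfolding pointed_simplex_def convex_hull_linear_image[OF linear_shear2] by simp
qed

lemma covering_familiesI:
  assumes "lattice_polytope_3d S1" "S1 \<subseteq> Q_box 0" "lattice_polytope_3d S2" "S2 \<subseteq> R_box 0"
    "lattice_polytope_3d S3" "S3 \<subseteq> unit_cube" "mixed_degree (triple S1 S2 S3) = 1"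
    and "triple_equiv P (triple (shear1 k ` S1) (shear2 k ` S2) S3)"
  shows "\<exists>F\<in>covering_families. \<exists>k. triple_equiv P (F k)"
proof -
  have "(\<lambda>k. triple (shear1 k ` S1) (shear2 k ` S2) S3) \<in> covering_families"
    using assms(1-7) unfolding covering_families_def by blast
  with assms(8) show ?thesis by (intro bexI[of _ "\<lambda>k. triple (shear1 k ` S1) (shear2 k ` S2) S3"] exI[of _ k])
qed

text \<open>A unimodular simplex with its apex at the bottom. The vertices are listed in the order
  of their images in \<open>example_triple\<close>, namely the origin, the two unit vectors and the
  apex; the same holds for the next two definitions.\<close>

definition flipped_Q :: "(real^3) set" where
  "flipped_Q = convex hull {vector [1, 0, 1], vector [0, 0, 1], vector [1, -1, 1], 0}"

definition flipped_R :: "(real^3) set" where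
  "flipped_R = convex hull {vector [0, 1, 1], vector [-1, 1, 1], vector [0, 0, 1], 0}"

definition flipped_cube :: "(real^3) set" where
  "flipped_cube = convex hull {vector [1, 1, 1], vector [0, 1, 1], vector [1, 0, 1], 0}"

lemma interior_flipped:
  "vector [1/2, -1/4, 3/4] \<in> interior flipped_Q" "vector [-1/4, 1/2, 3/4] \<in> interior flipped_R"
  "vector [1/2, 1/2, 3/4] \<in> interior flipped_cube"
  unfolding flipped_Q_def flipped_R_def flipped_cube_def
  subgoal
    by (rule interior_by_barycentric[of _ "vector [1, 0, 1]" "vector [0, 0, 1]" "vector [1, -1, 1]" 0
        "\<lambda>x. x$1 + x$2" "\<lambda>x. x$3 - x$1" "\<lambda>x. - x$2" "\<lambda>x. 1 - x$3"])
      (auto intro!: continuous_intros hull_inc simp: barycentric_simps)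
  subgoal
    by (rule interior_by_barycentric[of _ "vector [0, 1, 1]" "vector [-1, 1, 1]" "vector [0, 0, 1]" 0
        "\<lambda>x. x$1 + x$2" "\<lambda>x. - x$1" "\<lambda>x. x$3 - x$2" "\<lambda>x. 1 - x$3"])
      (auto intro!: continuous_intros hull_inc simp: barycentric_simps)
  subgoal
    by (rule interior_by_barycentric[of _ "vector [1, 1, 1]" "vector [0, 1, 1]" "vector [1, 0, 1]" 0
        "\<lambda>x. x$1 + x$2 - x$3" "\<lambda>x. x$3 - x$1" "\<lambda>x. x$3 - x$2" "\<lambda>x. 1 - x$3"])
      (auto intro!: continuous_intros hull_inc simp: barycentric_simps)
  done

lemma lattice_polytope_3d_flipped:
  "lattice_polytope_3d flipped_Q" "lattice_polytope_3d flipped_R" "lattice_polytope_3d flipped_cube"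
  using interior_flipped unfolding flipped_Q_def flipped_R_def flipped_cube_def
  by (intro lattice_polytope_3d_hull; auto simp: int_lattice_vector_iff int_lattice_0)+

lemma flipped_bounds:
  "p \<in> flipped_Q \<Longrightarrow> 0 \<le> p$1 \<and> p$1 \<le> p$3 \<and> 0 \<le> p$1 + p$2 \<and> p$1 + p$2 \<le> p$3 \<and> p$3 \<le> 1"
  "p \<in> flipped_R \<Longrightarrow> 0 \<le> p$2 \<and> p$2 \<le> p$3 \<and> 0 \<le> p$1 + p$2 \<and> p$1 + p$2 \<le> p$3 \<and> p$3 \<le> 1"
  "p \<in> flipped_cube \<Longrightarrow> 0 \<le> p$1 \<and> p$1 \<le> p$3 \<and> 0 \<le> p$2 \<and> p$2 \<le> p$3 \<and> p$3 \<le> 1"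
proof -
  have half: "c \<le> u \<bullet> p" if "p \<in> convex hull A" "\<forall>q\<in>A. c \<le> u \<bullet> q" for c u A and p :: "real^3"
    using that hull_minimal[of A "{x. c \<le> u \<bullet> x}" convex] convex_halfspace_ge by blast
  note simps = inner_real3
  show "p \<in> flipped_Q \<Longrightarrow> 0 \<le> p$1 \<and> p$1 \<le> p$3 \<and> 0 \<le> p$1 + p$2 \<and> p$1 + p$2 \<le> p$3 \<and> p$3 \<le> 1"
    using half[of p _ 0 "vector [1, 0, 0]"] half[of p _ 0 "vector [-1, 0, 1]"] half[of p _ 0 "vector [1, 1, 0]"]
      half[of p _ 0 "vector [-1, -1, 1]"] half[of p _ "-1" "vector [0, 0, -1]"]
    unfolding flipped_Q_def by (force simp: simps)
  show "p \<in> flipped_R \<Longrightarrow> 0 \<le> p$2 \<and> p$2 \<le> p$3 \<and> 0 \<le> p$1 + p$2 \<and> p$1 + p$2 \<le> p$3 \<and> p$3 \<le> 1"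
    using half[of p _ 0 "vector [0, 1, 0]"] half[of p _ 0 "vector [0, -1, 1]"] half[of p _ 0 "vector [1, 1, 0]"]
      half[of p _ 0 "vector [-1, -1, 1]"] half[of p _ "-1" "vector [0, 0, -1]"]
    unfolding flipped_R_def by (force simp: simps)
  show "p \<in> flipped_cube \<Longrightarrow> 0 \<le> p$1 \<and> p$1 \<le> p$3 \<and> 0 \<le> p$2 \<and> p$2 \<le> p$3 \<and> p$3 \<le> 1"
    using half[of p _ 0 "vector [1, 0, 0]"] half[of p _ 0 "vector [-1, 0, 1]"] half[of p _ 0 "vector [0, 1, 0]"]
      half[of p _ 0 "vector [0, -1, 1]"] half[of p _ "-1" "vector [0, 0, -1]"]
    unfolding flipped_cube_def by (force simp: simps)
qed

text \<open>The pairs share the same functionals as upright pyramids do, combined with - z. Unlike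
  before the reflection, the three simplices differ, and their sum has an interior lattice
  point.\<close>

lemma mixed_degree_flipped: "mixed_degree (triple flipped_Q flipped_R flipped_cube) = 1"
proof (rule mixed_degree_eq_1)
  show "hollow flipped_Q" by (rule hollow_slab) (use flipped_bounds(1) in fastforce)
  show "hollow flipped_R" by (rule hollow_slab) (use flipped_bounds(2) in fastforce)
  show "hollow flipped_cube" by (rule hollow_slab) (use flipped_bounds(3) in fastforce)
  note simps = inner_real3 int_lattice_vector_iff vec3_eq_iff
  show "hollow (flipped_Q + flipped_R)"
    by (rule hollow_pair[of flipped_Q 0 "vector [1, 1, 0]" "-1" "vector [0, 0, -1]"])
      (use flipped_bounds in \<open>force simp: simps\<close>)+
  show "hollow (flipped_Q + flipped_cube)"
    by (rule hollow_pair[of flipped_Q 0 "vector [1, 0, 0]" "-1" "vector [0, 0, -1]"])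
      (use flipped_bounds in \<open>force simp: simps\<close>)+
  show "hollow (flipped_R + flipped_cube)"
    by (rule hollow_pair[of flipped_R 0 "vector [0, 1, 0]" "-1" "vector [0, 0, -1]"])
      (use flipped_bounds in \<open>force simp: simps\<close>)+
  \<comment> \<open>With the chosen interior point of \<open>flipped_Q\<close> and the point (1/4,
    1/2, 1/2) of \<open>flipped_cube\<close> this adds up to (0, 1, 2).\<close>
  have R: "vector [-3/4, 3/4, 3/4] \<in> flipped_R"
    by (rule convex_segment_point[of flipped_R "vector [-1, 1, 1]" 0 "3/4"])
      (auto simp: flipped_R_def vec3_eq_iff intro!: hull_inc)
  have "(1/4) *\<^sub>R vector [1, 1, 1] + (1/4) *\<^sub>R vector [0, 1, 1] + 0 *\<^sub>R vector [1, 0, 1] + (1/2) *\<^sub>R 0 \<in> flipped_cube"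
    by (rule convex_comb4) (auto simp: flipped_cube_def intro!: hull_inc)
  moreover have "(1/4) *\<^sub>R vector [1, 1, 1] + (1/4) *\<^sub>R vector [0, 1, 1] + 0 *\<^sub>R vector [1, 0, 1] + (1/2) *\<^sub>R 0
      = (vector [1/4, 1/2, 1/2] :: real^3)" by (simp add: vec3_eq_iff)
  ultimately have "vector [1/4, 1/2, 1/2] \<in> flipped_cube" by simp
  then show "\<not> hollow (flipped_Q + flipped_R + flipped_cube)"
    by (rule not_hollow_sum3[OF interior_flipped(1) R]) (simp add: int_lattice_def forall_3)
qed

text \<open>For three equal base triangles \<open>md(P\<^sub>1\<^sup>0, P\<^sub>2\<^sup>0, P\<^sub>3)\<close> would be zero: the unsheared polytopes
  are one and the same unimodular simplex. The reflection \<open>z \<mapsto> 1 - z\<close> turns the triple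
  into a member of another family, with parameter \<open>k + 1\<close>.\<close>

lemma example_triple_covered: "\<exists>F\<in>covering_families. \<exists>j. triple_equiv (example_triple k) (F j)"
proof (rule covering_familiesI[OF lattice_polytope_3d_flipped(1) _ lattice_polytope_3d_flipped(2) _
    lattice_polytope_3d_flipped(3) _ mixed_degree_flipped])
  show "flipped_Q \<subseteq> Q_box 0" using flipped_bounds(1) by (fastforce simp: Q_box_eq)
  show "flipped_R \<subseteq> R_box 0" using flipped_bounds(2) by (fastforce simp: R_box_eq)
  show "flipped_cube \<subseteq> unit_cube" using flipped_bounds(3) by (fastforce simp: unit_cube_eq)
  let ?a = "vector [-1, 0, 1] :: real^3" and ?b = "vector [0, -1, 1] :: real^3"
  let ?h = "(-1) *\<^sub>R axis 3 1 :: real^3" and ?F = "triple (shear1 (k + 1) ` flipped_Q) (shear2 (k + 1) ` flipped_R) flipped_cube"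
  \<comment> \<open>\<open>?U\<close> is (x, y, z) \<mapsto> (z - x, z - y, 1 - z). Applied after a
    shear with parameter k + 1 it equals, up to the translations \<open>?t\<close>, a shear with
    parameter k applied to a reflected point: z - y - (k + 1) z + k = - y + k (1 - z), and likewise
    in x.\<close>
  let ?U = "\<lambda>x. vector [0, 0, 1] + coord_map ?a ?b ?h x"
  let ?t = "\<lambda>i::3. if i = 1 then vector [0, real k, 0] else if i = 2 then vector [real k, 0, 0] else (0 :: real^3)"
  show "triple_equiv (example_triple k) ?F"
  proof (rule triple_equivI[of id ?U ?t])
    show "lattice_automorphism ?U"
      by (rule coord_map_automorphism[of _ _ "-1"]) (auto simp: int_lattice_vector_iff minor12_def)
    show "?t i \<in> int_lattice" for i by (simp add: int_lattice_vector_iff int_lattice_0)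
    have hull: "(+) t ` ?U ` f ` (convex hull W) = convex hull ((\<lambda>x. t + ?U (f x)) ` W)" if "linear f" for t f and W :: "(real^3) set"
    proof -
      have eq: "(+) t ` ?U ` f ` X = (+) t ` (+) (vector [0, 0, 1]) ` coord_map ?a ?b ?h ` f ` X" for X
        by (simp only: image_image)
      have "(+) t ` ?U ` f ` (convex hull W) = convex hull ((+) t ` (+) (vector [0, 0, 1]) ` coord_map ?a ?b ?h ` f ` W)"
        unfolding eq by (simp only: convex_hull_linear_image[OF that] convex_hull_linear_image[OF linear_coord_map]
            convex_hull_translation)
      then show ?thesis by (simp only: image_image)
    qed
    have axes: "(axis 1 1 :: real^3) $ 1 = 1" "(axis 1 1 :: real^3) $ 2 = 0" "(axis 1 1 :: real^3) $ 3 = 0"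
      "(axis 2 1 :: real^3) $ 1 = 0" "(axis 2 1 :: real^3) $ 2 = 1" "(axis 2 1 :: real^3) $ 3 = 0"
      by (simp_all add: axis_def)
    have nth: "(\<lambda>x. t + ?U (f x)) ` {w0, w1, w2, w3} = {0, axis 1 1, axis 2 1, vector [a, b, 1]}"
      if "t + ?U (f w0) = 0" "t + ?U (f w1) = axis 1 1" "t + ?U (f w2) = axis 2 1" "t + ?U (f w3) = vector [a, b, 1]"
      for t f a b and w0 w1 w2 w3 :: "real^3"
      using that by (simp only: image_insert image_empty)
    show "example_triple k i = (+) (?t i) ` ?U ` ?F (id i)" for i
    proof -
      consider "i = 1" | "i = 2" | "i = 3" using exhaust_3[of i] by blast
      then show ?thesis
      proof cases
        case 1
        have "(+) (vector [0, real k, 0]) ` ?U ` shear1 (k + 1) ` flipped_Q = pointed_simplex 0 k"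
          unfolding flipped_Q_def pointed_simplex_def hull[OF linear_shear1]
          by (rule arg_cong[OF nth]; simp add: vec3_eq_iff axes inner_axis' inner_real3[of ?a] inner_real3[of ?b])
        then show ?thesis by (simp add: 1 example_triple_def)
      next
        case 2
        have "(+) (vector [real k, 0, 0]) ` ?U ` shear2 (k + 1) ` flipped_R = pointed_simplex k 0"
          unfolding flipped_R_def pointed_simplex_def hull[OF linear_shear2]
          by (rule arg_cong[OF nth]; simp add: vec3_eq_iff axes inner_axis' inner_real3[of ?a] inner_real3[of ?b])
        then show ?thesis by (simp add: 2 example_triple_def)
      next
        case 3
        have "(+) 0 ` ?U ` (\<lambda>x. x) ` flipped_cube = pointed_simplex 0 0"
          unfolding flipped_cube_def pointed_simplex_def hull[OF linear_id[unfolded id_def]]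
          by (rule arg_cong[OF nth]; simp add: vec3_eq_iff axes inner_axis' inner_real3[of ?a] inner_real3[of ?b])
        then show ?thesis by (simp add: 3 example_triple_def)
      qed
    qed
  qed simp
qed

section \<open>The covering families\<close>

lemma coordinate_image:
  assumes g: "\<And>x. g x = c + coord_map a b h x"
    and "a \<in> int_lattice" "b \<in> int_lattice" "s = 1 \<or> s = -1" "h = s *\<^sub>R axis 3 1"
    and "c \<in> int_lattice" "minor12 a b = 1 \<or> minor12 a b = -1" "lattice_polytope_3d P"
  shows "lattice_polytope_3d (g ` P)" "g ` P \<inter> int_lattice = g ` (P \<inter> int_lattice)"
proof -
  have "lattice_automorphism g"
    unfolding ext[of g, OF g] by (rule coord_map_automorphism[OF assms(2-7)])
  then show "lattice_polytope_3d (g ` P)" "g ` P \<inter> int_lattice = g ` (P \<inter> int_lattice)"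
    using assms(8) lattice_polytope_3d_image lattice_automorphism_image_Int by blast+
qed

text \<open>The three bases have the origin and two unit vectors in common; \<open>v\<close> is the
  fourth corner. If it is missing, the others are present and the lattice points of \<open>S\<close>
  are determined.\<close>

lemma pointed_simplex_eqI:
  assumes S: "lattice_polytope_3d S" "vector [0, 0, 1] \<in> S"
    and sub: "S \<inter> int_lattice \<subseteq> insert (vector [0, 0, 1]) {vector [0, 0, 0], vector [1, 0, 0], vector [0, 1, 0], v}"
    and "misses_at_most_one S {vector [0, 0, 0], vector [1, 0, 0], vector [0, 1, 0], v}" "v \<notin> S"
    and v: "vector [0, 0, 0] \<noteq> v" "vector [1, 0, 0] \<noteq> v" "vector [0, 1, 0] \<noteq> v"
  shows "S = pointed_simplex 0 0"
proof -
  have e: "axis 1 1 = (vector [1, 0, 0] :: real^3)" "axis 2 1 = (vector [0, 1, 0] :: real^3)" "(0 :: real^3) = vector [0, 0, 0]"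
    by (simp_all add: vec3_eq_iff axis_def)
  have "vector [0, 0, 0] \<in> S" "vector [1, 0, 0] \<in> S" "vector [0, 1, 0] \<in> S"
    using misses_at_most_oneD[OF assms(4), of _ v] assms(5) v by simp_all
  then have "S \<inter> int_lattice = {vector [0, 0, 0], vector [1, 0, 0], vector [0, 1, 0], vector [0, 0, 1]}"
    using sub S(2) assms(5) by (auto simp: int_lattice_vector_iff)
  then show ?thesis
    using S(1) lattice_polytope_hull[of S] by (simp add: lattice_polytope_3d_def pointed_simplex_def e)
qed

text \<open>The data left after normalisation; the third functional is derived from them and from
  \<open>k\<close>.\<close>

locale normal_frame =
  fixes a1 a2 h :: "real^3" and s :: real and k :: nat
  assumes a: "a1 \<in> int_lattice" "a2 \<in> int_lattice"
    and minor: "minor12 a1 a2 = 1 \<or> minor12 a1 a2 = -1"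
    and s: "s = 1 \<or> s = -1" and h: "h = s *\<^sub>R axis 3 1"
begin

definition a3 :: "real^3" where "a3 = a1 + a2 - real k *\<^sub>R h"

lemma h_int: "h \<in> int_lattice"
  using s by (auto simp: h intro: int_lattice_intros)

lemma a3_int: "a3 \<in> int_lattice"
  unfolding a3_def by (intro int_lattice_intros a h_int) simp

lemma minors:
  "minor12 a2 a1 = 1 \<or> minor12 a2 a1 = -1" "minor12 a2 a3 = 1 \<or> minor12 a2 a3 = -1"
  "minor12 a1 a3 = 1 \<or> minor12 a1 a3 = -1" "minor12 a2 (a3 - a2) = 1 \<or> minor12 a2 (a3 - a2) = -1"
  "minor12 (a3 - a1) a1 = 1 \<or> minor12 (a3 - a1) a1 = -1"
proof -
  have "h$1 = 0" "h$2 = 0" by (simp_all add: h axis_def)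
  then have "minor12 a2 a1 = - minor12 a1 a2" "minor12 a2 a3 = - minor12 a1 a2" "minor12 a1 a3 = minor12 a1 a2"
    "minor12 a2 (a3 - a2) = - minor12 a1 a2" "minor12 (a3 - a1) a1 = - minor12 a1 a2"
    by (simp_all add: minor12_def a3_def algebra_simps)
  then show "minor12 a2 a1 = 1 \<or> minor12 a2 a1 = -1" "minor12 a2 a3 = 1 \<or> minor12 a2 a3 = -1"
    "minor12 a1 a3 = 1 \<or> minor12 a1 a3 = -1" "minor12 a2 (a3 - a2) = 1 \<or> minor12 a2 (a3 - a2) = -1"
    "minor12 (a3 - a1) a1 = 1 \<or> minor12 (a3 - a1) a1 = -1"
    using minor by auto
qed

definition W :: "real^3 \<Rightarrow> real^3" where "W = coord_map a2 a1 h"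

text \<open>A chart in which x and x + y are the two functionals that see the first polytope,
  normalised to vanish at the corner of the base. \<open>R_map\<close> and \<open>cube_map\<close>
  do the same for the other two.\<close>

definition Q_map :: "real \<Rightarrow> real \<Rightarrow> real \<Rightarrow> real^3 \<Rightarrow> real^3" where
  "Q_map m m' n x = vector [a2 \<bullet> x - m, (a3 \<bullet> x - m') - (a2 \<bullet> x - m), h \<bullet> x - n]"

definition R_map :: "real \<Rightarrow> real \<Rightarrow> real \<Rightarrow> real^3 \<Rightarrow> real^3" where
  "R_map m m' n x = vector [(a3 \<bullet> x - m') - (a1 \<bullet> x - m), a1 \<bullet> x - m, h \<bullet> x - n]"

definition cube_map :: "real \<Rightarrow> real \<Rightarrow> real \<Rightarrow> real^3 \<Rightarrow> real^3" where
  "cube_map m m' n x = vector [a2 \<bullet> x - m, a1 \<bullet> x - m', h \<bullet> x - n]"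

lemma maps_affine:
  "Q_map m m' n x = vector [- m, m - m', - n] + coord_map a2 (a3 - a2) h x"
  "R_map m m' n x = vector [m - m', - m, - n] + coord_map (a3 - a1) a1 h x"
  "cube_map m m' n x = vector [- m, - m', - n] + coord_map a2 a1 h x"
  by (simp_all add: Q_map_def R_map_def cube_map_def vec3_eq_iff inner_diff_left)

lemma map_images:
  assumes "m \<in> \<int>" "m' \<in> \<int>" "n \<in> \<int>" "lattice_polytope_3d P"
  shows "lattice_polytope_3d (Q_map m m' n ` P)" "Q_map m m' n ` P \<inter> int_lattice = Q_map m m' n ` (P \<inter> int_lattice)"
    and "lattice_polytope_3d (R_map m m' n ` P)" "R_map m m' n ` P \<inter> int_lattice = R_map m m' n ` (P \<inter> int_lattice)"
    and "lattice_polytope_3d (cube_map m m' n ` P)" "cube_map m m' n ` P \<inter> int_lattice = cube_map m m' n ` (P \<inter> int_lattice)"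
proof -
  have c: "vector [- m, m - m', - n] \<in> (int_lattice :: (real^3) set)" "vector [m - m', - m, - n] \<in> (int_lattice :: (real^3) set)"
    "vector [- m, - m', - n] \<in> (int_lattice :: (real^3) set)"
    using assms(1-3) by (simp_all add: int_lattice_vector_iff)
  have d: "a3 - a2 \<in> int_lattice" "a3 - a1 \<in> int_lattice" using a a3_int int_lattice_diff by blast+
  show "lattice_polytope_3d (Q_map m m' n ` P)" "Q_map m m' n ` P \<inter> int_lattice = Q_map m m' n ` (P \<inter> int_lattice)"
    by (rule coordinate_image[OF maps_affine(1) a(2) d(1) s h c(1) minors(4) assms(4)])+
  show "lattice_polytope_3d (R_map m m' n ` P)" "R_map m m' n ` P \<inter> int_lattice = R_map m m' n ` (P \<inter> int_lattice)"
    by (rule coordinate_image[OF maps_affine(2) d(2) a(1) s h c(2) minors(5) assms(4)])+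
  show "lattice_polytope_3d (cube_map m m' n ` P)" "cube_map m m' n ` P \<inter> int_lattice = cube_map m m' n ` (P \<inter> int_lattice)"
    by (rule coordinate_image[OF maps_affine(3) a(2) a(1) s h c(3) minors(1) assms(4)])+
qed

text \<open>Horizontally \<open>a3 - a2\<close> is \<open>a1\<close>, and the difference is
  \<open>- k h\<close>. The shear adds this multiple of the height back, so all three charts become
  the one linear map \<open>W\<close> up to lattice translations.\<close>

lemma shear_maps:
  "shear1 k (Q_map m m' n x) = vector [- m, m - m' - real k * n, - n] + W x"
  "shear2 k (R_map m m' n x) = vector [m - m' - real k * n, - m, - n] + W x"
  by (simp_all add: Q_map_def R_map_def W_def a3_def vec3_eq_iff inner_diff_left inner_add_left algebra_simps)

text \<open>Equivalence allows a separate translation for each member, so the normalising constants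
  of the three charts can be independent.\<close>

lemma triple_equiv_maps:
  assumes "m1 \<in> \<int>" "m1' \<in> \<int>" "n1 \<in> \<int>" "m2 \<in> \<int>" "m2' \<in> \<int>" "n2 \<in> \<int>" "m3 \<in> \<int>" "m3' \<in> \<int>" "n3 \<in> \<int>"
  shows "triple_equiv (triple P1 P2 P3)
    (triple (shear1 k ` Q_map m1 m1' n1 ` P1) (shear2 k ` R_map m2 m2' n2 ` P2) (cube_map m3 m3' n3 ` P3))"
proof (rule triple_equiv_sym, rule triple_equivI[of id W])
  let ?t = "\<lambda>i::3. if i = 1 then vector [- m1, m1 - m1' - real k * n1, - n1]
      else if i = 2 then vector [m2 - m2' - real k * n2, - m2, - n2] else (vector [- m3, - m3', - n3] :: real^3)"
  show "lattice_automorphism W"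
    unfolding W_def using coord_map_automorphism[OF a(2) a(1) s h int_lattice_0 minors(1)] by simp
  show "?t i \<in> int_lattice" for i
    using assms by (simp add: int_lattice_vector_iff)
  show "triple (shear1 k ` Q_map m1 m1' n1 ` P1) (shear2 k ` R_map m2 m2' n2 ` P2) (cube_map m3 m3' n3 ` P3) i
      = (+) (?t i) ` W ` triple P1 P2 P3 (id i)" for i
    by (simp add: triple_def image_image shear_maps maps_affine(3) W_def)
qed simp

lemma pyramid_Q:
  assumes P: "lattice_polytope_3d P"
    and std: "standard_image a2 h (P \<inter> int_lattice)" "standard_image a3 h (P \<inter> int_lattice)"
  obtains m m' n where "m \<in> \<int>" "m' \<in> \<int>" "n \<in> \<int>"
    "\<And>p. p \<in> Q_map m m' n ` P \<Longrightarrow> 0 \<le> p$1 \<and> 0 \<le> p$1 + p$2 \<and> 0 \<le> p$3 \<and> p$1 + p$3 \<le> 1 \<and> p$1 + p$2 + p$3 \<le> 1"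
    "Q_map m m' n ` P \<inter> int_lattice \<subseteq> insert (vector [0, 0, 1]) Q_base"
    "vector [0, 0, 1] \<in> Q_map m m' n ` P" "misses_at_most_one (Q_map m m' n ` P) Q_base"
proof -
  have inj: "x = 0" if "a2 \<bullet> x = 0" "a3 \<bullet> x = 0" "h \<bullet> x = 0" for x
    using minor12_inj[OF minors(2) s h that] .
  obtain m m' n where Z: "m \<in> \<int>" "m' \<in> \<int>" "n \<in> \<int>"
    and ineq: "\<And>x. x \<in> P \<Longrightarrow> m \<le> a2 \<bullet> x \<and> m' \<le> a3 \<bullet> x \<and> n \<le> h \<bullet> x \<and> a2 \<bullet> x + h \<bullet> x \<le> m + n + 1 \<and> a3 \<bullet> x + h \<bullet> x \<le> m' + n + 1"
    and C: "(\<lambda>x. (a2 \<bullet> x - m, a3 \<bullet> x - m', h \<bullet> x - n)) ` (P \<inter> int_lattice) \<subseteq> insert (0, 0, 1) square_base" (is "?C \<subseteq> _")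
      "(0, 0, 1) \<in> (\<lambda>x. (a2 \<bullet> x - m, a3 \<bullet> x - m', h \<bullet> x - n)) ` (P \<inter> int_lattice)"
      "misses_at_most_one ((\<lambda>x. (a2 \<bullet> x - m, a3 \<bullet> x - m', h \<bullet> x - n)) ` (P \<inter> int_lattice)) square_base"
    using standard_images_pyramid[OF P std inj] by blast
  \<comment> \<open>Passes from the values of (\<open>a2\<close>, \<open>a3\<close>,
    \<open>h\<close>) to the chart; it takes the unit square to the parallelogram
    \<open>Q_base\<close>.\<close>
  let ?f = "\<lambda>(x, w, z). vector [x, w - x, z] :: real^3"
  have f: "?f ` square_base = Q_base" "?f (0, 0, 1) = vector [0, 0, 1]"
    by (auto simp: square_base_def Q_base_def)
  have fC: "?f ` ?C = Q_map m m' n ` P \<inter> int_lattice"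
    unfolding map_images(2)[OF Z P] by (simp add: image_image Q_map_def)
  show thesis
  proof (rule that[OF Z])
    show "0 \<le> p$1 \<and> 0 \<le> p$1 + p$2 \<and> 0 \<le> p$3 \<and> p$1 + p$3 \<le> 1 \<and> p$1 + p$2 + p$3 \<le> 1"
      if "p \<in> Q_map m m' n ` P" for p
      using that ineq by (fastforce simp: Q_map_def)
    show "Q_map m m' n ` P \<inter> int_lattice \<subseteq> insert (vector [0, 0, 1]) Q_base"
      unfolding fC[symmetric] using image_mono[OF C(1), of ?f] f by (simp only: image_insert)
    show "vector [0, 0, 1] \<in> Q_map m m' n ` P"
      using imageI[OF C(2), of ?f] unfolding fC f(2) by (rule IntD1)
    show "misses_at_most_one (Q_map m m' n ` P) Q_base"
      using misses_at_most_one_image[OF C(3), of ?f] unfolding fC f(1)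
      by (rule misses_at_most_one_mono) (rule Int_lower1)
  qed
qed

lemma pyramid_R:
  assumes P: "lattice_polytope_3d P"
    and std: "standard_image a1 h (P \<inter> int_lattice)" "standard_image a3 h (P \<inter> int_lattice)"
  obtains m m' n where "m \<in> \<int>" "m' \<in> \<int>" "n \<in> \<int>"
    "\<And>p. p \<in> R_map m m' n ` P \<Longrightarrow> 0 \<le> p$2 \<and> 0 \<le> p$1 + p$2 \<and> 0 \<le> p$3 \<and> p$2 + p$3 \<le> 1 \<and> p$1 + p$2 + p$3 \<le> 1"
    "R_map m m' n ` P \<inter> int_lattice \<subseteq> insert (vector [0, 0, 1]) R_base"
    "vector [0, 0, 1] \<in> R_map m m' n ` P" "misses_at_most_one (R_map m m' n ` P) R_base"
proof -
  have inj: "x = 0" if "a1 \<bullet> x = 0" "a3 \<bullet> x = 0" "h \<bullet> x = 0" for x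
    using minor12_inj[OF minors(3) s h that] .
  obtain m m' n where Z: "m \<in> \<int>" "m' \<in> \<int>" "n \<in> \<int>"
    and ineq: "\<And>x. x \<in> P \<Longrightarrow> m \<le> a1 \<bullet> x \<and> m' \<le> a3 \<bullet> x \<and> n \<le> h \<bullet> x \<and> a1 \<bullet> x + h \<bullet> x \<le> m + n + 1 \<and> a3 \<bullet> x + h \<bullet> x \<le> m' + n + 1"
    and C: "(\<lambda>x. (a1 \<bullet> x - m, a3 \<bullet> x - m', h \<bullet> x - n)) ` (P \<inter> int_lattice) \<subseteq> insert (0, 0, 1) square_base" (is "?C \<subseteq> _")
      "(0, 0, 1) \<in> (\<lambda>x. (a1 \<bullet> x - m, a3 \<bullet> x - m', h \<bullet> x - n)) ` (P \<inter> int_lattice)"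
      "misses_at_most_one ((\<lambda>x. (a1 \<bullet> x - m, a3 \<bullet> x - m', h \<bullet> x - n)) ` (P \<inter> int_lattice)) square_base"
    using standard_images_pyramid[OF P std inj] by blast
  let ?f = "\<lambda>(y, w, z). vector [w - y, y, z] :: real^3"
  have f: "?f ` square_base = R_base" "?f (0, 0, 1) = vector [0, 0, 1]"
    by (auto simp: square_base_def R_base_def)
  have fC: "?f ` ?C = R_map m m' n ` P \<inter> int_lattice"
    unfolding map_images(4)[OF Z P] by (simp add: image_image R_map_def)
  show thesis
  proof (rule that[OF Z])
    show "0 \<le> p$2 \<and> 0 \<le> p$1 + p$2 \<and> 0 \<le> p$3 \<and> p$2 + p$3 \<le> 1 \<and> p$1 + p$2 + p$3 \<le> 1"
      if "p \<in> R_map m m' n ` P" for p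
      using that ineq by (fastforce simp: R_map_def)
    show "R_map m m' n ` P \<inter> int_lattice \<subseteq> insert (vector [0, 0, 1]) R_base"
      unfolding fC[symmetric] using image_mono[OF C(1), of ?f] f by (simp only: image_insert)
    show "vector [0, 0, 1] \<in> R_map m m' n ` P"
      using imageI[OF C(2), of ?f] unfolding fC f(2) by (rule IntD1)
    show "misses_at_most_one (R_map m m' n ` P) R_base"
      using misses_at_most_one_image[OF C(3), of ?f] unfolding fC f(1)
      by (rule misses_at_most_one_mono) (rule Int_lower1)
  qed
qed

lemma pyramid_cube:
  assumes P: "lattice_polytope_3d P"
    and std: "standard_image a2 h (P \<inter> int_lattice)" "standard_image a1 h (P \<inter> int_lattice)"
  obtains m m' n where "m \<in> \<int>" "m' \<in> \<int>" "n \<in> \<int>"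
    "\<And>p. p \<in> cube_map m m' n ` P \<Longrightarrow> 0 \<le> p$1 \<and> 0 \<le> p$2 \<and> 0 \<le> p$3 \<and> p$1 + p$3 \<le> 1 \<and> p$2 + p$3 \<le> 1"
    "cube_map m m' n ` P \<inter> int_lattice \<subseteq> insert (vector [0, 0, 1]) cube_base"
    "vector [0, 0, 1] \<in> cube_map m m' n ` P" "misses_at_most_one (cube_map m m' n ` P) cube_base"
proof -
  have inj: "x = 0" if "a2 \<bullet> x = 0" "a1 \<bullet> x = 0" "h \<bullet> x = 0" for x
    using minor12_inj[OF minors(1) s h that] .
  obtain m m' n where Z: "m \<in> \<int>" "m' \<in> \<int>" "n \<in> \<int>"
    and ineq: "\<And>x. x \<in> P \<Longrightarrow> m \<le> a2 \<bullet> x \<and> m' \<le> a1 \<bullet> x \<and> n \<le> h \<bullet> x \<and> a2 \<bullet> x + h \<bullet> x \<le> m + n + 1 \<and> a1 \<bullet> x + h \<bullet> x \<le> m' + n + 1"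
    and C: "(\<lambda>x. (a2 \<bullet> x - m, a1 \<bullet> x - m', h \<bullet> x - n)) ` (P \<inter> int_lattice) \<subseteq> insert (0, 0, 1) square_base" (is "?C \<subseteq> _")
      "(0, 0, 1) \<in> (\<lambda>x. (a2 \<bullet> x - m, a1 \<bullet> x - m', h \<bullet> x - n)) ` (P \<inter> int_lattice)"
      "misses_at_most_one ((\<lambda>x. (a2 \<bullet> x - m, a1 \<bullet> x - m', h \<bullet> x - n)) ` (P \<inter> int_lattice)) square_base"
    using standard_images_pyramid[OF P std inj] by blast
  let ?f = "\<lambda>(x, y, z). vector [x, y, z] :: real^3"
  have f: "?f ` square_base = cube_base" "?f (0, 0, 1) = vector [0, 0, 1]"
    by (auto simp: square_base_def cube_base_def)
  have fC: "?f ` ?C = cube_map m m' n ` P \<inter> int_lattice"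
    unfolding map_images(6)[OF Z P] by (simp add: image_image cube_map_def)
  show thesis
  proof (rule that[OF Z])
    show "0 \<le> p$1 \<and> 0 \<le> p$2 \<and> 0 \<le> p$3 \<and> p$1 + p$3 \<le> 1 \<and> p$2 + p$3 \<le> 1"
      if "p \<in> cube_map m m' n ` P" for p
      using that ineq by (fastforce simp: cube_map_def)
    show "cube_map m m' n ` P \<inter> int_lattice \<subseteq> insert (vector [0, 0, 1]) cube_base"
      unfolding fC[symmetric] using image_mono[OF C(1), of ?f] f by (simp only: image_insert)
    show "vector [0, 0, 1] \<in> cube_map m m' n ` P"
      using imageI[OF C(2), of ?f] unfolding fC f(2) by (rule IntD1)
    show "misses_at_most_one (cube_map m m' n ` P) cube_base"
      using misses_at_most_one_image[OF C(3), of ?f] unfolding fC f(1)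
      by (rule misses_at_most_one_mono) (rule Int_lower1)
  qed
qed

lemma twisted_Q:
  assumes P: "lattice_polytope_3d P"
    and std: "standard_image a2 h (P \<inter> int_lattice)" "standard_image (- a3) (- h) (P \<inter> int_lattice)"
  obtains m m' n where "m \<in> \<int>" "m' \<in> \<int>" "n \<in> \<int>"
    "\<And>p. p \<in> Q_map m m' n ` P \<Longrightarrow> 0 \<le> p$1 \<and> 0 \<le> p$3 \<and> p$1 + p$3 \<le> 1 \<and> p$1 + p$2 \<le> 1 \<and> p$3 \<le> 1 \<and> 1 \<le> p$1 + p$2 + p$3"
    "{vector [0, 1, 0], vector [1, 0, 0], vector [0, 0, 1], vector [0, 1, 1]} \<subseteq> Q_map m m' n ` P"
proof -
  have inj: "x = 0" if "a2 \<bullet> x = 0" "a3 \<bullet> x = 0" "h \<bullet> x = 0" for x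
    using minor12_inj[OF minors(2) s h that] .
  obtain m m' n where Z: "m \<in> \<int>" "m' \<in> \<int>" "n \<in> \<int>"
    and ineq: "\<And>x. x \<in> P \<Longrightarrow> m \<le> a2 \<bullet> x \<and> n \<le> h \<bullet> x \<and> a2 \<bullet> x + h \<bullet> x \<le> m + n + 1 \<and>
      a3 \<bullet> x \<le> m' + 1 \<and> h \<bullet> x \<le> n + 1 \<and> m' + n + 1 \<le> a3 \<bullet> x + h \<bullet> x"
    and C: "(\<lambda>x. (a2 \<bullet> x - m, a3 \<bullet> x - m', h \<bullet> x - n)) ` (P \<inter> int_lattice) = twisted_vertices" (is "?C = _")
    using standard_images_twisted[OF P std inj] by blast
  let ?f = "\<lambda>(x, w, z). vector [x, w - x, z] :: real^3"
  have "?f ` ?C = Q_map m m' n ` P \<inter> int_lattice"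
    unfolding map_images(2)[OF Z P] by (simp add: image_image Q_map_def)
  moreover have "?f ` ?C = {vector [0, 1, 0], vector [1, 0, 0], vector [0, 0, 1], vector [0, 1, 1]}"
    unfolding C by (simp add: twisted_vertices_def)
  ultimately have sub: "{vector [0, 1, 0], vector [1, 0, 0], vector [0, 0, 1], vector [0, 1, 1]} \<subseteq> Q_map m m' n ` P"
    by (metis Int_lower1)
  show thesis
  proof (rule that[OF Z _ sub])
    show "0 \<le> p$1 \<and> 0 \<le> p$3 \<and> p$1 + p$3 \<le> 1 \<and> p$1 + p$2 \<le> 1 \<and> p$3 \<le> 1 \<and> 1 \<le> p$1 + p$2 + p$3"
      if "p \<in> Q_map m m' n ` P" for p
      using that ineq by (fastforce simp: Q_map_def)
  qed
qed

lemma twisted_R: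
  assumes P: "lattice_polytope_3d P"
    and std: "standard_image a1 h (P \<inter> int_lattice)" "standard_image (- a3) (- h) (P \<inter> int_lattice)"
  obtains m m' n where "m \<in> \<int>" "m' \<in> \<int>" "n \<in> \<int>"
    "\<And>p. p \<in> R_map m m' n ` P \<Longrightarrow> 0 \<le> p$2 \<and> 0 \<le> p$3 \<and> p$2 + p$3 \<le> 1 \<and> p$1 + p$2 \<le> 1 \<and> p$3 \<le> 1 \<and> 1 \<le> p$1 + p$2 + p$3"
    "{vector [1, 0, 0], vector [0, 1, 0], vector [0, 0, 1], vector [1, 0, 1]} \<subseteq> R_map m m' n ` P"
proof -
  have inj: "x = 0" if "a1 \<bullet> x = 0" "a3 \<bullet> x = 0" "h \<bullet> x = 0" for x
    using minor12_inj[OF minors(3) s h that] .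
  obtain m m' n where Z: "m \<in> \<int>" "m' \<in> \<int>" "n \<in> \<int>"
    and ineq: "\<And>x. x \<in> P \<Longrightarrow> m \<le> a1 \<bullet> x \<and> n \<le> h \<bullet> x \<and> a1 \<bullet> x + h \<bullet> x \<le> m + n + 1 \<and>
      a3 \<bullet> x \<le> m' + 1 \<and> h \<bullet> x \<le> n + 1 \<and> m' + n + 1 \<le> a3 \<bullet> x + h \<bullet> x"
    and C: "(\<lambda>x. (a1 \<bullet> x - m, a3 \<bullet> x - m', h \<bullet> x - n)) ` (P \<inter> int_lattice) = twisted_vertices" (is "?C = _")
    using standard_images_twisted[OF P std inj] by blast
  let ?f = "\<lambda>(y, w, z). vector [w - y, y, z] :: real^3"
  have "?f ` ?C = R_map m m' n ` P \<inter> int_lattice"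
    unfolding map_images(4)[OF Z P] by (simp add: image_image R_map_def)
  moreover have "?f ` ?C = {vector [1, 0, 0], vector [0, 1, 0], vector [0, 0, 1], vector [1, 0, 1]}"
    unfolding C by (simp add: twisted_vertices_def)
  ultimately have sub: "{vector [1, 0, 0], vector [0, 1, 0], vector [0, 0, 1], vector [1, 0, 1]} \<subseteq> R_map m m' n ` P"
    by (metis Int_lower1)
  show thesis
  proof (rule that[OF Z _ sub])
    show "0 \<le> p$2 \<and> 0 \<le> p$3 \<and> p$2 + p$3 \<le> 1 \<and> p$1 + p$2 \<le> 1 \<and> p$3 \<le> 1 \<and> 1 \<le> p$1 + p$2 + p$3"
      if "p \<in> R_map m m' n ` P" for p
      using that ineq by (fastforce simp: R_map_def)
  qed
qed

lemma lattice_polytope_3d_convex: "lattice_polytope_3d P \<Longrightarrow> convex P"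
  by (simp add: lattice_polytope_3d_def lattice_polytope_convex)

text \<open>A fourth corner in any of the three bases yields an interior lattice point of the total
  sum. If none is present, all unsheared polytopes are the same simplex, and the triple is
  equivalent to \<open>example_triple k\<close>.\<close>

lemma covered_pyramids:
  assumes P: "lattice_polytope_3d P1" "lattice_polytope_3d P2" "lattice_polytope_3d P3"
    and std: "standard_image a2 h (P1 \<inter> int_lattice)" "standard_image a3 h (P1 \<inter> int_lattice)"
      "standard_image a1 h (P2 \<inter> int_lattice)" "standard_image a3 h (P2 \<inter> int_lattice)"
      "standard_image a2 h (P3 \<inter> int_lattice)" "standard_image a1 h (P3 \<inter> int_lattice)"
  shows "\<exists>F\<in>covering_families. \<exists>j. triple_equiv (triple P1 P2 P3) (F j)"
proof -
  obtain m1 m1' n1 where Z1: "m1 \<in> \<int>" "m1' \<in> \<int>" "n1 \<in> \<int>"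
    and S1: "\<And>p. p \<in> Q_map m1 m1' n1 ` P1 \<Longrightarrow> 0 \<le> p$1 \<and> 0 \<le> p$1 + p$2 \<and> 0 \<le> p$3 \<and> p$1 + p$3 \<le> 1 \<and> p$1 + p$2 + p$3 \<le> 1"
      "Q_map m1 m1' n1 ` P1 \<inter> int_lattice \<subseteq> insert (vector [0, 0, 1]) Q_base"
      "vector [0, 0, 1] \<in> Q_map m1 m1' n1 ` P1" "misses_at_most_one (Q_map m1 m1' n1 ` P1) Q_base"
    using pyramid_Q[OF P(1) std(1,2)] by blast
  obtain m2 m2' n2 where Z2: "m2 \<in> \<int>" "m2' \<in> \<int>" "n2 \<in> \<int>"
    and S2: "\<And>p. p \<in> R_map m2 m2' n2 ` P2 \<Longrightarrow> 0 \<le> p$2 \<and> 0 \<le> p$1 + p$2 \<and> 0 \<le> p$3 \<and> p$2 + p$3 \<le> 1 \<and> p$1 + p$2 + p$3 \<le> 1"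
      "R_map m2 m2' n2 ` P2 \<inter> int_lattice \<subseteq> insert (vector [0, 0, 1]) R_base"
      "vector [0, 0, 1] \<in> R_map m2 m2' n2 ` P2" "misses_at_most_one (R_map m2 m2' n2 ` P2) R_base"
    using pyramid_R[OF P(2) std(3,4)] by blast
  obtain m3 m3' n3 where Z3: "m3 \<in> \<int>" "m3' \<in> \<int>" "n3 \<in> \<int>"
    and S3: "\<And>p. p \<in> cube_map m3 m3' n3 ` P3 \<Longrightarrow> 0 \<le> p$1 \<and> 0 \<le> p$2 \<and> 0 \<le> p$3 \<and> p$1 + p$3 \<le> 1 \<and> p$2 + p$3 \<le> 1"
      "cube_map m3 m3' n3 ` P3 \<inter> int_lattice \<subseteq> insert (vector [0, 0, 1]) cube_base"
      "vector [0, 0, 1] \<in> cube_map m3 m3' n3 ` P3" "misses_at_most_one (cube_map m3 m3' n3 ` P3) cube_base"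
    using pyramid_cube[OF P(3) std(5,6)] by blast
  note L = map_images(1)[OF Z1 P(1)] map_images(3)[OF Z2 P(2)] map_images(5)[OF Z3 P(3)]
  have equiv: "triple_equiv (triple P1 P2 P3)
      (triple (shear1 k ` Q_map m1 m1' n1 ` P1) (shear2 k ` R_map m2 m2' n2 ` P2) (cube_map m3 m3' n3 ` P3))"
    by (intro triple_equiv_maps Z1 Z2 Z3)
  show ?thesis
  proof (cases "vector [1, -1, 0] \<in> Q_map m1 m1' n1 ` P1 \<or> vector [-1, 1, 0] \<in> R_map m2 m2' n2 ` P2
      \<or> vector [1, 1, 0] \<in> cube_map m3 m3' n3 ` P3")
    case True
    show ?thesis
    proof (rule covering_familiesI[OF L(1) _ L(2) _ L(3) _ _ equiv])
      show "Q_map m1 m1' n1 ` P1 \<subseteq> Q_box 0" using S1(1) unfolding Q_box_eq by fastforce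
      show "R_map m2 m2' n2 ` P2 \<subseteq> R_box 0" using S2(1) unfolding R_box_eq by fastforce
      show "cube_map m3 m3' n3 ` P3 \<subseteq> unit_cube" using S3(1) unfolding unit_cube_eq by fastforce
      show "mixed_degree (triple (Q_map m1 m1' n1 ` P1) (R_map m2 m2' n2 ` P2) (cube_map m3 m3' n3 ` P3)) = 1"
        by (rule mixed_degree_pyramids[OF S1(1) S2(1) S3(1)], assumption+)
          (rule not_hollow_pyramids[OF lattice_polytope_3d_convex[OF L(1)] lattice_polytope_3d_convex[OF L(2)]
            lattice_polytope_3d_convex[OF L(3)] S1(3) S2(3) S3(3) S1(4) S2(4) S3(4) True])
    qed
  next
    case False
    have "Q_map m1 m1' n1 ` P1 = pointed_simplex 0 0"
      by (rule pointed_simplex_eqI[OF L(1) S1(3) S1(2,4)[unfolded Q_base_def]]) (use False base_distinct in blast)+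
    moreover have "R_map m2 m2' n2 ` P2 = pointed_simplex 0 0"
      by (rule pointed_simplex_eqI[OF L(2) S2(3) S2(2,4)[unfolded R_base_def]]) (use False base_distinct in blast)+
    moreover have "cube_map m3 m3' n3 ` P3 = pointed_simplex 0 0"
      by (rule pointed_simplex_eqI[OF L(3) S3(3) S3(2,4)[unfolded cube_base_def]]) (use False base_distinct in blast)+
    ultimately have "triple_equiv (triple P1 P2 P3) (example_triple k)"
      using equiv by (simp add: shear_pointed_simplex example_triple_def)
    then show ?thesis using example_triple_covered[of k] triple_equiv_trans by blast
  qed
qed

text \<open>The two tetrahedra are completely determined, so one certificate serves every third
  polytope and no exceptional case arises.\<close>

lemma covered_twisted:
  assumes P: "lattice_polytope_3d P1" "lattice_polytope_3d P2" "lattice_polytope_3d P3"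
    and std: "standard_image a2 h (P1 \<inter> int_lattice)" "standard_image (- a3) (- h) (P1 \<inter> int_lattice)"
      "standard_image a1 h (P2 \<inter> int_lattice)" "standard_image (- a3) (- h) (P2 \<inter> int_lattice)"
      "standard_image a2 h (P3 \<inter> int_lattice)" "standard_image a1 h (P3 \<inter> int_lattice)"
  shows "\<exists>F\<in>covering_families. \<exists>j. triple_equiv (triple P1 P2 P3) (F j)"
proof -
  obtain m1 m1' n1 where Z1: "m1 \<in> \<int>" "m1' \<in> \<int>" "n1 \<in> \<int>"
    and S1: "\<And>p. p \<in> Q_map m1 m1' n1 ` P1 \<Longrightarrow> 0 \<le> p$1 \<and> 0 \<le> p$3 \<and> p$1 + p$3 \<le> 1 \<and> p$1 + p$2 \<le> 1 \<and> p$3 \<le> 1 \<and> 1 \<le> p$1 + p$2 + p$3"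
      "{vector [0, 1, 0], vector [1, 0, 0], vector [0, 0, 1], vector [0, 1, 1]} \<subseteq> Q_map m1 m1' n1 ` P1"
    using twisted_Q[OF P(1) std(1,2)] by blast
  obtain m2 m2' n2 where Z2: "m2 \<in> \<int>" "m2' \<in> \<int>" "n2 \<in> \<int>"
    and S2: "\<And>p. p \<in> R_map m2 m2' n2 ` P2 \<Longrightarrow> 0 \<le> p$2 \<and> 0 \<le> p$3 \<and> p$2 + p$3 \<le> 1 \<and> p$1 + p$2 \<le> 1 \<and> p$3 \<le> 1 \<and> 1 \<le> p$1 + p$2 + p$3"
      "{vector [1, 0, 0], vector [0, 1, 0], vector [0, 0, 1], vector [1, 0, 1]} \<subseteq> R_map m2 m2' n2 ` P2"
    using twisted_R[OF P(2) std(3,4)] by blast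
  obtain m3 m3' n3 where Z3: "m3 \<in> \<int>" "m3' \<in> \<int>" "n3 \<in> \<int>"
    and S3: "\<And>p. p \<in> cube_map m3 m3' n3 ` P3 \<Longrightarrow> 0 \<le> p$1 \<and> 0 \<le> p$2 \<and> 0 \<le> p$3 \<and> p$1 + p$3 \<le> 1 \<and> p$2 + p$3 \<le> 1"
      "cube_map m3 m3' n3 ` P3 \<inter> int_lattice \<subseteq> insert (vector [0, 0, 1]) cube_base"
      "vector [0, 0, 1] \<in> cube_map m3 m3' n3 ` P3" "misses_at_most_one (cube_map m3 m3' n3 ` P3) cube_base"
    using pyramid_cube[OF P(3) std(5,6)] by blast
  note L = map_images(1)[OF Z1 P(1)] map_images(3)[OF Z2 P(2)] map_images(5)[OF Z3 P(3)]
  have equiv: "triple_equiv (triple P1 P2 P3)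
      (triple (shear1 k ` Q_map m1 m1' n1 ` P1) (shear2 k ` R_map m2 m2' n2 ` P2) (cube_map m3 m3' n3 ` P3))"
    by (intro triple_equiv_maps Z1 Z2 Z3)
  show ?thesis
  proof (rule covering_familiesI[OF L(1) _ L(2) _ L(3) _ _ equiv])
    show "Q_map m1 m1' n1 ` P1 \<subseteq> Q_box 0" using S1(1) unfolding Q_box_eq by fastforce
    show "R_map m2 m2' n2 ` P2 \<subseteq> R_box 0" using S2(1) unfolding R_box_eq by fastforce
    show "cube_map m3 m3' n3 ` P3 \<subseteq> unit_cube" using S3(1) unfolding unit_cube_eq by fastforce
    show "mixed_degree (triple (Q_map m1 m1' n1 ` P1) (R_map m2 m2' n2 ` P2) (cube_map m3 m3' n3 ` P3)) = 1"
      by (rule mixed_degree_twisted[OF lattice_polytope_3d_convex[OF L(1)] lattice_polytope_3d_convex[OF L(2)]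
        lattice_polytope_3d_convex[OF L(3)] S1(2) S2(2) S3(3,4) S1(1) S2(1) S3(1)], assumption+)
  qed
qed

end

lemma projecting_triples_covered:
  assumes "P \<in> projecting_triples"
  shows "\<exists>F\<in>covering_families. \<exists>j. triple_equiv P (F j)"
proof -
  obtain \<sigma> :: "3 \<Rightarrow> 3" and a1 a2 h s \<eta> and k :: nat where \<sigma>: "bij \<sigma>"
    and a: "a1 \<in> int_lattice" "a2 \<in> int_lattice" "minor12 a1 a2 = 1 \<or> minor12 a1 a2 = -1"
      "s = 1 \<or> s = -1" "h = s *\<^sub>R axis 3 1" and \<eta>: "\<eta> = 1 \<or> \<eta> = -1"
    and std: "standard_image a1 h (P (\<sigma> 2) \<inter> int_lattice)" "standard_image a1 h (P (\<sigma> 3) \<inter> int_lattice)"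
      "standard_image a2 h (P (\<sigma> 1) \<inter> int_lattice)" "standard_image a2 h (P (\<sigma> 3) \<inter> int_lattice)"
      "standard_image (\<eta> *\<^sub>R (a1 + a2 - real k *\<^sub>R h)) (\<eta> *\<^sub>R h) (P (\<sigma> 1) \<inter> int_lattice)"
      "standard_image (\<eta> *\<^sub>R (a1 + a2 - real k *\<^sub>R h)) (\<eta> *\<^sub>R h) (P (\<sigma> 2) \<inter> int_lattice)"
    using projecting_triples_normal_form[OF assms] .
  interpret normal_frame a1 a2 h s k using a by unfold_locales
  have P: "lattice_polytope_3d (P i)" for i using assms by (simp add: projecting_triples_def)
  note std' = std(5,6)[folded a3_def]
  \<comment> \<open>Measured by \<open>h\<close>, the third functional sees its horizontal edge on
    the lower level for \<open>\<eta>\<close> = 1 and on the upper level for \<open>\<eta>\<close> =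
    -1.\<close>
  have "\<exists>F\<in>covering_families. \<exists>j. triple_equiv (triple (P (\<sigma> 1)) (P (\<sigma> 2)) (P (\<sigma> 3))) (F j)"
    using \<eta>
  proof
    assume "\<eta> = 1"
    then show ?thesis using std std' by (intro covered_pyramids P) simp_all
  next
    assume "\<eta> = -1"
    then show ?thesis using std std' by (intro covered_twisted P) simp_all
  qed
  moreover have "triple (P (\<sigma> 1)) (P (\<sigma> 2)) (P (\<sigma> 3)) = (\<lambda>i. P (\<sigma> i))"
  proof
    show "triple (P (\<sigma> 1)) (P (\<sigma> 2)) (P (\<sigma> 3)) i = P (\<sigma> i)" for i
      using exhaust_3[of i] by (auto simp: triple_def)
  qed
  ultimately show ?thesis
    using triple_equiv_trans[OF triple_equiv_sym[OF triple_equiv_permute[OF \<sigma>, of P]]] by metis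
qed

text \<open>Containment follows from the covering because the shears carry \<open>Q_box 0\<close>
  and \<open>R_box 0\<close> into the boxes with the same parameter.\<close>

lemma contained_if_covered:
  assumes "F \<in> covering_families" "triple_equiv P (F k)"
  shows "contained_up_to_equiv P (triple (Q_box k) (R_box k) unit_cube)"
proof -
  obtain P1 P2 P3 where "F = (\<lambda>k. triple (shear1 k ` P1) (shear2 k ` P2) P3)"
    "P1 \<subseteq> Q_box 0" "P2 \<subseteq> R_box 0" "P3 \<subseteq> unit_cube"
    using assms(1) unfolding covering_families_def by blast
  then have "F k i \<subseteq> triple (Q_box k) (R_box k) unit_cube i" for i
    using shear1_Q_box[of P1 k] shear2_R_box[of P2 k] by (simp add: triple_def)
  then show ?thesis using assms(2) unfolding contained_up_to_equiv_def by blast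
qed

theorem proposition4p7:
  shows "infinite (projecting_triples // {(P, Q). triple_equiv P Q}) \<and>
    (\<forall>P\<in>projecting_triples. \<exists>k. contained_up_to_equiv P (triple (Q_box k) (R_box k) unit_cube)) \<and>
    (\<forall>k. mixed_degree (triple (Q_box k) (R_box k) unit_cube) = 2) \<and>
    finite covering_families \<and>
    covered_up_to_equiv projecting_triples covering_families"
proof (intro conjI allI ballI)
  show "infinite (projecting_triples // {(P, Q). triple_equiv P Q})" by (rule infinite_classes)
  show "\<exists>k. contained_up_to_equiv P (triple (Q_box k) (R_box k) unit_cube)" if P: "P \<in> projecting_triples" for P
    using projecting_triples_covered[OF P] contained_if_covered by blast
  show "mixed_degree (triple (Q_box k) (R_box k) unit_cube) = 2" for k by (rule mixed_degree_boxes)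
  show "finite covering_families" by (rule finite_covering_families)
  show "covered_up_to_equiv projecting_triples covering_families"
    using projecting_triples_covered by (simp add: covered_up_to_equiv_def)
qed

end
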